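(* Let $T>0$, $n\ge1$, and let $F:[0,T]\times\mathbb{R}^n\times\mathbb{R}\times\mathbb{R}^n\times S^n\to\mathbb{R}$ satisfy the structural assumptions (A0)–(A2) and (A3') listed in the context. Let $u:[0,T]\times\mathbb{R}^n\to\mathbb{R}$ be a bounded continuous function which is a viscosity solution of $\partial_tu-F(t,x,u,Du,D^2u)=0$ on $(0,T)\times\mathbb{R}^n$ and whose initial data $u_0=u(0,\cdot)$ is bounded and uniformly continuous on $\mathbb{R}^n$. Then $u$ is bounded and uniformly continuous on $[0,T]\times\mathbb{R}^n$ (jointly in $(t,x)$).
   Context: $S^n$ is the space of real symmetric $n\times n$ matrices with its usual partial order; $I$ is the identity matrix. Structural assumptions on $F=F(t,x,u,p,X)$: (A0) $F$ is continuous and degenerate elliptic, i.e. non-decreasing in $X$: $F(t,x,u,p,X)\le F(t,x,u,p,X+B)$ whenever $B\ge 0$. (A1) There is $\gamma\in\mathbb{R}$ such that, for all $t,x,p,X$, $\gamma(u-v)\le F(t,x,v,p,X)-F(t,x,u,p,X)$ whenever $v\le u$. (A2) For every $R>0$ there is a function $\theta_R:[0,\infty]\to[0,\infty]$ with $\theta_R(0+)=0$ such that $$F(t,x,r,\alpha(x-\tilde x),X)-F(t,\tilde x,r,\alpha(x-\tilde x),Y)\le\theta_R\left(\alpha|x-\tilde x|^2+|x-\tilde x|\right)$$ for all $t\in[0,T]$, $x,\tilde x\in\mathbb{R}^n$, $r\in[-R,R]$, $\alpha>0$ and all $X,Y\in S^n$ satisfying $$-3\alpha\begin{pmatrix}I&0\\0&I\end{pmatrix}\le\begin{pmatrix}X&0\\0&-Y\end{pmatrix}\le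 3\alpha\begin{pmatrix}I&-I\\-I&I\end{pmatrix}.$$ (A3') For every $R>0$, the restriction of $F$ to $[0,T]\times\mathbb{R}^n\times[-R,R]\times B_R\times M_R$ is bounded and uniformly continuous, where $B_R\subset\mathbb{R}^n$ and $M_R\subset S^n$ are the open balls of radius $R$ centered at $0$. Viscosity notions on $D=(0,T)\times\mathbb{R}^n$: an upper semicontinuous function $u$ is a viscosity subsolution on $D$ if for every $(\bar t,\bar x)\in D$ and every test function $\varphi$ (of class $C^1$ in $t$ and $C^2$ in $x$ near $(\bar t,\bar x)$) such that $u-\varphi$ has a local maximum relative to $D$ at $(\bar t,\bar x)$, one has $\partial_t\varphi(\bar t,\bar x)-F(\bar t,\bar x,u(\bar t,\bar x),D\varphi(\bar t,\bar x),D^2\varphi(\bar t,\bar x))\le 0$. A lower semicontinuous function is a viscosity supersolution on $D$ if the same holds with "local maximum" replaced by "local minimum" and "$\le0$" by "$\ge0$". A viscosity solution is both a viscosity sub- and supersolution. *)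

theory Defs
  imports "HOL-Analysis.Analysis"
begin

definition sym_mats :: "(real ^ 'n ^ 'n) set"
  where "sym_mats = {A. transpose A = A}"

text \<open>
  The library order on \<^typ>\<open>real ^ 'n ^ 'n\<close> is entrywise, so the usual partial order of symmetric
  matrices has to be introduced separately.
\<close>

definition psd :: "real ^ 'n ^ 'n \<Rightarrow> bool"
  where "psd A \<longleftrightarrow> A \<in> sym_mats \<and> (\<forall>v. 0 \<le> v \<bullet> (A *v v))"

definition mat_le :: "real ^ 'n ^ 'n \<Rightarrow> real ^ 'n ^ 'n \<Rightarrow> bool"  (infix "\<preceq>" 50)
  where "A \<preceq> B \<longleftrightarrow> psd (B - A)"

text \<open>\<open>block_mat A B C D\<close> has first block row \<open>A B\<close> and second block row \<open>C D\<close>.\<close>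

definition block_mat ::
    "real ^ 'n ^ 'n \<Rightarrow> real ^ 'n ^ 'n \<Rightarrow> real ^ 'n ^ 'n \<Rightarrow> real ^ 'n ^ 'n \<Rightarrow>
      real ^ ('n + 'n) ^ ('n + 'n)"
  where "block_mat A B C D = (\<chi> i j.
    case i of
      Inl a \<Rightarrow> (case j of Inl b \<Rightarrow> A $ a $ b | Inr b \<Rightarrow> B $ a $ b)
    | Inr a \<Rightarrow> (case j of Inl b \<Rightarrow> C $ a $ b | Inr b \<Rightarrow> D $ a $ b))"


text \<open>
  A nonlinearity \<open>F t x r p X\<close> is a total function; only its values for \<open>t \<in> {0..T}\<close> and
  \<open>X \<in> sym_mats\<close> are ever constrained or used.
\<close>

type_synonym 'n nonlinearity =
  "real \<Rightarrow> real ^ 'n \<Rightarrow> real \<Rightarrow> real ^ 'n \<Rightarrow> real ^ 'n ^ 'n \<Rightarrow> real"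

definition A0 :: "real \<Rightarrow> 'n::finite nonlinearity \<Rightarrow> bool"
  where "A0 T F \<longleftrightarrow>
    continuous_on ({0..T} \<times> UNIV \<times> UNIV \<times> UNIV \<times> sym_mats) (\<lambda>(t, x, r, p, X). F t x r p X) \<and>
    (\<forall>t\<in>{0..T}. \<forall>x r p. \<forall>X\<in>sym_mats. \<forall>B\<in>sym_mats.
      0 \<preceq> B \<longrightarrow> F t x r p X \<le> F t x r p (X + B))"

definition A1 :: "real \<Rightarrow> 'n::finite nonlinearity \<Rightarrow> bool"
  where "A1 T F \<longleftrightarrow>
    (\<exists>\<gamma>. \<forall>t\<in>{0..T}. \<forall>x p. \<forall>X\<in>sym_mats. \<forall>u v.
      v \<le> u \<longrightarrow> \<gamma> * (u - v) \<le> F t x v p X - F t x u p X)"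

definition A2 :: "real \<Rightarrow> 'n::finite nonlinearity \<Rightarrow> bool"
  where "A2 T F \<longleftrightarrow>
    (\<forall>R>0. \<exists>\<theta> :: ennreal \<Rightarrow> ennreal.
      (\<theta> \<longlongrightarrow> 0) (at_right 0) \<and>
      (\<forall>t\<in>{0..T}. \<forall>x y. \<forall>r\<in>{-R..R}. \<forall>\<alpha>>0. \<forall>X\<in>sym_mats. \<forall>Y\<in>sym_mats.
        (- 3 * \<alpha>) *\<^sub>R block_mat (mat 1) 0 0 (mat 1) \<preceq> block_mat X 0 0 (- Y) \<and>
        block_mat X 0 0 (- Y) \<preceq> (3 * \<alpha>) *\<^sub>R block_mat (mat 1) (- mat 1) (- mat 1) (mat 1)
        \<longrightarrow>
        ereal (F t x r (\<alpha> *\<^sub>R (x - y)) X - F t y r (\<alpha> *\<^sub>R (x - y)) Y)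
          \<le> enn2ereal (\<theta> (ennreal (\<alpha> * (norm (x - y))\<^sup>2 + norm (x - y))))))"

text \<open>
  In the next condition the ball of matrices refers to the Frobenius norm; as the condition ranges
  over all radii, any other matrix norm yields the same notion.
\<close>

definition A3' :: "real \<Rightarrow> 'n::finite nonlinearity \<Rightarrow> bool"
  where "A3' T F \<longleftrightarrow>
    (\<forall>R>0.
      let S = {0..T} \<times> UNIV \<times> {-R..R} \<times> ball 0 R \<times> (ball 0 R \<inter> sym_mats);
          G = (\<lambda>(t, x, r, p, X). F t x r p X)
      in bounded (G ` S) \<and> uniformly_continuous_on S G)"


definition usc_on :: "'a::topological_space set \<Rightarrow> ('a \<Rightarrow> real) \<Rightarrow> bool"
  where "usc_on D u \<longleftrightarrow> (\<forall>z\<in>D. \<forall>c>u z. \<forall>\<^sub>F w in at z within D. u w < c)"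

definition lsc_on :: "'a::topological_space set \<Rightarrow> ('a \<Rightarrow> real) \<Rightarrow> bool"
  where "lsc_on D u \<longleftrightarrow> (\<forall>z\<in>D. \<forall>c<u z. \<forall>\<^sub>F w in at z within D. c < u w)"

definition local_max_rel :: "'a::topological_space set \<Rightarrow> ('a \<Rightarrow> real) \<Rightarrow> 'a \<Rightarrow> bool"
  where "local_max_rel D g z \<longleftrightarrow> (\<forall>\<^sub>F w in at z within D. g w \<le> g z)"

definition local_min_rel :: "'a::topological_space set \<Rightarrow> ('a \<Rightarrow> real) \<Rightarrow> 'a \<Rightarrow> bool"
  where "local_min_rel D g z \<longleftrightarrow> (\<forall>\<^sub>F w in at z within D. g z \<le> g w)"

text \<open>
  \<open>C12_near z \<phi> \<phi>t D\<phi> D2\<phi>\<close>: on a neighbourhood of \<open>z\<close> the function \<open>\<phi>\<close> is of class \<open>C\<^sup>1\<close> in time and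
  \<open>C\<^sup>2\<close> in space, with time derivative \<open>\<phi>t\<close>, spatial gradient \<open>D\<phi>\<close> and spatial Hessian \<open>D2\<phi>\<close>, all
  jointly continuous. Symmetry of \<open>D2\<phi>\<close> near \<open>z\<close> is then automatic (Schwarz).
\<close>

definition C12_near ::
    "real \<times> (real ^ 'n) \<Rightarrow> (real \<times> (real ^ 'n) \<Rightarrow> real) \<Rightarrow> (real \<times> (real ^ 'n) \<Rightarrow> real) \<Rightarrow>
      (real \<times> (real ^ 'n) \<Rightarrow> real ^ 'n) \<Rightarrow> (real \<times> (real ^ 'n) \<Rightarrow> real ^ 'n ^ 'n) \<Rightarrow> bool"
  where "C12_near z \<phi> \<phi>t D\<phi> D2\<phi> \<longleftrightarrow>
    (\<exists>U. open U \<and> z \<in> U \<and>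
      (\<forall>(t, x)\<in>U.
        ((\<lambda>s. \<phi> (s, x)) has_real_derivative \<phi>t (t, x)) (at t) \<and>
        ((\<lambda>y. \<phi> (t, y)) has_derivative (\<lambda>h. D\<phi> (t, x) \<bullet> h)) (at x) \<and>
        ((\<lambda>y. D\<phi> (t, y)) has_derivative (\<lambda>h. D2\<phi> (t, x) *v h)) (at x)) \<and>
      continuous_on U \<phi>t \<and> continuous_on U D\<phi> \<and> continuous_on U D2\<phi>)"

text \<open>Sub-, super- and solutions of \<open>\<partial>\<^sub>t u - F(t, x, u, D u, D\<^sup>2 u) = 0\<close> on an open set \<open>D\<close>.\<close>

definition viscosity_subsolution ::
    "'n::finite nonlinearity \<Rightarrow> (real \<times> (real ^ 'n)) set \<Rightarrow> (real \<times> (real ^ 'n) \<Rightarrow> real) \<Rightarrow> bool"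
  where "viscosity_subsolution F D u \<longleftrightarrow>
    usc_on D u \<and>
    (\<forall>t x \<phi> \<phi>t D\<phi> D2\<phi>.
      (t, x) \<in> D \<and> C12_near (t, x) \<phi> \<phi>t D\<phi> D2\<phi> \<and>
      local_max_rel D (\<lambda>z. u z - \<phi> z) (t, x) \<longrightarrow>
        \<phi>t (t, x) - F t x (u (t, x)) (D\<phi> (t, x)) (D2\<phi> (t, x)) \<le> 0)"

definition viscosity_supersolution ::
    "'n::finite nonlinearity \<Rightarrow> (real \<times> (real ^ 'n)) set \<Rightarrow> (real \<times> (real ^ 'n) \<Rightarrow> real) \<Rightarrow> bool"
  where "viscosity_supersolution F D u \<longleftrightarrow>
    lsc_on D u \<and>
    (\<forall>t x \<phi> \<phi>t D\<phi> D2\<phi>.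
      (t, x) \<in> D \<and> C12_near (t, x) \<phi> \<phi>t D\<phi> D2\<phi> \<and>
      local_min_rel D (\<lambda>z. u z - \<phi> z) (t, x) \<longrightarrow>
        \<phi>t (t, x) - F t x (u (t, x)) (D\<phi> (t, x)) (D2\<phi> (t, x)) \<ge> 0)"

definition viscosity_solution ::
    "'n::finite nonlinearity \<Rightarrow> (real \<times> (real ^ 'n)) set \<Rightarrow> (real \<times> (real ^ 'n) \<Rightarrow> real) \<Rightarrow> bool"
  where "viscosity_solution F D u \<longleftrightarrow> viscosity_subsolution F D u \<and> viscosity_supersolution F D u"

end

theory Submission
  imports Defs
begin

text \<open>
  The proof compares \<open>u\<close> with itself at nearby points. For \<open>w = exp(-\<Lambda>t) u\<close> with \<open>\<Lambda>\<close> large the equation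
  becomes one whose right-hand side decreases in \<open>w\<close> at rate at least one
  (\<open>proper_equation_damped\<close>), and everything is done for \<open>w\<close>.

  The modulus in space is obtained by contradiction. If \<open>w(t,x) - w(t,y) \<le> \<epsilon> + \<alpha>/2 |x-y|\<^sup>2\<close> failed for every \<open>\<alpha>\<close>, one would maximise
  \<open>w(t,x) - w(s,y) - \<alpha>/2 |x-y|\<^sup>2 - (t-s)\<^sup>2/(2\<tau>)\<close> minus penalties that keep the maximum away from infinity
  and from \<open>t = T\<close>; uniform continuity of the initial data keeps it away from \<open>t = 0\<close>. At a maximum of a
  smooth function the second-order conditions produce matrices \<open>X, Y\<close> as in (A2), and subtracting the two
  viscosity inequalities gives a contradiction (\<open>spatial_modulus\<close>). For a function that is merely
  continuous this is the theorem on sums (\<open>theorem_on_sums\<close>, used through \<open>interior_maximum\<close>).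

  In the theorem on sums, replacing both functions by their sup-convolutions yields semiconvex functions with
  the same jets at neighbouring points, so what is needed is a point close to the maximum at which a
  semiconvex function is twice differentiable (\<open>twice_differentiable_near_touched_point\<close>, which merges
  the theorems of Alexandrov and Jensen). For a convex \<open>g\<close> the resolvent \<open>J = (id + \<partial>g)\<^sup>-\<^sup>1\<close> is
  nonexpansive, hence differentiable almost everywhere by Rademacher's theorem. Tilting the maximisation
  problem by small linear functions produces contact points whose slopes fill a ball, and the slope is a
  Lipschitz function of the argument of \<open>J\<close>; a null set cannot be mapped onto a ball, so some contact
  point comes from a point where \<open>J\<close> is differentiable. There \<open>DJ\<close> is invertible, because the contact
  bounds \<open>g\<close> from above by a quadratic, and inverting it differentiates \<open>\<partial>g\<close>.

  Rademacher's theorem rests on its one-dimensional case, a Vitali covering argument for monotone functions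
  (\<open>emeasure_zero_of_slopes_apart\<close>). In higher dimension partial derivatives exist almost everywhere by
  Fubini, and they assemble to a total derivative at points where suitable closed sets are not porous
  (\<open>negligible_porous_points\<close>, \<open>approximate_gradient_at_nonporous\<close>).

  The modulus in time follows from the one in space: \<open>w(s,x) + \<epsilon> + C|y-x|\<^sup>2 + K(t-s)\<close> is a barrier as soon as
  \<open>K\<close> exceeds the values of the equation on a bounded set (\<open>upper_time_modulus\<close>). The lower bounds follow
  by applying the same to \<open>-w\<close>, which solves the reflected equation.
\<close>

section \<open>Almost everywhere differentiability on the line\<close>

lemma emeasure_interval_measure_Ioo:
  assumes "a < b" and mono: "\<And>x y. x \<le> y \<Longrightarrow> F x \<le> F y" and cont: "continuous_on UNIV F"
  shows "emeasure (interval_measure F) {a<..<b} = ennreal (F b - F a)"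
proof -
  have "{a<..<b} = {a..b} - {a,b}" by auto
  moreover have "emeasure (interval_measure F) {x} = 0" for x
    using emeasure_interval_measure_Icc[OF order_refl mono cont, of x] by simp
  then have "{a} \<union> {b} \<in> null_sets (interval_measure F)"
    by (intro null_sets.Un) (auto simp: null_sets_def)
  then have "{a, b} \<in> null_sets (interval_measure F)"
    by (metis insert_is_Un)
  ultimately show ?thesis
    using assms(1) emeasure_interval_measure_Icc[OF _ mono cont, of a b]
    by (simp add: emeasure_Diff_null_set)
qed

lemma ball_midpoint_eq_Ioo:
  "ball ((fst p + snd p) / 2) ((snd p - fst p) / 2) = {fst p<..<snd p}" for p :: "real \<times> real"
  by (auto simp: ball_def dist_real_def abs_less_iff field_simps)

lemma Vitali_covering_Ioo:
  fixes E :: "real set" and K :: "(real \<times> real) set"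
  assumes "\<And>x d. x \<in> E \<Longrightarrow> 0 < d \<Longrightarrow> \<exists>p\<in>K. x \<in> {fst p<..<snd p} \<and> snd p - fst p < d"
  obtains C where "countable C" "C \<subseteq> K" "disjoint_family_on (\<lambda>p. {fst p<..<snd p}) C"
    "negligible (E - (\<Union>p\<in>C. {fst p<..<snd p}))"
proof -
  have "\<exists>p. p \<in> K \<and> x \<in> ball ((fst p + snd p) / 2) ((snd p - fst p) / 2) \<and> (snd p - fst p) / 2 < d"
    if xd: "x \<in> E" "0 < d" for x d
  proof -
    obtain p where "p \<in> K" "x \<in> {fst p<..<snd p}" "snd p - fst p < d" using assms[OF xd] by blast
    then show ?thesis unfolding ball_midpoint_eq_Ioo by (intro exI[of _ p]) auto
  qed
  then obtain C where C: "countable C" "C \<subseteq> K"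
     "pairwise (\<lambda>i j. disjnt (ball ((fst i + snd i) / 2) ((snd i - fst i) / 2))
                             (ball ((fst j + snd j) / 2) ((snd j - fst j) / 2))) C"
     "negligible (E - (\<Union>p\<in>C. ball ((fst p + snd p) / 2) ((snd p - fst p) / 2)))"
    by (rule Vitali_covering_theorem_balls)
  show thesis
    by (rule that[OF C(1,2)]) (use C(3,4) in \<open>unfold ball_midpoint_eq_Ioo\<close>,
      auto simp: disjoint_family_on_def pairwise_def disjnt_def)
qed

lemma emeasure_Un_Ioo:
  assumes "countable C" "disjoint_family_on (\<lambda>p. {fst p<..<snd p}) C" "\<And>p. p \<in> C \<Longrightarrow> fst p < (snd p :: real)"
  shows "emeasure lebesgue (\<Union>p\<in>C. {fst p<..<snd p}) = (\<integral>\<^sup>+p. ennreal (snd p - fst p) \<partial>count_space C)"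
proof -
  have "emeasure lebesgue (\<Union>p\<in>C. {fst p<..<snd p})
      = (\<integral>\<^sup>+p. emeasure lebesgue {fst p<..<snd p} \<partial>count_space C)"
    by (rule emeasure_UN_countable) (use assms in auto)
  also have "\<dots> = (\<integral>\<^sup>+p. ennreal (snd p - fst p) \<partial>count_space C)"
    by (rule nn_integral_cong) (use assms(3) in \<open>simp add: less_imp_le\<close>)
  finally show ?thesis .
qed

lemma emeasure_interval_measure_Un_Ioo:
  assumes "countable C" "disjoint_family_on (\<lambda>p. {fst p<..<snd p}) C" "\<And>p. p \<in> C \<Longrightarrow> fst p < (snd p :: real)"
    and mono: "\<And>x y. x \<le> y \<Longrightarrow> F x \<le> F y" and cont: "continuous_on UNIV F"
  shows "emeasure (interval_measure F) (\<Union>p\<in>C. {fst p<..<snd p})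
    = (\<integral>\<^sup>+p. ennreal (F (snd p) - F (fst p)) \<partial>count_space C)"
proof -
  have "emeasure (interval_measure F) (\<Union>p\<in>C. {fst p<..<snd p})
      = (\<integral>\<^sup>+p. emeasure (interval_measure F) {fst p<..<snd p} \<partial>count_space C)"
    by (rule emeasure_UN_countable) (use assms in auto)
  also have "\<dots> = (\<integral>\<^sup>+p. ennreal (F (snd p) - F (fst p)) \<partial>count_space C)"
    by (rule nn_integral_cong) (use assms(3) emeasure_interval_measure_Ioo[OF _ mono cont] in simp)
  finally show ?thesis .
qed

lemma emeasure_lebesgue_subset_up_to_negligible:
  assumes "negligible (E - A)" "E \<in> sets lebesgue" "A \<in> sets lebesgue"
  shows "emeasure lebesgue E \<le> emeasure lebesgue A"
proof -
  have "E - A \<in> null_sets lebesgue" using assms(1) by (simp add: negligible_iff_null_sets)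
  have "emeasure lebesgue E \<le> emeasure lebesgue (A \<union> (E - A))"
    by (rule emeasure_mono) (use assms in auto)
  also have "\<dots> = emeasure lebesgue A"
    using \<open>E - A \<in> null_sets lebesgue\<close> assms(3) by (simp add: emeasure_Un_null_set del: Un_Diff_cancel)
  finally show ?thesis .
qed

text \<open>
  The intervals of small slope, chosen disjoint and inside an open set \<open>U\<close> slightly larger than \<open>E\<close>,
  carry an increment of \<open>f\<close> of at most \<open>r |U|\<close>. Inside their union, intervals of large slope again cover
  almost all of \<open>E\<close>, so the same increment is at least \<open>q |E|\<close>. Hence \<open>q |E| \<le> r |E|\<close>.
\<close>

lemma emeasure_zero_of_slopes_apart:
  fixes f :: "real \<Rightarrow> real"
  assumes mono: "\<And>x y. x \<le> y \<Longrightarrow> f x \<le> f y" and cont: "continuous_on UNIV f"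
    and rq: "0 \<le> r" "r < q" and E: "E \<in> sets lebesgue" "emeasure lebesgue E < \<infinity>"
    and lo: "\<And>x d. x \<in> E \<Longrightarrow> 0 < d \<Longrightarrow> \<exists>a b. a < x \<and> x < b \<and> b - a < d \<and> f b - f a \<le> r * (b - a)"
    and hi: "\<And>x d. x \<in> E \<Longrightarrow> 0 < d \<Longrightarrow> \<exists>a b. a < x \<and> x < b \<and> b - a < d \<and> q * (b - a) \<le> f b - f a"
  shows "emeasure lebesgue E = 0"
proof -
  define m where "m = measure lebesgue E"
  have m: "emeasure lebesgue E = ennreal m" "0 \<le> m"
    using E(2) by (simp_all add: m_def emeasure_eq_ennreal_measure)
  have small: "\<exists>d>0. \<forall>a b. a < x \<and> x < b \<and> b - a < d \<longrightarrow> {a<..<b} \<subseteq> U" if Ux: "open U" "x \<in> U" for U and x :: real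
  proof -
    obtain d where "0 < d" "ball x d \<subseteq> U" using openE[OF Ux] .
    moreover have "{a<..<b} \<subseteq> ball x d" if "a < x" "x < b" "b - a < d" for a b
    proof
      fix y assume "y \<in> {a<..<b}"
      then have "\<bar>x - y\<bar> < d" using that by (auto simp: abs_less_iff)
      then show "y \<in> ball x d" by (simp add: dist_real_def)
    qed
    ultimately show ?thesis by (meson order_trans)
  qed
  have main: "q * m \<le> r * (m + \<epsilon>)" if \<epsilon>: "\<epsilon> > 0" for \<epsilon>
  proof -
    obtain U where U: "open U" "E \<subseteq> U" "U - E \<in> lmeasurable" "emeasure lebesgue (U - E) < ennreal \<epsilon>"
      using sets_lebesgue_outer_open[OF E(1) \<epsilon>] .
    have Um: "U \<in> sets lebesgue" using U(1) by auto
    have "emeasure lebesgue U = emeasure lebesgue E + emeasure lebesgue (U - E)"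
      using U(2) E(1) Um by (metis Diff_partition plus_emeasure sets.Diff Diff_disjoint)
    also have "\<dots> \<le> ennreal m + ennreal \<epsilon>"
      using U(4) m by (intro add_mono) auto
    finally have lU: "emeasure lebesgue U \<le> ennreal (m + \<epsilon>)"
      using m(2) that by (simp add: ennreal_plus)
    define K1 where "K1 = {p. fst p < snd p \<and> {fst p<..<snd p} \<subseteq> U \<and> f (snd p) - f (fst p) \<le> r * (snd p - fst p)}"
    have "\<exists>p\<in>K1. x \<in> {fst p<..<snd p} \<and> snd p - fst p < d" if x: "x \<in> E" "0 < d" for x d
    proof -
      obtain d' where d': "d' > 0" "\<forall>a b. a < x \<and> x < b \<and> b - a < d' \<longrightarrow> {a<..<b} \<subseteq> U"
        using small[OF U(1)] U(2) x by blast
      obtain a b where "a < x \<and> x < b \<and> b - a < min d d' \<and> f b - f a \<le> r * (b - a)"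
        using lo[OF x(1), of "min d d'"] d'(1) x(2) by auto
      then show ?thesis using d'(2) by (intro bexI[of _ "(a,b)"]) (auto simp: K1_def)
    qed
    then obtain C1 where C1: "countable C1" "C1 \<subseteq> K1" "disjoint_family_on (\<lambda>p. {fst p<..<snd p}) C1"
        "negligible (E - (\<Union>p\<in>C1. {fst p<..<snd p}))"
      by (rule Vitali_covering_Ioo)
    define O1 where "O1 = (\<Union>p\<in>C1. {fst p<..<snd p})"
    have O1: "open O1" "O1 \<subseteq> U" using C1(2) by (auto simp: O1_def K1_def)
    define K2 where "K2 = {p. fst p < snd p \<and> {fst p<..<snd p} \<subseteq> O1 \<and> q * (snd p - fst p) \<le> f (snd p) - f (fst p)}"
    have "\<exists>p\<in>K2. x \<in> {fst p<..<snd p} \<and> snd p - fst p < d" if x: "x \<in> E \<inter> O1" "0 < d" for x d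
    proof -
      obtain d' where d': "d' > 0" "\<forall>a b. a < x \<and> x < b \<and> b - a < d' \<longrightarrow> {a<..<b} \<subseteq> O1"
        using small[OF O1(1)] x by blast
      obtain a b where "a < x \<and> x < b \<and> b - a < min d d' \<and> q * (b - a) \<le> f b - f a"
        using hi[of x "min d d'"] d'(1) x by auto
      then show ?thesis using d'(2) by (intro bexI[of _ "(a,b)"]) (auto simp: K2_def)
    qed
    then obtain C2 where C2: "countable C2" "C2 \<subseteq> K2" "disjoint_family_on (\<lambda>p. {fst p<..<snd p}) C2"
        "negligible (E \<inter> O1 - (\<Union>p\<in>C2. {fst p<..<snd p}))"
      by (rule Vitali_covering_Ioo)
    define O2 where "O2 = (\<Union>p\<in>C2. {fst p<..<snd p})"
    have O2: "open O2" "O2 \<subseteq> O1" using C2(2) by (auto simp: O2_def K2_def)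
    have neg: "negligible (E - O2)"
      by (rule negligible_subset[OF negligible_Un[OF C1(4) C2(4)]]) (auto simp: O1_def O2_def)
    have "ennreal q * ennreal m \<le> ennreal q * emeasure lebesgue O2"
      unfolding m(1)[symmetric]
      using emeasure_lebesgue_subset_up_to_negligible[OF neg E(1)] O2(1) by (intro mult_left_mono) auto
    also have "\<dots> = (\<integral>\<^sup>+p. ennreal q * ennreal (snd p - fst p) \<partial>count_space C2)"
      unfolding O2_def by (subst emeasure_Un_Ioo) (use C2 in \<open>auto simp: K2_def nn_integral_cmult\<close>)
    also have "\<dots> \<le> (\<integral>\<^sup>+p. ennreal (f (snd p) - f (fst p)) \<partial>count_space C2)"
      by (rule nn_integral_mono)
        (use C2(2) rq in \<open>auto simp: K2_def ennreal_mult[symmetric] less_imp_le intro!: ennreal_leI\<close>)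
    also have "\<dots> = emeasure (interval_measure f) O2"
      unfolding O2_def by (subst emeasure_interval_measure_Un_Ioo[OF C2(1,3) _ mono cont]) (use C2(2) in \<open>auto simp: K2_def\<close>)
    also have "\<dots> \<le> emeasure (interval_measure f) O1"
      using O1 O2 by (intro emeasure_mono) auto
    also have "\<dots> = (\<integral>\<^sup>+p. ennreal (f (snd p) - f (fst p)) \<partial>count_space C1)"
      unfolding O1_def by (subst emeasure_interval_measure_Un_Ioo[OF C1(1,3) _ mono cont]) (use C1(2) in \<open>auto simp: K1_def\<close>)
    also have "\<dots> \<le> (\<integral>\<^sup>+p. ennreal r * ennreal (snd p - fst p) \<partial>count_space C1)"
      by (rule nn_integral_mono)
        (use C1(2) rq in \<open>auto simp: K1_def ennreal_mult[symmetric] less_imp_le intro!: ennreal_leI\<close>)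
    also have "\<dots> = ennreal r * emeasure lebesgue O1"
      unfolding O1_def by (subst emeasure_Un_Ioo) (use C1 in \<open>auto simp: K1_def nn_integral_cmult\<close>)
    also have "\<dots> \<le> ennreal r * emeasure lebesgue U"
      using O1 Um by (intro mult_left_mono emeasure_mono) auto
    also have "\<dots> \<le> ennreal r * ennreal (m + \<epsilon>)"
      using lU by (intro mult_left_mono) auto
    finally show ?thesis using rq m(2) \<epsilon>
      by (simp add: ennreal_mult[symmetric] ennreal_le_iff del: ennreal_plus)
  qed
  have "q * m \<le> r * m"
  proof (rule field_le_epsilon)
    fix e :: real assume "0 < e"
    have "q * m \<le> r * (m + e / (r + 1))" using rq \<open>0 < e\<close> by (intro main) auto
    also have "\<dots> \<le> r * m + e" using rq \<open>0 < e\<close> by (simp add: field_simps)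
    finally show "q * m \<le> r * m + e" .
  qed
  then have "m = 0" using rq m(2) by (smt (verit) mult_right_less_imp_less mult_strict_right_mono)
  then show ?thesis using m by simp
qed

definition slope :: "(real \<Rightarrow> real) \<Rightarrow> real \<Rightarrow> real \<Rightarrow> real"
  where "slope f a b = (f b - f a) / (b - a)"

lemma open_Union_slopes: fixes d :: real shows "open {x. \<exists>a b. a < x \<and> x < b \<and> b - a < d \<and> P a b}"
proof -
  have "{x. \<exists>a b. a < x \<and> x < b \<and> b - a < d \<and> P a b} = (\<Union>(a,b)\<in>{(a,b). b - a < d \<and> P a b}. {a<..<b})"
    by (auto; blast)
  then show ?thesis by (auto intro!: open_UN)
qed

text \<open>
  The covering argument speaks of intervals with \<open>x\<close> in their interior; by continuity their slopes
  control the one-sided difference quotients.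
\<close>

lemma DERIV_of_slopes:
  fixes f :: "real \<Rightarrow> real"
  assumes cont: "continuous_on UNIV f"
    and D: "\<And>e. 0 < e \<Longrightarrow> \<exists>d>0. \<forall>a b. a < x \<and> x < b \<and> b - a < d \<longrightarrow> \<bar>slope f a b - D\<bar> \<le> e"
  shows "(f has_real_derivative D) (at x)"
  unfolding DERIV_def
proof (rule LIM_I)
  fix e :: real assume "0 < e"
  then obtain d where d: "d > 0" "\<And>a b. a < x \<Longrightarrow> x < b \<Longrightarrow> b - a < d \<Longrightarrow> \<bar>slope f a b - D\<bar> \<le> e / 2"
    using D[of "e/2"] by auto
  have c: "(f \<longlongrightarrow> f z) (at z within S)" for z S
    using cont by (meson UNIV_I continuous_on_def tendsto_within_subset top_greatest)
  have idl: "((\<lambda>a::real. a) \<longlongrightarrow> z) (at z within S)" for z S by (rule tendsto_ident_at)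
  have "norm ((f (x + h) - f x) / h - D) < e" if h: "h \<noteq> 0" "\<bar>h\<bar> < d" for h
  proof (cases "h > 0")
    case True
    have "\<bar>slope f x (x + h) - D\<bar> \<le> e / 2"
    proof (rule tendsto_upperbound[of _ _ "at_left x"])
      show "((\<lambda>a. \<bar>slope f a (x + h) - D\<bar>) \<longlongrightarrow> \<bar>slope f x (x + h) - D\<bar>) (at_left x)"
        unfolding slope_def by (intro tendsto_intros c) (use h True in auto)
      have "eventually (\<lambda>a. x + h - d < a \<and> a < x) (at_left x)"
        using h True eventually_at_left_real[of "x + h - d" x] by (auto elim!: eventually_mono)
      then show "\<forall>\<^sub>F a in at_left x. \<bar>slope f a (x + h) - D\<bar> \<le> e / 2"
        by eventually_elim (use d True in auto)
    qed simp
    then show ?thesis using \<open>0 < e\<close> by (simp add: slope_def)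
  next
    case False
    have "\<bar>slope f (x + h) x - D\<bar> \<le> e / 2"
    proof (rule tendsto_upperbound[of _ _ "at_right x"])
      show "((\<lambda>b. \<bar>slope f (x + h) b - D\<bar>) \<longlongrightarrow> \<bar>slope f (x + h) x - D\<bar>) (at_right x)"
        unfolding slope_def by (intro tendsto_intros c) (use h False in auto)
      have "eventually (\<lambda>b. x < b \<and> b < x + h + d) (at_right x)"
        using h False eventually_at_right_real[of x "x + h + d"] by (auto elim!: eventually_mono)
      then show "\<forall>\<^sub>F b in at_right x. \<bar>slope f (x + h) b - D\<bar> \<le> e / 2"
        by eventually_elim (use d h False in auto)
    qed simp
    moreover have "slope f (x + h) x = (f (x + h) - f x) / h"
      using h by (simp add: slope_def field_simps)
    ultimately show ?thesis using \<open>0 < e\<close> by simp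
  qed
  then show "\<exists>s>0. \<forall>h. h \<noteq> 0 \<and> norm (h - 0) < s \<longrightarrow> norm ((f (x + h) - f x) / h - D) < e"
    using d(1) by auto
qed

text \<open>
  Where the upper and the lower limit of the slopes differ, two rational numbers separate them; the
  exceptional set is thus a countable union of sets to which \<open>emeasure_zero_of_slopes_apart\<close> applies.
\<close>

lemma ae_differentiable_mono_Lipschitz:
  fixes f :: "real \<Rightarrow> real"
  assumes mono: "\<And>x y. x \<le> y \<Longrightarrow> f x \<le> f y" and lip: "\<And>x y. x \<le> y \<Longrightarrow> f y - f x \<le> L * (y - x)"
  shows "negligible {x. \<not> (\<exists>D. (f has_real_derivative D) (at x))}"
proof -
  have L0: "0 \<le> L" using lip[of 0 1] mono[of 0 1] by simp
  have abs_lip: "\<bar>f y - f x\<bar> \<le> L * \<bar>y - x\<bar>" for x y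
    using lip[of x y] lip[of y x] mono[of x y] mono[of y x] by (cases "x \<le> y") auto
  have "L-lipschitz_on UNIV f"
    by (rule lipschitz_onI) (use abs_lip L0 in \<open>auto simp: dist_real_def\<close>)
  then have cont: "continuous_on UNIV f" by (rule lipschitz_on_continuous_on)
  define lo where "lo r d = {x. \<exists>a b. a < x \<and> x < b \<and> b - a < d \<and> slope f a b \<le> r}" for r d
  define hi where "hi q d = {x. \<exists>a b. a < x \<and> x < b \<and> b - a < d \<and> q \<le> slope f a b}" for q d
  define E where "E r q n = (\<Inter>k::nat. lo r (inverse (Suc k))) \<inter> (\<Inter>k::nat. hi q (inverse (Suc k))) \<inter> {- real n<..<real n}"
    for r q n
  have slope0: "0 \<le> slope f a b" "slope f a b \<le> L" if "a < b" for a b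
    using that mono[of a b] lip[of a b] by (auto simp: slope_def field_simps)
  have small: "\<exists>k. inverse (Suc k) < d" if "0 < d" for d :: real
    using reals_Archimedean[OF that] by auto
  have "negligible (E r q n)" if rq: "r < q" for r q n
  proof (cases "0 \<le> r")
    case False
    then have "\<not> slope f a b \<le> r" if "a < b" for a b using slope0(1)[OF that] by simp
    then have "lo r d = {}" for d unfolding lo_def by (auto; meson less_trans)
    then show ?thesis by (simp add: E_def)
  next
    case True
    have bo: "{x. \<exists>a b. a < x \<and> x < b \<and> b - a < d \<and> P a b} \<in> sets borel" for d :: real and P
      by (rule borel_open[OF open_Union_slopes])
    have lob: "lo r d \<in> sets borel" "hi q d \<in> sets borel" for d unfolding lo_def hi_def by (rule bo)+
    have "(\<Inter>k::nat. lo r (inverse (Suc k))) \<in> sets borel" "(\<Inter>k::nat. hi q (inverse (Suc k))) \<in> sets borel"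
      by (intro sets.countable_INT'' lob; simp)+
    then have "E r q n \<in> sets borel" unfolding E_def by (intro sets.Int) auto
    then have leb: "E r q n \<in> sets lebesgue" by auto
    have "emeasure lebesgue (E r q n) = 0"
    proof (rule emeasure_zero_of_slopes_apart[OF mono cont True rq leb])
      have "emeasure lebesgue (E r q n) \<le> emeasure lebesgue {- real n<..<real n}"
        by (rule emeasure_mono) (auto simp: E_def)
      then show "emeasure lebesgue (E r q n) < \<infinity>"
        by (auto intro: le_less_trans)
    next
      fix x d :: real assume x: "x \<in> E r q n" "0 < d"
      then obtain k where "inverse (Suc k) < d" using small by blast
      moreover have "x \<in> lo r (inverse (Suc k))" "x \<in> hi q (inverse (Suc k))" using x(1) by (auto simp: E_def)
      ultimately obtain a b a' b' where
         "a < x" "x < b" "b - a < inverse (Suc k)" "slope f a b \<le> r"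
         "a' < x" "x < b'" "b' - a' < inverse (Suc k)" "q \<le> slope f a' b'"
        unfolding lo_def hi_def mem_Collect_eq by blast
      with \<open>inverse (Suc k) < d\<close> have
         ab: "a < x" "x < b" "b - a < d" "slope f a b \<le> r" and
         ab': "a' < x" "x < b'" "b' - a' < d" "q \<le> slope f a' b'"
        by linarith+
      show "\<exists>a b. a < x \<and> x < b \<and> b - a < d \<and> f b - f a \<le> r * (b - a)"
        by (rule exI[of _ a], rule exI[of _ b]) (use ab in \<open>auto simp: slope_def divide_le_eq\<close>)
      show "\<exists>a b. a < x \<and> x < b \<and> b - a < d \<and> q * (b - a) \<le> f b - f a"
        by (rule exI[of _ a'], rule exI[of _ b']) (use ab' in \<open>auto simp: slope_def le_divide_eq\<close>)
    qed
    then show ?thesis using leb by (simp add: negligible_iff_emeasure0)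
  qed
  then have "negligible (\<Union>n. E r q n)" if "r < q" for r q
    using that by (intro negligible_Union_nat)
  then have "negligible (\<Union>q\<in>\<rat>\<inter>{r<..}. \<Union>n. E r q n)" for r
    by (intro negligible_countable_Union) (auto intro: countable_rat countable_Int1)
  then have neg: "negligible (\<Union>r\<in>\<rat>. \<Union>q\<in>\<rat>\<inter>{r<..}. \<Union>n. E r q n)"
    by (intro negligible_countable_Union) (auto intro: countable_rat)
  have "\<exists>D. (f has_real_derivative D) (at x)" if x: "x \<notin> (\<Union>r\<in>\<rat>. \<Union>q\<in>\<rat>\<inter>{r<..}. \<Union>n. E r q n)" for x
  proof -
    obtain n :: nat where n: "\<bar>x\<bar> < n" using reals_Archimedean2 by blast
    have dich: "(\<exists>d>0. x \<notin> lo r d) \<or> (\<exists>d>0. x \<notin> hi q d)" if "r \<in> \<rat>" "q \<in> \<rat>" "r < q" for r q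
    proof -
      have "x \<notin> E r q n" using x that by auto
      then have "(\<exists>k. x \<notin> lo r (inverse (Suc k))) \<or> (\<exists>k. x \<notin> hi q (inverse (Suc k)))"
        using n by (auto simp: E_def abs_less_iff)
      moreover have "0 < inverse (real (Suc k))" for k by (rule positive_imp_inverse_positive) simp
      ultimately show ?thesis by blast
    qed
    define S where "S = {r. \<exists>d>0. x \<notin> lo r d}"
    \<comment> \<open>the lower limit of the slopes around \<open>x\<close>\<close>
    define D where "D = Sup S"
    have bS: "r \<le> L" if rS: "r \<in> S" for r
    proof (rule ccontr)
      assume "\<not> r \<le> L"
      obtain d where d: "d > 0" "x \<notin> lo r d" using rS by (auto simp: S_def)
      have "slope f (x - d/3) (x + d/3) \<le> r" using slope0(2)[of "x - d/3" "x + d/3"] d(1) \<open>\<not> r \<le> L\<close> by simp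
      then have "x \<in> lo r d" unfolding lo_def mem_Collect_eq
        by (intro exI[of _ "x - d/3"] exI[of _ "x + d/3"]) (use d(1) in auto)
      then show False using d by simp
    qed
    have "-1 \<in> S" 
    proof -
      have "\<not> slope f a b \<le> -1" if "a < b" for a b using slope0(1)[OF that] by simp
      then have "x \<notin> lo (-1) 1" unfolding lo_def mem_Collect_eq by (meson less_trans)
      then show ?thesis unfolding S_def by (auto intro!: exI[of _ 1])
    qed
    then have Sne: "S \<noteq> {}" "bdd_above S" using bS by (auto intro!: bdd_aboveI)
    have "(f has_real_derivative D) (at x)"
    proof (rule DERIV_of_slopes[OF cont])
      fix e :: real assume e: "0 < e"
      obtain r where "r \<in> S" "D - e < r" using less_cSup_iff[OF Sne, of "D - e"] e by (auto simp: D_def)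
      then obtain d1 where d1: "d1 > 0" "x \<notin> lo r d1" by (auto simp: S_def)
      obtain r' where r': "r' \<in> \<rat>" "D < r'" "r' < D + e/2" using Rats_dense_in_real[of D "D + e/2"] e by auto
      obtain q where q: "q \<in> \<rat>" "D + e/2 < q" "q < D + e" using Rats_dense_in_real[of "D + e/2" "D + e"] e by auto
      have "r' \<notin> S" using r'(2) cSup_upper[OF _ Sne(2), of r'] by (auto simp: D_def)
      then obtain d2 where d2: "d2 > 0" "x \<notin> hi q d2" using dich[OF r'(1) q(1)] r' q unfolding S_def by auto
      show "\<exists>d>0. \<forall>a b. a < x \<and> x < b \<and> b - a < d \<longrightarrow> \<bar>slope f a b - D\<bar> \<le> e"
      proof (intro exI[of _ "min d1 d2"] conjI allI impI)
        fix a b assume ab: "a < x \<and> x < b \<and> b - a < min d1 d2"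
        then have "r < slope f a b" using d1(2) unfolding lo_def by force
        moreover have "slope f a b < q" using d2(2) ab unfolding hi_def by force
        ultimately show "\<bar>slope f a b - D\<bar> \<le> e" using \<open>D - e < r\<close> q by auto
      qed (use d1 d2 in auto)
    qed
    then show ?thesis by blast
  qed
  then show ?thesis by (intro negligible_subset[OF neg]) blast
qed

text \<open>
  Adding \<open>L x\<close> makes \<open>f\<close> monotone.
\<close>

lemma ae_differentiable_Lipschitz_real:
  fixes f :: "real \<Rightarrow> real"
  assumes lip: "\<And>x y. \<bar>f y - f x\<bar> \<le> L * \<bar>y - x\<bar>"
  shows "negligible {x. \<not> (\<exists>D. (f has_real_derivative D) (at x))}"
proof -
  let ?g = "\<lambda>x. f x + L * x"
  have "negligible {x. \<not> (\<exists>D. (?g has_real_derivative D) (at x))}"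
  proof (rule ae_differentiable_mono_Lipschitz[where L="2 * L"])
    fix x y :: real assume "x \<le> y"
    then show "?g x \<le> ?g y" "?g y - ?g x \<le> 2 * L * (y - x)"
      using lip[of y x] by (auto simp: algebra_simps abs_le_iff)
  qed
  moreover have "\<exists>D. (f has_real_derivative D) (at x)" if "(?g has_real_derivative D) (at x)" for x D
  proof -
    have "((\<lambda>x. ?g x - L * x) has_real_derivative D - L) (at x)"
      by (rule DERIV_diff[OF that]) (auto intro!: derivative_eq_intros)
    then show ?thesis by auto
  qed
  ultimately show ?thesis by (elim negligible_subset) blast
qed

section \<open>Porous sets and Rademacher's theorem\<close>

text \<open>
  By Fubini and translation invariance, \<open>|N|\<close> is the integral over \<open>x\<close> of the measure of those
  \<open>s \<in> {0..1}\<close> with \<open>x + s e \<in> N\<close>. Averaging over translations avoids splitting off a coordinate.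
\<close>

lemma negligible_of_null_slices:
  fixes N :: "'a::euclidean_space set" and e :: 'a
  assumes N: "N \<in> sets borel" and slices: "\<And>x. negligible {s. x + s *\<^sub>R e \<in> N}"
  shows "negligible N"
proof -
  let ?f = "\<lambda>(x::'a, s::real). indicator N (x + s *\<^sub>R e) * indicator {0..1} s :: ennreal"
  have m: "(\<lambda>(x, s). x + s *\<^sub>R e) \<in> borel_measurable (lborel \<Otimes>\<^sub>M lborel)"
    by (subst measurable_cong_sets[OF sets_pair_measure_cong[OF sets_lborel sets_lborel] refl])
       (auto simp: borel_prod intro!: borel_measurable_continuous_onI continuous_intros simp: case_prod_beta)
  have fm: "?f \<in> borel_measurable (lborel \<Otimes>\<^sub>M lborel)"
    using N m by (auto simp: case_prod_beta intro!: borel_measurable_times measurable_compose[OF _ borel_measurable_indicator])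
  have slice0: "(\<integral>\<^sup>+s. ?f (x, s) \<partial>lborel) = 0" for x
  proof -
    have sb: "{s. x + s *\<^sub>R e \<in> N} \<in> sets lborel"
    proof -
      have "(\<lambda>s. x + s *\<^sub>R e) \<in> borel_measurable lborel" by measurable
      from measurable_sets[OF this N] show ?thesis by (simp add: vimage_def)
    qed
    have "emeasure lborel {s. x + s *\<^sub>R e \<in> N} = 0"
      using slices[of x] sb by (simp add: negligible_iff_emeasure0 sets_completionI_sets)
    then have "(\<integral>\<^sup>+s. indicator {s. x + s *\<^sub>R e \<in> N} s \<partial>lborel) = 0" using sb by simp
    moreover have "(\<integral>\<^sup>+s. ?f (x, s) \<partial>lborel) \<le> (\<integral>\<^sup>+s. indicator {s. x + s *\<^sub>R e \<in> N} s \<partial>lborel)"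
      by (rule nn_integral_mono) (auto simp: indicator_def)
    ultimately show ?thesis by simp
  qed
  have trans: "(\<integral>\<^sup>+x. indicator N (x + v) \<partial>lborel) = emeasure lborel N" for v :: 'a
  proof -
    have "emeasure lborel N = emeasure (distr lborel borel ((+) v)) N"
      by (simp add: lborel_distr_plus)
    also have "\<dots> = (\<integral>\<^sup>+x. indicator N x \<partial>distr lborel borel ((+) v))"
      using N by simp
    also have "\<dots> = (\<integral>\<^sup>+x. indicator N (v + x) \<partial>lborel)"
      using N by (subst nn_integral_distr) auto
    finally show ?thesis by (simp add: add.commute)
  qed
  have "(\<integral>\<^sup>+s. (\<integral>\<^sup>+x. ?f (x, s) \<partial>lborel) \<partial>lborel) = (\<integral>\<^sup>+x. (\<integral>\<^sup>+s. ?f (x, s) \<partial>lborel) \<partial>lborel)"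
    by (rule lborel_pair.Fubini[OF fm])
  also have "\<dots> = 0" using slice0 by simp
  finally have z: "(\<integral>\<^sup>+s. (\<integral>\<^sup>+x. ?f (x, s) \<partial>lborel) \<partial>lborel) = 0" .
  have "(\<integral>\<^sup>+x. ?f (x, s) \<partial>lborel) = emeasure lborel N * indicator {0..1} s" for s
  proof -
    have "(\<integral>\<^sup>+x. ?f (x, s) \<partial>lborel) = (\<integral>\<^sup>+x. indicator N (x + s *\<^sub>R e) \<partial>lborel) * indicator {0..1} s"
      using N by (simp add: nn_integral_multc)
    then show ?thesis by (simp add: trans)
  qed
  then have "(\<integral>\<^sup>+s. (\<integral>\<^sup>+x. ?f (x, s) \<partial>lborel) \<partial>lborel) = emeasure lborel N"
    by (simp add: nn_integral_cmult_indicator)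
  with z have "emeasure lborel N = 0" by simp
  then show ?thesis using N by (simp add: negligible_iff_emeasure0 sets_completionI_sets)
qed

text \<open>
  Porosity in the sense of holes at all small scales: arbitrarily close to \<open>x\<close> there are balls free of \<open>P\<close>
  whose radius is at least \<open>c\<close> times their distance from \<open>x\<close>.
\<close>

definition porous_at :: "'a::metric_space set \<Rightarrow> real \<Rightarrow> 'a \<Rightarrow> bool"
  where "porous_at P c x \<longleftrightarrow> (\<forall>d>0. \<exists>y r. 0 < r \<and> dist x y < d \<and> c * dist x y \<le> r \<and> ball y r \<inter> P = {})"

text \<open>
  Vitali's theorem covers \<open>P\<close> by disjoint balls, inside a slightly larger open set, in each of which a
  hole takes up at least the fraction \<open>(c/2)\<^sup>n\<close> of the volume. So \<open>|P|\<close> is at most \<open>1 - (c/2)\<^sup>n\<close> times itself.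
\<close>

lemma negligible_porous_bounded:
  fixes P :: "'a::euclidean_space set"
  assumes P: "P \<in> sets lebesgue" "emeasure lebesgue P < \<infinity>" and c: "0 < c" "c \<le> 1"
    and por: "\<And>x. x \<in> P \<Longrightarrow> porous_at P c x"
  shows "negligible P"
proof -
  define m where "m = measure lebesgue P"
  define n where "n = DIM('a)"
  have m: "emeasure lebesgue P = ennreal m" "0 \<le> m"
    using P(2) by (simp_all add: m_def emeasure_eq_ennreal_measure)
  define \<kappa> where "\<kappa> = 1 - (c / 2) ^ n"
  have \<kappa>: "0 \<le> \<kappa>" "\<kappa> < 1" using c by (auto simp: \<kappa>_def power_le_one)
  have ballm: "emeasure lborel (ball y r) = ennreal (r ^ n * measure lebesgue (ball (0::'a) 1))" if "0 \<le> r" for y :: 'a and r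
    using that emeasure_lborel_ball_finite[of y r] content_ball_conv_unit_ball[OF that, of y]
    by (simp add: n_def emeasure_eq_ennreal_measure less_top)
  have main: "m \<le> \<kappa> * (m + \<epsilon>)" if \<epsilon>: "\<epsilon> > 0" for \<epsilon>
  proof -
    obtain U where U: "open U" "P \<subseteq> U" "U - P \<in> lmeasurable" "emeasure lebesgue (U - P) < ennreal \<epsilon>"
      using sets_lebesgue_outer_open[OF P(1) \<epsilon>] .
    have Um: "U \<in> sets lebesgue" using U(1) by auto
    have "emeasure lebesgue U = emeasure lebesgue P + emeasure lebesgue (U - P)"
      using U(2) P(1) Um by (metis Diff_partition plus_emeasure sets.Diff Diff_disjoint)
    also have "\<dots> \<le> ennreal m + ennreal \<epsilon>"
      using U(4) m by (intro add_mono) auto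
    finally have lU: "emeasure lebesgue U \<le> ennreal (m + \<epsilon>)"
      using m(2) \<epsilon> by (simp add: ennreal_plus)
    define K where "K = {(x, r, y, s). 0 < r \<and> 0 < s \<and> c / 2 * r \<le> s \<and> ball x r \<subseteq> U \<and> ball y s \<subseteq> ball x r \<and> ball y s \<inter> P = {}}"
    obtain C where C: "countable C" "C \<subseteq> K"
      "pairwise (\<lambda>i j. disjnt (ball (fst i) (fst (snd i))) (ball (fst j) (fst (snd j)))) C"
      "negligible (P - (\<Union>i\<in>C. ball (fst i) (fst (snd i))))"
    proof (rule Vitali_covering_theorem_balls[of P K fst "\<lambda>i. fst (snd i)"])
      fix x d assume x: "x \<in> P" "0 < (d::real)"
      obtain \<rho> where \<rho>: "\<rho> > 0" "ball x \<rho> \<subseteq> U" using openE[OF U(1)] U(2) x(1) by blast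
      obtain y s where ys: "0 < s" "dist x y < min \<rho> d / 2" "c * dist x y \<le> s" "ball y s \<inter> P = {}"
        using por[OF x(1)] \<rho>(1) x(2) unfolding porous_at_def by (metis half_gt_zero min_less_iff_conj)
      have "x \<noteq> y" using ys(1,4) x(1) centre_in_ball by blast
      then have dp: "0 < dist x y" by simp
      define s' where "s' = min s (dist x y)"
      have "ball y s' \<subseteq> ball y s" by (rule subset_ball) (simp add: s'_def)
      then have s': "0 < s'" "c * dist x y \<le> s'" "s' \<le> dist x y" "ball y s' \<inter> P = {}"
        using ys dp c by (auto simp: s'_def min_def mult_left_le_one_le)
      have "ball y s' \<subseteq> ball x (2 * dist x y)"
      proof
        fix z assume "z \<in> ball y s'"
        then show "z \<in> ball x (2 * dist x y)" using s'(3) dist_triangle[of x z y] by (simp)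
      qed
      moreover have "ball x (2 * dist x y) \<subseteq> U"
        using \<rho>(2) ys(2) by (smt (verit) mem_ball min_less_iff_conj subset_iff field_sum_of_halves)
      ultimately have "(x, 2 * dist x y, y, s') \<in> K" using s' dp unfolding K_def by auto
      then show "\<exists>i. i \<in> K \<and> x \<in> ball (fst i) (fst (snd i)) \<and> fst (snd i) < d"
        by (rule exI[of _ "(x, 2 * dist x y, y, s')", OF conjI]) (use dp ys(2) in auto)
    qed
    let ?B = "\<lambda>i. ball (fst i) (fst (snd i))" and ?H = "\<lambda>i. ball (fst (snd (snd i))) (snd (snd (snd i)))"
    have dB: "disjoint_family_on ?B C"
      using C(3) by (auto simp: disjoint_family_on_def pairwise_def disjnt_def)
    then have dH: "disjoint_family_on (\<lambda>i. ?B i - ?H i) C"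
      unfolding disjoint_family_on_def by blast
    have one: "emeasure lebesgue (?B i - ?H i) \<le> ennreal \<kappa> * emeasure lebesgue (?B i)" if "i \<in> C" for i
    proof -
      obtain x r y s where i: "i = (x, r, y, s)" by (cases i) auto
      have iK: "0 < r" "0 < s" "c / 2 * r \<le> s" "ball y s \<subseteq> ball x r" using that C(2) i by (auto simp: K_def)
      have "emeasure lebesgue (?B i - ?H i) = emeasure lebesgue (ball x r) - emeasure lebesgue (ball y s)"
        unfolding i using iK by (simp add: emeasure_Diff ballm less_top[symmetric] ennreal_mult_eq_top_iff)
      also have "\<dots> = ennreal ((r ^ n - s ^ n) * measure lebesgue (ball (0::'a) 1))"
        using iK by (simp add: ballm ennreal_minus left_diff_distrib)
      also have "\<dots> \<le> ennreal ((\<kappa> * r ^ n) * measure lebesgue (ball (0::'a) 1))"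
      proof (intro ennreal_leI mult_right_mono)
        have "(c / 2 * r) ^ n \<le> s ^ n" using iK c by (intro power_mono) auto
        then show "r ^ n - s ^ n \<le> \<kappa> * r ^ n" by (simp add: \<kappa>_def power_mult_distrib power_divide algebra_simps)
      qed simp
      also have "\<dots> = ennreal \<kappa> * emeasure lebesgue (?B i)"
        using iK \<kappa> by (simp add: i ballm[OF less_imp_le[OF iK(1)]] ennreal_mult mult.assoc)
      finally show ?thesis .
    qed
    have neg: "negligible (P - (\<Union>i\<in>C. ?B i - ?H i))"
    proof (rule negligible_subset[OF C(4)])
      have "?H i \<inter> P = {}" if "i \<in> C" for i 
        using that C(2) by (cases i) (force simp: K_def)
      then show "P - (\<Union>i\<in>C. ?B i - ?H i) \<subseteq> P - (\<Union>i\<in>C. ?B i)" by blast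
    qed
    have "emeasure lebesgue P \<le> emeasure lebesgue (\<Union>i\<in>C. ?B i - ?H i)"
      by (rule emeasure_lebesgue_subset_up_to_negligible[OF neg P(1)])
         (use C(1) in \<open>auto intro!: sets.countable_UN''\<close>)
    also have "\<dots> = (\<integral>\<^sup>+i. emeasure lebesgue (?B i - ?H i) \<partial>count_space C)"
      by (rule emeasure_UN_countable) (use C(1) dH in auto)
    also have "\<dots> \<le> (\<integral>\<^sup>+i. ennreal \<kappa> * emeasure lebesgue (?B i) \<partial>count_space C)"
      by (rule nn_integral_mono) (use one in simp)
    also have "\<dots> = ennreal \<kappa> * (\<integral>\<^sup>+i. emeasure lebesgue (?B i) \<partial>count_space C)"
      by (rule nn_integral_cmult) simp
    also have "\<dots> = ennreal \<kappa> * emeasure lebesgue (\<Union>i\<in>C. ?B i)"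
      by (subst emeasure_UN_countable) (use C(1) dB in auto)
    also have "\<dots> \<le> ennreal \<kappa> * emeasure lebesgue U"
      using C(2) Um by (intro mult_left_mono emeasure_mono) (fastforce simp: K_def)+
    also have "\<dots> \<le> ennreal \<kappa> * ennreal (m + \<epsilon>)"
      using lU by (intro mult_left_mono) auto
    finally show ?thesis using \<kappa>(1) m \<epsilon>
      by (simp add: ennreal_mult[symmetric] ennreal_le_iff del: ennreal_plus)
  qed
  have "m \<le> \<kappa> * m"
  proof (rule field_le_epsilon)
    fix e :: real assume "0 < e"
    have "m \<le> \<kappa> * (m + e)" by (rule main[OF \<open>0 < e\<close>])
    also have "\<dots> \<le> \<kappa> * m + e" using \<kappa> \<open>0 < e\<close> by (simp add: distrib_left mult_left_le_one_le)
    finally show "m \<le> \<kappa> * m + e" .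
  qed
  then have "(1 - \<kappa>) * m \<le> 0" by (simp add: algebra_simps)
  then have "m = 0" using \<kappa> m(2) by (simp add: mult_le_0_iff)
  then show ?thesis using m P(1) by (simp add: negligible_iff_emeasure0)
qed

lemma porous_at_infdist:
  assumes P: "P \<noteq> {}" and por: "porous_at P c x" and c: "0 < c"
  shows "\<forall>d>0. \<exists>y. dist x y < d \<and> 0 < infdist y P \<and> c * dist x y \<le> infdist y P"
proof (intro allI impI)
  fix d :: real assume "0 < d"
  then obtain y r where yr: "0 < r" "dist x y < d" "c * dist x y \<le> r" "ball y r \<inter> P = {}"
    using por unfolding porous_at_def by blast
  have "r \<le> infdist y P" unfolding infdist_notempty[OF P]
    by (rule cINF_greatest[OF P]) (use yr(4) in \<open>auto simp: disjoint_iff not_less\<close>)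
  then show "\<exists>y. dist x y < d \<and> 0 < infdist y P \<and> c * dist x y \<le> infdist y P"
    using yr by (intro exI[of _ y]) auto
qed

text \<open>
  For closed \<open>P\<close> the largest hole around \<open>y\<close> has radius \<open>infdist y P\<close>, which is continuous in \<open>y\<close>; hence
  the porous points lie in a Borel set of points with the same property for \<open>c/2\<close>.
\<close>

lemma negligible_porous_points:
  fixes P :: "'a::euclidean_space set"
  assumes P: "closed P" and c: "0 < c" "c \<le> 1"
  shows "negligible {x \<in> P. porous_at P c x}"
proof (cases "P = {}")
  case False
  define Q where "Q k = (\<Union>y\<in>{y. 0 < infdist y P}. {x. dist x y < inverse (Suc k) \<and> c / 2 * dist x y < infdist y P})" for k :: nat
  have "open (Q k)" for k
    unfolding Q_def by (intro open_UN ballI open_Collect_conj open_Collect_less continuous_intros)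
  then have Qb: "(\<Inter>k. Q k) \<in> sets borel"
    by (intro sets.countable_INT'') auto
  let ?P = "\<lambda>n::nat. P \<inter> (\<Inter>k. Q k) \<inter> ball 0 (real n)"
  have "negligible (?P n)" for n
  proof (rule negligible_porous_bounded[where c="c/2"])
    show "?P n \<in> sets lebesgue" using Qb P by auto
    have "emeasure lebesgue (?P n) \<le> emeasure lebesgue (ball (0::'a) (real n))"
      by (intro emeasure_mono) auto
    also have "\<dots> < \<infinity>" using emeasure_lborel_ball_finite[of "0::'a" "real n"] by simp
    finally show "emeasure lebesgue (?P n) < \<infinity>" .
    show "0 < c / 2" "c / 2 \<le> 1" using c by auto
    fix x assume x: "x \<in> ?P n"
    show "porous_at (?P n) (c / 2) x"
      unfolding porous_at_def
    proof (intro allI impI)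
      fix d :: real assume "0 < d"
      then obtain k where k: "inverse (Suc k) < d" using reals_Archimedean by blast
      have "x \<in> Q k" using x by auto
      then obtain y where y: "0 < infdist y P" "dist x y < inverse (Suc k)" "c / 2 * dist x y < infdist y P"
        unfolding Q_def by blast
      have "z \<notin> P" if "z \<in> ball y (infdist y P)" for z
        using that infdist_le[of z P y] by auto
      then show "\<exists>y r. 0 < r \<and> dist x y < d \<and> c / 2 * dist x y \<le> r \<and> ball y r \<inter> ?P n = {}"
        using y k by (intro exI[of _ y] exI[of _ "infdist y P"]) (auto simp del: of_nat_Suc)
    qed
  qed
  then have "negligible (\<Union>n. ?P n)" by (rule negligible_Union_nat)
  moreover have "{x \<in> P. porous_at P c x} \<subseteq> (\<Union>n. ?P n)"
  proof
    fix x assume x: "x \<in> {x \<in> P. porous_at P c x}"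
    obtain n :: nat where n: "norm x < n" using reals_Archimedean2 by blast
    have "x \<in> Q k" for k
    proof -
      have "0 < inverse (real (Suc k))" by (rule positive_imp_inverse_positive) simp
      then obtain y where y: "dist x y < inverse (Suc k)" "0 < infdist y P" "c * dist x y \<le> infdist y P"
        using porous_at_infdist[OF False, of c x] x c by blast
      have "x \<noteq> y" using y(2) x by auto
      then have "c / 2 * dist x y < c * dist x y" using c by auto
      with y show ?thesis unfolding Q_def by (intro UN_I[of y]) (auto simp del: of_nat_Suc)
    qed
    then show "x \<in> (\<Union>n. ?P n)" using x n by auto
  qed
  ultimately show ?thesis by (rule negligible_subset)
qed auto

text \<open>
  The approximate gradients for tolerances \<open>\<epsilon>\<^sub>n\<close> and \<open>\<epsilon>\<^sub>m\<close> differ by at most \<open>\<epsilon>\<^sub>n + \<epsilon>\<^sub>m\<close>, so they converge.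
\<close>

lemma differentiable_of_approximate_gradients:
  fixes g :: "'a::euclidean_space \<Rightarrow> real"
  assumes appr: "\<And>e. 0 < e \<Longrightarrow> \<exists>v d. 0 < d \<and> (\<forall>h. norm h < d \<longrightarrow> \<bar>g (x + h) - g x - v \<bullet> h\<bar> \<le> e * norm h)"
  shows "g differentiable (at x)"
proof -
  define \<epsilon> where "\<epsilon> n = inverse (real (Suc n))" for n
  have \<epsilon>0: "0 < \<epsilon> n" for n unfolding \<epsilon>_def by (rule positive_imp_inverse_positive) simp
  have "\<forall>n. \<exists>v d. 0 < d \<and> (\<forall>h. norm h < d \<longrightarrow> \<bar>g (x + h) - g x - v \<bullet> h\<bar> \<le> \<epsilon> n * norm h)"
    using appr[OF \<epsilon>0] by blast
  then obtain v d where vd: "\<And>n. 0 < d n" "\<And>n h. norm h < d n \<Longrightarrow> \<bar>g (x + h) - g x - v n \<bullet> h\<bar> \<le> \<epsilon> n * norm h"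
    by metis
  have close: "norm (v n - v m) \<le> \<epsilon> n + \<epsilon> m" for n m
  proof (cases "v n = v m")
    case True
    then show ?thesis using \<epsilon>0[of n] \<epsilon>0[of m] by simp
  next
    case False
    define w where "w = v n - v m"
    define t where "t = min (d n) (d m) / (2 * norm w)"
    have w: "norm w > 0" using False by (simp add: w_def)
    have t: "t > 0" using vd(1)[of n] vd(1)[of m] w by (simp add: t_def)
    have small: "norm (t *\<^sub>R w) < d n" "norm (t *\<^sub>R w) < d m"
      using w vd(1)[of n] vd(1)[of m] by (auto simp: t_def)
    have "w \<bullet> (t *\<^sub>R w) \<le> (\<epsilon> n + \<epsilon> m) * norm (t *\<^sub>R w)"
      using vd(2)[OF small(1)] vd(2)[OF small(2)] by (simp add: w_def inner_diff_left algebra_simps)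
    then have "t * norm w * norm w \<le> t * norm w * (\<epsilon> n + \<epsilon> m)"
      using t by (simp add: power2_norm_eq_inner[symmetric] power2_eq_square algebra_simps)
    then show ?thesis using t w by (simp add: w_def)
  qed
  have \<epsilon>lim: "\<epsilon> \<longlonglongrightarrow> 0" unfolding \<epsilon>_def by (rule LIMSEQ_inverse_real_of_nat)
  have "Cauchy v"
  proof (rule metric_CauchyI)
    fix e :: real assume "0 < e"
    then obtain N where N: "\<And>n. n \<ge> N \<Longrightarrow> \<epsilon> n < e / 2"
      using order_tendstoD(2)[OF \<epsilon>lim, of "e/2"] by (auto simp: eventually_sequentially)
    show "\<exists>M. \<forall>m\<ge>M. \<forall>n\<ge>M. dist (v m) (v n) < e"
    proof (intro exI[of _ N] allI impI)
      fix m n assume "N \<le> m" "N \<le> n"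
      then have "\<epsilon> m < e / 2" "\<epsilon> n < e / 2" using N by auto
      then show "dist (v m) (v n) < e" using close[of m n] by (simp add: dist_norm)
    qed
  qed
  then obtain w where w: "v \<longlonglongrightarrow> w" using Cauchy_convergent_iff convergent_def by blast
  have vw: "norm (v n - w) \<le> \<epsilon> n" for n
  proof (rule tendsto_le[OF sequentially_bot _ _ always_eventually])
    show "(\<lambda>m. norm (v n - v m)) \<longlonglongrightarrow> norm (v n - w)" by (intro tendsto_intros w)
    show "(\<lambda>m. \<epsilon> n + \<epsilon> m) \<longlonglongrightarrow> \<epsilon> n" using tendsto_add[OF tendsto_const \<epsilon>lim, of "\<epsilon> n"] by simp
  qed (use close in auto)
  have "(g has_derivative (\<lambda>h. w \<bullet> h)) (at x)"
    unfolding has_derivative_at_alt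
  proof (intro conjI allI impI)
    show "bounded_linear ((\<bullet>) w)" by (rule bounded_linear_inner_right)
    fix e :: real assume "0 < e"
    then obtain n where n: "\<epsilon> n < e / 2"
      using order_tendstoD(2)[OF \<epsilon>lim, of "e/2"] by (auto simp: eventually_sequentially)
    have "\<bar>g y - g x - w \<bullet> (y - x)\<bar> \<le> e * norm (y - x)" if y: "norm (y - x) < d n" for y
    proof -
      have "\<bar>g y - g x - v n \<bullet> (y - x)\<bar> \<le> \<epsilon> n * norm (y - x)" using vd(2)[OF y] by simp
      moreover have "\<bar>(v n - w) \<bullet> (y - x)\<bar> \<le> \<epsilon> n * norm (y - x)"
        using Cauchy_Schwarz_ineq2[of "v n - w" "y - x"] vw[of n]
        by (meson mult_right_mono norm_ge_zero order_trans)
      ultimately have "\<bar>g y - g x - w \<bullet> (y - x)\<bar> \<le> 2 * \<epsilon> n * norm (y - x)"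
        by (simp add: inner_diff_left)
      also have "\<dots> \<le> e * norm (y - x)" using n by (intro mult_right_mono) auto
      finally show ?thesis .
    qed
    then show "\<exists>da>0. \<forall>y. norm (y - x) < da \<longrightarrow> norm (g y - g x - w \<bullet> (y - x)) \<le> e * norm (y - x)"
      using vd(1)[of n] by (intro exI[of _ "d n"]) auto
  qed
  then show ?thesis by (auto simp: differentiable_def)
qed

text \<open>
  The increment from \<open>x\<close> to \<open>x + h\<close> is followed along the coordinate directions. Each intermediate point
  is within \<open>\<eta> |h|\<close> of a point of \<open>P\<close>, because \<open>P\<close> has no holes of that size near \<open>x\<close>, and at points of \<open>P\<close>
  the difference quotients are uniformly close to \<open>a b\<close>; the Lipschitz bound pays for the shift.
\<close>

lemma approximate_gradient_at_nonporous:
  fixes g :: "'a::euclidean_space \<Rightarrow> real"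
  assumes lip: "\<And>x y. \<bar>g x - g y\<bar> \<le> L * norm (x - y)" and \<eta>: "0 < \<eta>" and \<rho>: "0 < \<rho>"
    and P: "\<And>z b s. z \<in> P \<Longrightarrow> b \<in> Basis \<Longrightarrow> \<bar>s\<bar> \<le> \<rho> \<Longrightarrow> \<bar>g (z + s *\<^sub>R b) - g z - a b * s\<bar> \<le> \<eta> * \<bar>s\<bar>"
    and np: "\<not> porous_at P \<eta> x"
  shows "\<exists>d>0. \<forall>h. norm h < d \<longrightarrow>
    \<bar>g (x + h) - g x - (\<Sum>b\<in>Basis. a b *\<^sub>R b) \<bullet> h\<bar> \<le> real DIM('a) * (2 * L + 1) * \<eta> * norm h"
proof -
  obtain d where d: "d > 0" "\<And>y r. 0 < r \<Longrightarrow> dist x y < d \<Longrightarrow> \<eta> * dist x y \<le> r \<Longrightarrow> ball y r \<inter> P \<noteq> {}"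
    using np unfolding porous_at_def by blast
  have L0: "0 \<le> L" using order_trans[OF abs_ge_zero lip[of "SOME b. b \<in> Basis" 0]]
    by (simp add: SOME_Basis)
  have "\<bar>g (x + h) - g x - (\<Sum>b\<in>Basis. a b *\<^sub>R b) \<bullet> h\<bar> \<le> real DIM('a) * (2 * L + 1) * \<eta> * norm h"
    if h: "norm h < min d \<rho>" for h
  proof (cases "h = 0")
    case False
    define hB where "hB B = (\<Sum>b\<in>B. (h \<bullet> b) *\<^sub>R b)" for B
    have step: "\<bar>g (x + hB B) - g x - (\<Sum>b\<in>B. a b * (h \<bullet> b))\<bar> \<le> real (card B) * ((2 * L + 1) * \<eta> * norm h)"
      if "finite B" "B \<subseteq> Basis" for B
      using that
    proof (induction B rule: finite_induct)
      case (insert b B)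
      define y where "y = x + hB B"
      define s where "s = h \<bullet> b"
      have b: "b \<in> Basis" "B \<subseteq> Basis" using insert by auto
      have s: "\<bar>s\<bar> \<le> norm h" unfolding s_def using Basis_le_norm[OF b(1)] .
      have "norm (hB B) \<le> norm h"
      proof -
        have "(norm (hB B))\<^sup>2 = (\<Sum>b\<in>B. (h \<bullet> b)\<^sup>2)"
          using b(2) unfolding hB_def
          by (subst norm_sum_Pythagorean[OF insert(1)])
             (use b(2) in \<open>auto simp: pairwise_def orthogonal_def power_mult_distrib inner_not_same_Basis subset_iff intro!: sum.cong\<close>)
        also have "\<dots> \<le> (\<Sum>b\<in>Basis. (h \<bullet> b)\<^sup>2)" by (rule sum_mono2) (use b in auto)
        also have "\<dots> = (norm h)\<^sup>2" by (simp only: power2_norm_eq_inner) (simp add: euclidean_inner[of h h] power2_eq_square)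
        finally show ?thesis by (simp add: power2_le_iff_abs_le)
      qed
      then have dy: "dist x y \<le> norm h" by (simp add: y_def dist_norm)
      have "ball y (\<eta> * norm h) \<inter> P \<noteq> {}"
        by (rule d(2)) (use \<eta> False dy h in auto)
      then obtain z where "z \<in> P" "z \<in> ball y (\<eta> * norm h)" by blast
      then have z: "z \<in> P" "norm (y - z) \<le> \<eta> * norm h" by (simp_all add: dist_norm)
      have "\<bar>g (z + s *\<^sub>R b) - g z - a b * s\<bar> \<le> \<eta> * \<bar>s\<bar>" using P[OF z(1) b(1)] s h by simp
      also have "\<dots> \<le> \<eta> * norm h" using s \<eta> by simp
      finally have 1: "\<bar>g (z + s *\<^sub>R b) - g z - a b * s\<bar> \<le> \<eta> * norm h" .
      have Lz: "L * norm (y - z) \<le> L * (\<eta> * norm h)" using z L0 by (intro mult_left_mono) auto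
      have 2: "\<bar>g y - g z\<bar> \<le> L * (\<eta> * norm h)" using lip[of y z] Lz by simp
      have 3: "\<bar>g (y + s *\<^sub>R b) - g (z + s *\<^sub>R b)\<bar> \<le> L * (\<eta> * norm h)" using lip[of "y + s *\<^sub>R b" "z + s *\<^sub>R b"] Lz by simp
      have "\<bar>g y - g x - (\<Sum>b\<in>B. a b * (h \<bullet> b))\<bar> \<le> real (card B) * ((2 * L + 1) * \<eta> * norm h)"
        using insert.IH[OF b(2)] by (simp add: y_def)
      moreover have "x + hB (insert b B) = y + s *\<^sub>R b" using insert(1,2) by (simp add: hB_def y_def s_def)
      moreover have "(\<Sum>b\<in>insert b B. a b * (h \<bullet> b)) = (\<Sum>b\<in>B. a b * (h \<bullet> b)) + a b * s"
        using insert(1,2) by (simp add: s_def)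
      moreover have "real (card (insert b B)) = real (card B) + 1" using insert(1,2) by simp
      moreover have "(2 * L + 1) * \<eta> * norm h = L * (\<eta> * norm h) + L * (\<eta> * norm h) + \<eta> * norm h"
        by (simp add: algebra_simps)
      ultimately show ?case using 1 2 3 by (simp only: distrib_right mult_1; linarith?)
    qed (simp add: hB_def)
    have "hB Basis = h" by (simp add: hB_def euclidean_representation)
    moreover have "(\<Sum>b\<in>Basis. a b *\<^sub>R b) \<bullet> h = (\<Sum>b\<in>Basis. a b * (h \<bullet> b))"
      by (simp add: inner_sum_left inner_commute[of h])
    ultimately show ?thesis using step[of Basis] by (simp add: mult.assoc)
  qed simp
  then show ?thesis using d(1) \<rho> by (intro exI[of _ "min d \<rho>"]) auto
qed

text \<open>
  The points where all partial derivatives exist are covered by countably many closed sets on which the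
  difference quotients up to a fixed scale agree with fixed rational numbers to within a tolerance. A
  point outside the porous parts of all of these sets has approximate gradients for every tolerance.
\<close>

lemma Rademacher_real:
  fixes g :: "'a::euclidean_space \<Rightarrow> real"
  assumes lip: "\<And>x y. \<bar>g x - g y\<bar> \<le> L * norm (x - y)"
  shows "negligible {x. \<not> g differentiable (at x)}"
proof -
  have L0: "0 \<le> L" using order_trans[OF abs_ge_zero lip[of "SOME b. b \<in> Basis" 0]]
    by (simp add: SOME_Basis)
  have cont: "continuous_on UNIV g"
    by (rule lipschitz_on_continuous_on[of L]) (use L0 lip in \<open>auto intro!: lipschitz_onI simp: dist_norm\<close>)
  define \<epsilon> where "\<epsilon> n = inverse (real (Suc n))" for n
  have \<epsilon>0: "0 < \<epsilon> n" for n unfolding \<epsilon>_def by (rule positive_imp_inverse_positive) simp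
  have \<epsilon>small: "\<exists>n. \<epsilon> n < e" if "0 < e" for e using reals_Archimedean[OF that] by (simp add: \<epsilon>_def)
  have \<epsilon>mono: "\<epsilon> n \<le> \<epsilon> m" if "m \<le> n" for m n using that by (simp add: \<epsilon>_def)
  define A where "A b a m k = {x. \<forall>s. \<bar>s\<bar> \<le> \<epsilon> k \<longrightarrow> \<bar>g (x + s *\<^sub>R b) - g x - a * s\<bar> \<le> \<epsilon> m * \<bar>s\<bar>}" for b a m k
  have Acl: "closed (A b a m k)" for b a m k
    unfolding A_def
    by (intro closed_Collect_all closed_Collect_imp open_Collect_const closed_Collect_le continuous_intros continuous_on_compose2[OF cont]) auto
  have Amono: "A b a m k \<subseteq> A b a m k'" if "k \<le> k'" for b a m k k'
    using \<epsilon>mono[OF that] by (auto simp: A_def)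
  \<comment> \<open>points at which the partial derivative in direction \<open>b\<close> exists\<close>
  define Good where "Good b = (\<Inter>m. \<Union>a\<in>\<rat>. \<Union>k. A b a m k)" for b
  have partial: "negligible (- Good b)" for b
  proof (rule negligible_of_null_slices[where e=b])
    have "Good b \<in> sets borel" unfolding Good_def
      by (intro sets.countable_INT'' sets.countable_UN' countable_rat) (use Acl in auto)
    then show "- Good b \<in> sets borel" by auto
    fix x
    have "negligible {s. \<not> (\<exists>D. ((\<lambda>s. g (x + s *\<^sub>R b)) has_real_derivative D) (at s))}"
    proof (rule ae_differentiable_Lipschitz_real)
      fix s t :: real
      show "\<bar>g (x + t *\<^sub>R b) - g (x + s *\<^sub>R b)\<bar> \<le> (L * norm b) * \<bar>t - s\<bar>"
        using lip[of "x + t *\<^sub>R b" "x + s *\<^sub>R b"] by (simp add: scaleR_diff_left[symmetric] mult.commute mult.left_commute)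
    qed
    moreover have "x + s *\<^sub>R b \<in> Good b" if D: "((\<lambda>s. g (x + s *\<^sub>R b)) has_real_derivative D) (at s)" for s D
      unfolding Good_def
    proof
      fix m
      obtain a where a: "a \<in> \<rat>" "D < a" "a < D + \<epsilon> m / 2" using Rats_dense_in_real[of D "D + \<epsilon> m / 2"] \<epsilon>0[of m] by auto
      obtain d where d: "d > 0" "\<And>t. \<bar>t - s\<bar> < d \<Longrightarrow> \<bar>g (x + t *\<^sub>R b) - g (x + s *\<^sub>R b) - D * (t - s)\<bar> \<le> \<epsilon> m / 2 * \<bar>t - s\<bar>"
        using D \<epsilon>0[of m] unfolding has_field_derivative_def has_derivative_at_alt by (metis half_gt_zero real_norm_def)
      obtain k where k: "\<epsilon> k < d" using \<epsilon>small[OF d(1)] by blast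
      have "x + s *\<^sub>R b \<in> A b a m k" unfolding A_def mem_Collect_eq
      proof (intro allI impI)
        fix t :: real assume "\<bar>t\<bar> \<le> \<epsilon> k"
        then have "\<bar>g (x + (s + t) *\<^sub>R b) - g (x + s *\<^sub>R b) - D * t\<bar> \<le> \<epsilon> m / 2 * \<bar>t\<bar>"
          using d(2)[of "s + t"] k by simp
        moreover have "\<bar>D * t - a * t\<bar> \<le> \<epsilon> m / 2 * \<bar>t\<bar>"
        proof -
          have "\<bar>D * t - a * t\<bar> = \<bar>D - a\<bar> * \<bar>t\<bar>" by (simp only: left_diff_distrib[symmetric] abs_mult)
          also have "\<dots> \<le> \<epsilon> m / 2 * \<bar>t\<bar>" using a by (intro mult_right_mono) auto
          finally show ?thesis .
        qed
        ultimately have "\<bar>g (x + (s + t) *\<^sub>R b) - g (x + s *\<^sub>R b) - a * t\<bar> \<le> \<epsilon> m / 2 * \<bar>t\<bar> + \<epsilon> m / 2 * \<bar>t\<bar>"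
          by linarith
        moreover have "x + (s + t) *\<^sub>R b = x + s *\<^sub>R b + t *\<^sub>R b" by (simp add: algebra_simps)
        ultimately show "\<bar>g (x + s *\<^sub>R b + t *\<^sub>R b) - g (x + s *\<^sub>R b) - a * t\<bar> \<le> \<epsilon> m * \<bar>t\<bar>"
          by (simp add: mult.commute[of "\<bar>t\<bar>"])
      qed
      then show "x + s *\<^sub>R b \<in> (\<Union>a\<in>\<rat>. \<Union>k. A b a m k)" using a(1) by blast
    qed
    ultimately show "negligible {s. x + s *\<^sub>R b \<in> - Good b}"
      by (elim negligible_subset) blast
  qed
  define P where "P a m k = (\<Inter>b\<in>Basis. A b (a b) m k)" for a m k
  define I :: "('a \<Rightarrow> real) set" where "I = Basis \<rightarrow>\<^sub>E \<rat>"
  have I: "countable I" unfolding I_def by (intro countable_PiE countable_rat) auto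
  have Pcl: "closed (P a m k)" for a m k unfolding P_def using Acl by auto
  have "\<epsilon> m \<le> 1" for m using \<epsilon>mono[of 0 m] by (simp add: \<epsilon>_def)
  then have np: "negligible {x \<in> P a m k. porous_at (P a m k) (\<epsilon> m) x}" for a m k
    by (intro negligible_porous_points Pcl \<epsilon>0)
  define N where "N = (\<Union>b\<in>Basis. - Good b) \<union> (\<Union>a\<in>I. \<Union>m. \<Union>k. {x \<in> P a m k. porous_at (P a m k) (\<epsilon> m) x})"
  have "negligible (\<Union>m. \<Union>k. {x \<in> P a m k. porous_at (P a m k) (\<epsilon> m) x})" for a
    by (intro negligible_Union_nat np)
  then have "negligible (\<Union>a\<in>I. \<Union>m. \<Union>k. {x \<in> P a m k. porous_at (P a m k) (\<epsilon> m) x})"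
    by (intro negligible_countable_Union) (use I in auto)
  moreover have "negligible (\<Union>b\<in>(Basis::'a set). - Good b)"
    by (intro negligible_Union) (use partial in auto)
  ultimately have "negligible N" unfolding N_def by (rule negligible_Un[rotated])
  moreover have "g differentiable (at x)" if x: "x \<notin> N" for x
  proof (rule differentiable_of_approximate_gradients)
    fix e :: real assume e: "0 < e"
    define C where "C = real DIM('a) * (2 * L + 1)"
    have C: "C > 0" using L0 by (simp add: C_def)
    obtain m where m: "\<epsilon> m < e / C" using \<epsilon>small[of "e / C"] e C by auto
    have "\<forall>b\<in>Basis. \<exists>a k. a \<in> \<rat> \<and> x \<in> A b a m k"
    proof
      fix b :: 'a assume "b \<in> Basis"
      then have "x \<in> Good b" using x unfolding N_def by (meson ComplI UN_I UnI1)
      then have "x \<in> (\<Union>a\<in>\<rat>. \<Union>k. A b a m k)" unfolding Good_def by (rule InterD) (rule rangeI)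
      then show "\<exists>a k. a \<in> \<rat> \<and> x \<in> A b a m k" by blast
    qed
    then obtain a k where ak: "\<And>b. b \<in> Basis \<Longrightarrow> a b \<in> \<rat>" "\<And>b. b \<in> Basis \<Longrightarrow> x \<in> A b (a b) m (k b)" by metis
    define K where "K = Max (k ` (Basis :: 'a set))"
    define a' where "a' = restrict a Basis"
    have "x \<in> A b (a b) m K" if "b \<in> Basis" for b
      using ak(2)[OF that] Amono[of "k b" K b "a b" m] that by (auto simp: K_def)
    then have xP: "x \<in> P a' m K" by (auto simp: P_def a'_def)
    have "a' \<in> I" using ak(1) by (auto simp: a'_def I_def)
    then have "\<not> porous_at (P a' m K) (\<epsilon> m) x" 
    proof -
      have "x \<notin> (\<Union>a\<in>I. \<Union>m. \<Union>k. {x \<in> P a m k. porous_at (P a m k) (\<epsilon> m) x})" using x unfolding N_def by (meson UnI2)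
      then show ?thesis using xP \<open>a' \<in> I\<close> by (simp only: UN_iff mem_Collect_eq UNIV_I simp_thms) blast
    qed
    then obtain d where d: "d > 0" "\<And>h. norm h < d \<Longrightarrow>
      \<bar>g (x + h) - g x - (\<Sum>b\<in>Basis. a' b *\<^sub>R b) \<bullet> h\<bar> \<le> real DIM('a) * (2 * L + 1) * \<epsilon> m * norm h"
      using approximate_gradient_at_nonporous[OF lip \<epsilon>0[of m] \<epsilon>0[of K], of "P a' m K" a' x]
      by (auto simp: P_def A_def)
    have "C * \<epsilon> m \<le> e" using m C by (simp add: field_simps)
    then have "real DIM('a) * (2 * L + 1) * \<epsilon> m * norm h \<le> e * norm h" for h :: 'a
      unfolding C_def by (rule mult_right_mono) simp
    then show "\<exists>v d. 0 < d \<and> (\<forall>h. norm h < d \<longrightarrow> \<bar>g (x + h) - g x - v \<bullet> h\<bar> \<le> e * norm h)"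
      using d by (meson order_trans)
  qed
  ultimately show ?thesis by (elim negligible_subset) blast
qed

theorem Rademacher:
  fixes f :: "'a::euclidean_space \<Rightarrow> 'b::euclidean_space"
  assumes lip: "\<And>x y. norm (f x - f y) \<le> L * norm (x - y)"
  shows "negligible {x. \<not> f differentiable (at x)}"
proof -
  have "negligible {x. \<not> (\<lambda>x. f x \<bullet> b) differentiable (at x)}" if "b \<in> Basis" for b
  proof (rule Rademacher_real[where L=L])
    fix x y
    have "\<bar>f x \<bullet> b - f y \<bullet> b\<bar> \<le> norm (f x - f y)"
      using Basis_le_norm[OF that, of "f x - f y"] by (simp add: inner_diff_left)
    then show "\<bar>f x \<bullet> b - f y \<bullet> b\<bar> \<le> L * norm (x - y)" using lip[of x y] by simp
  qed
  then have "negligible (\<Union>b\<in>Basis. {x. \<not> (\<lambda>x. f x \<bullet> b) differentiable (at x)})"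
    by (intro negligible_Union) auto
  moreover have "f differentiable (at x)" if "\<forall>b\<in>Basis. (\<lambda>x. f x \<bullet> b) differentiable (at x)" for x
    using that differentiable_componentwise_within[of f x UNIV] by simp
  ultimately show ?thesis by (elim negligible_subset) blast
qed

section \<open>Second-order expansions of convex functions\<close>

definition subgrad :: "('a::euclidean_space \<Rightarrow> real) \<Rightarrow> 'a \<Rightarrow> 'a \<Rightarrow> bool"
  where "subgrad g y \<xi> \<longleftrightarrow> (\<forall>z. g y + \<xi> \<bullet> (z - y) \<le> g z)"

lemma subgradD: "subgrad g y \<xi> \<Longrightarrow> g y + \<xi> \<bullet> (z - y) \<le> g z"
  by (simp add: subgrad_def)

lemma zero_of_inner_le_quadratic:
  fixes v :: "'a::real_inner"
  assumes "\<And>h. v \<bullet> h \<le> C * (norm h)\<^sup>2"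
  shows "v = 0"
proof (rule ccontr)
  assume "v \<noteq> 0"
  then have v: "0 < (norm v)\<^sup>2" by simp
  define t where "t = 1 / (\<bar>C\<bar> + 1)"
  have t: "0 < t" "C * t < 1" by (auto simp: t_def field_simps)
  have "v \<bullet> (t *\<^sub>R v) \<le> C * (norm (t *\<^sub>R v))\<^sup>2" by (rule assms)
  then have "t * (norm v)\<^sup>2 \<le> (t * (norm v)\<^sup>2) * (C * t)"
    using t by (simp add: dot_square_norm power_mult_distrib power2_eq_square algebra_simps)
  then have "t * (norm v)\<^sup>2 * (1 - C * t) \<le> 0" by (simp add: algebra_simps)
  moreover have "0 < t * (norm v)\<^sup>2 * (1 - C * t)" using t v by simp
  ultimately show False by simp
qed

lemma continuous_attains_min_of_coercive:
  fixes f :: "'a::euclidean_space \<Rightarrow> real"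
  assumes cont: "continuous_on UNIV f" and r: "0 \<le> r" and far: "\<And>w. r \<le> dist w0 w \<Longrightarrow> f w0 \<le> f w"
  obtains w where "dist w0 w \<le> r" "\<And>z. f w \<le> f z"
proof -
  obtain w where w: "w \<in> cball w0 r" "\<And>z. z \<in> cball w0 r \<Longrightarrow> f w \<le> f z"
    using continuous_attains_inf[of "cball w0 r" f] r continuous_on_subset[OF cont] by auto
  have "f w \<le> f z" for z
  proof (cases "z \<in> cball w0 r")
    case False
    then have "f w0 \<le> f z" by (intro far) auto
    moreover have "f w \<le> f w0" using w(2)[of w0] r by simp
    ultimately show ?thesis by simp
  qed (use w in auto)
  then show ?thesis using w(1) by (intro that) auto
qed

text \<open>
  Subdividing \<open>{0..1}\<close> into \<open>m\<close> equal parts reduces the contribution of \<open>b\<close> to \<open>b/m\<close>.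
\<close>

lemma small_oscillation_of_subdivisions:
  fixes \<psi> :: "real \<Rightarrow> real"
  assumes "\<And>s t. 0 \<le> s \<Longrightarrow> s \<le> t \<Longrightarrow> t \<le> 1 \<Longrightarrow> \<bar>\<psi> t - \<psi> s\<bar> \<le> (t - s) * a + (t - s)\<^sup>2 * b"
  shows "\<bar>\<psi> 1 - \<psi> 0\<bar> \<le> a"
proof -
  have "\<bar>\<psi> 1 - \<psi> 0\<bar> \<le> a + b / real m" if m: "m \<ge> 1" for m :: nat
  proof -
    have "\<bar>\<psi> 1 - \<psi> 0\<bar> = \<bar>\<Sum>i<m. \<psi> (real (Suc i) / real m) - \<psi> (real i / real m)\<bar>"
      using m by (subst sum_lessThan_telescope) simp
    also have "\<dots> \<le> (\<Sum>i<m. \<bar>\<psi> (real (Suc i) / real m) - \<psi> (real i / real m)\<bar>)" by (rule sum_abs)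
    also have "\<dots> \<le> (\<Sum>i<m. a / real m + b / (real m)\<^sup>2)"
    proof (rule sum_mono)
      fix i assume "i \<in> {..<m}"
      then have "\<bar>\<psi> (real (Suc i) / real m) - \<psi> (real i / real m)\<bar> \<le>
         (real (Suc i) / real m - real i / real m) * a + (real (Suc i) / real m - real i / real m)\<^sup>2 * b"
        by (intro assms) (auto simp: divide_right_mono divide_le_eq)
      moreover have "real (Suc i) / real m - real i / real m = 1 / real m"
        by (simp add: diff_divide_distrib[symmetric])
      ultimately show "\<bar>\<psi> (real (Suc i) / real m) - \<psi> (real i / real m)\<bar> \<le> a / real m + b / (real m)\<^sup>2"
        by (simp add: power_divide)
    qed
    also have "\<dots> = a + b / real m" using m by (simp add: field_simps power2_eq_square)
    finally show ?thesis .
  qed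
  moreover have "(\<lambda>m. a + b / real m) \<longlonglongrightarrow> a + 0"
    by (intro tendsto_intros lim_const_over_n)
  ultimately show ?thesis
    by (intro tendsto_lowerbound[of "\<lambda>m. a + b / real m" a sequentially])
       (auto simp: eventually_sequentially intro!: exI[of _ 1])
qed

text \<open>
  A function with a subgradient everywhere is convex. Boundedness of the chosen subgradients makes it
  Lipschitz, and holds for suprema of affine functions whose slopes range over a compact set.
\<close>

locale bounded_subgradients =
  fixes g :: "'a::euclidean_space \<Rightarrow> real" and s :: "'a \<Rightarrow> 'a" and R :: real
  assumes sub: "\<And>z. subgrad g z (s z)" and bound: "\<And>z. norm (s z) \<le> R"
begin

lemma R_nonneg: "0 \<le> R"
  using bound norm_ge_zero order_trans by blast

lemma lower_Lipschitz: "g z - R * norm (y - z) \<le> g y"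
proof -
  have "\<bar>s z \<bullet> (y - z)\<bar> \<le> R * norm (y - z)"
    using Cauchy_Schwarz_ineq2[of "s z" "y - z"] bound[of z] by (meson mult_right_mono norm_ge_zero order_trans)
  then show ?thesis using subgradD[OF sub, of z y] by linarith
qed

lemma continuous_on_g: "continuous_on UNIV g"
proof (rule lipschitz_on_continuous_on)
  show "R-lipschitz_on UNIV g"
  proof (rule lipschitz_onI[OF _ R_nonneg])
    fix x y
    show "dist (g x) (g y) \<le> R * dist x y"
      using lower_Lipschitz[of x y] lower_Lipschitz[of y x]
      by (simp add: dist_norm abs_le_iff norm_minus_commute)
  qed
qed

lemma convexity:
  assumes "0 \<le> t" "t \<le> 1"
  shows "g (y + t *\<^sub>R h) \<le> (1 - t) * g y + t * g (y + h)"
proof -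
  let ?y = "y + t *\<^sub>R h"
  have "(1 - t) * (g ?y - t * (s ?y \<bullet> h)) + t * (g ?y + (1 - t) * (s ?y \<bullet> h)) \<le> (1 - t) * g y + t * g (y + h)"
  proof (intro add_mono mult_left_mono)
    show "g ?y - t * (s ?y \<bullet> h) \<le> g y" using subgradD[OF sub, of ?y y] by simp
    have "y + h - ?y = (1 - t) *\<^sub>R h" by (simp add: algebra_simps)
    then show "g ?y + (1 - t) * (s ?y \<bullet> h) \<le> g (y + h)" using subgradD[OF sub, of ?y "y + h"] by simp
  qed (use assms in auto)
  then show ?thesis by (simp add: algebra_simps)
qed

text \<open>
  A convex function lies above \<open>g y + \<xi> \<bullet> h - C |h|\<^sup>2 t\<close> for all \<open>0 < t \<le> 1\<close>, by applying the bound at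
  \<open>t h\<close> and convexity between \<open>y\<close> and \<open>y + h\<close>.
\<close>

lemma subgrad_of_quadratic_lower_bound:
  assumes "\<And>h. g y + \<xi> \<bullet> h - C * (norm h)\<^sup>2 \<le> g (y + h)"
  shows "subgrad g y \<xi>"
  unfolding subgrad_def
proof
  fix z
  define h where "h = z - y"
  have "g y + \<xi> \<bullet> h - C * (norm h)\<^sup>2 * t \<le> g z" if t: "0 < t" "t \<le> 1" for t
  proof -
    have "g y + \<xi> \<bullet> (t *\<^sub>R h) - C * (norm (t *\<^sub>R h))\<^sup>2 \<le> (1 - t) * g y + t * g (y + h)"
      using assms[of "t *\<^sub>R h"] convexity[of t y h] t by linarith
    moreover have "g (y + h) = g z" by (simp add: h_def)
    moreover have "(norm (t *\<^sub>R h))\<^sup>2 = t * t * (norm h)\<^sup>2" by (simp add: power_mult_distrib power2_eq_square)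
    ultimately have "t * (g y + \<xi> \<bullet> h - C * (norm h)\<^sup>2 * t) \<le> t * g z"
      by (simp add: algebra_simps power2_eq_square[of t])
    then show ?thesis using t by simp
  qed
  then have "\<forall>\<^sub>F t in at_right 0. g y + \<xi> \<bullet> h - C * (norm h)\<^sup>2 * t \<le> g z"
    unfolding eventually_at_right_field by (intro exI[of _ 1]) auto
  moreover have "((\<lambda>t. g y + \<xi> \<bullet> h - C * (norm h)\<^sup>2 * t) \<longlongrightarrow> g y + \<xi> \<bullet> h - C * (norm h)\<^sup>2 * 0) (at_right 0)"
    by (intro tendsto_intros)
  ultimately have "g y + \<xi> \<bullet> h - C * (norm h)\<^sup>2 * 0 \<le> g z"
    by (intro tendsto_upperbound[of _ _ "at_right 0"]) auto
  then show "g y + \<xi> \<bullet> (z - y) \<le> g z" by (simp add: h_def)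
qed

lemma subgrad_of_quadratic_upper_bound:
  assumes "\<And>h. g (y + h) \<le> g y + \<xi> \<bullet> h + C * (norm h)\<^sup>2"
  shows "subgrad g y \<xi>" "subgrad g y \<zeta> \<Longrightarrow> \<zeta> = \<xi>"
proof -
  have uniq: "\<zeta> = \<xi>" if "subgrad g y \<zeta>" for \<zeta>
  proof -
    have "(\<zeta> - \<xi>) \<bullet> h \<le> C * (norm h)\<^sup>2" for h
      using subgradD[OF that, of "y + h"] assms[of h] by (simp add: inner_diff_left)
    from zero_of_inner_le_quadratic[OF this] show ?thesis by simp
  qed
  then show "subgrad g y \<zeta> \<Longrightarrow> \<zeta> = \<xi>" .
  show "subgrad g y \<xi>" using uniq[OF sub] sub by metis
qed

text \<open>
  Such a \<open>y\<close> minimises \<open>g y + |y - x|\<^sup>2/2\<close>.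
\<close>

lemma resolvent_exists: "\<exists>y. subgrad g y (x - y)"
proof -
  let ?f = "\<lambda>y. g y + (norm (y - x))\<^sup>2 / 2"
  obtain y where y: "\<And>z. ?f y \<le> ?f z"
  proof (rule continuous_attains_min_of_coercive[of ?f "2 * R" x])
    show "continuous_on UNIV ?f" using continuous_on_g by (intro continuous_intros) auto
    fix w assume w: "2 * R \<le> dist x w"
    have "0 \<le> dist x w * (dist x w - 2 * R)" using w by (intro mult_nonneg_nonneg) auto
    then show "?f x \<le> ?f w" using lower_Lipschitz[of x w]
      by (simp add: dist_norm norm_minus_commute power2_eq_square algebra_simps)
  qed (use R_nonneg in auto)
  have "subgrad g y (x - y)"
  proof (rule subgrad_of_quadratic_lower_bound[where C="1/2"])
    fix h
    have "(norm (y + h - x))\<^sup>2 = (norm (y - x))\<^sup>2 - 2 * ((x - y) \<bullet> h) + (norm h)\<^sup>2"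
      unfolding power2_norm_eq_inner by (simp add: algebra_simps inner_commute)
    then show "g y + (x - y) \<bullet> h - 1 / 2 * (norm h)\<^sup>2 \<le> g (y + h)" using y[of "y + h"] by (simp add: field_simps)
  qed
  then show ?thesis by blast
qed

text \<open>
  The resolvent \<open>(id + \<partial>g)\<^sup>-\<^sup>1\<close>.
\<close>

definition J :: "'a \<Rightarrow> 'a" where "J x = (SOME y. subgrad g y (x - y))"

lemma subgrad_J: "subgrad g (J x) (x - J x)"
  unfolding J_def by (rule someI_ex[OF resolvent_exists])

lemma monotone_subgrad:
  assumes "subgrad g y \<xi>" "subgrad g z \<zeta>"
  shows "0 \<le> (\<xi> - \<zeta>) \<bullet> (y - z)"
  using subgradD[OF assms(1), of z] subgradD[OF assms(2), of y]
  by (simp add: inner_diff_left inner_diff_right)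

lemma resolvent_nonexpansive:
  assumes "subgrad g y (x - y)" "subgrad g y' (x' - y')"
  shows "norm (y - y') \<le> norm (x - x')"
proof -
  have "(norm (y - y'))\<^sup>2 \<le> (x - x') \<bullet> (y - y')"
    using monotone_subgrad[OF assms] by (simp add: power2_norm_eq_inner algebra_simps)
  also have "\<dots> \<le> norm (x - x') * norm (y - y')" by (rule norm_cauchy_schwarz)
  finally have "norm (y - y') * norm (y - y') \<le> norm (x - x') * norm (y - y')" by (simp add: power2_eq_square)
  then show ?thesis by (cases "y = y'") auto
qed

lemma J_nonexpansive: "norm (J x - J x') \<le> norm (x - x')"
  by (rule resolvent_nonexpansive[OF subgrad_J subgrad_J])

lemma J_eq:
  assumes "subgrad g y \<xi>" shows "J (y + \<xi>) = y"
  using resolvent_nonexpansive[OF subgrad_J[of "y + \<xi>"], of y "y + \<xi>"] assms by simp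

text \<open>
  A subgradient \<open>\<xi>\<close> at \<open>y + h\<close> that is much larger than \<open>\<xi>0\<close> would force \<open>g\<close> above the quadratic at
  \<open>y + h + k\<close>, where \<open>k\<close> has length \<open>|h|\<close> and the direction of \<open>\<xi> - \<xi>0\<close>.
\<close>

lemma subgrad_Lipschitz_at_touched_point:
  assumes C: "0 \<le> C" and up: "\<And>h. g (y + h) \<le> g y + \<xi>0 \<bullet> h + C * (norm h)\<^sup>2"
    and \<xi>: "subgrad g (y + h) \<xi>"
  shows "norm (\<xi> - \<xi>0) \<le> 4 * C * norm h"
proof -
  define \<eta> where "\<eta> = \<xi> - \<xi>0"
  have base: "\<eta> \<bullet> k \<le> C * (norm (h + k))\<^sup>2" for k
    using subgradD[OF \<xi>, of "y + h + k"] subgradD[OF subgrad_of_quadratic_upper_bound(1)[OF up], of "y + h"] up[of "h + k"]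
    by (simp add: \<eta>_def inner_diff_left inner_add_right add.assoc)
  show ?thesis
  proof (cases "h = 0 \<or> \<eta> = 0")
    case True
    then have "\<eta> = 0" using base zero_of_inner_le_quadratic[of \<eta> C] by auto
    then show ?thesis using C by (simp add: \<eta>_def)
  next
    case False
    define k where "k = (norm h / norm \<eta>) *\<^sub>R \<eta>"
    have k: "norm k = norm h" "\<eta> \<bullet> k = norm h * norm \<eta>"
      using False by (auto simp: k_def power2_norm_eq_inner[symmetric] power2_eq_square)
    have "(norm (h + k))\<^sup>2 \<le> (2 * norm h)\<^sup>2"
      using norm_triangle_ineq[of h k] k by (intro power_mono) auto
    then have "C * (norm (h + k))\<^sup>2 \<le> C * (2 * norm h)\<^sup>2" using C by (rule mult_left_mono)
    then have "norm h * norm \<eta> \<le> norm h * (4 * C * norm h)" using base[of k] k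
      by (simp add: power2_eq_square algebra_simps)
    then show ?thesis using False by (simp add: \<eta>_def)
  qed
qed

text \<open>
  If \<open>A\<close> is the derivative of \<open>J\<close> at \<open>y + \<xi>0\<close>, then \<open>id + \<partial>g\<close> should have derivative \<open>A\<^sup>-\<^sup>1\<close> at \<open>y\<close>, so that
  \<open>H = A\<^sup>-\<^sup>1 - id\<close>. By \<open>subgrad_Lipschitz_at_touched_point\<close> the inverse of \<open>J\<close> is Lipschitz at \<open>y\<close>; this makes \<open>A\<close>
  injective and turns errors relative to \<open>|x' - x|\<close> into errors relative to \<open>|h|\<close>.
\<close>

lemma subgrad_expansion:
  assumes C: "0 \<le> C" and up: "\<And>h. g (y + h) \<le> g y + \<xi>0 \<bullet> h + C * (norm h)\<^sup>2"
    and diff: "J differentiable (at (y + \<xi>0))"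
  obtains H where "linear H"
    "\<And>e. 0 < e \<Longrightarrow> \<exists>d>0. \<forall>h \<xi>. norm h < d \<longrightarrow> subgrad g (y + h) \<xi> \<longrightarrow> norm (\<xi> - \<xi>0 - H h) \<le> e * norm h"
proof -
  define x where "x = y + \<xi>0"
  define c where "c = 1 + 4 * C"
  have c: "c > 0" using C by (simp add: c_def)
  have sub0: "subgrad g y \<xi>0" by (rule subgrad_of_quadratic_upper_bound(1)[OF up])
  have Jx: "J x = y" unfolding x_def by (rule J_eq[OF sub0])
  have lower: "norm (x' - x) \<le> c * norm (J x' - y)" for x'
  proof -
    have "norm ((x' - J x') - \<xi>0) \<le> 4 * C * norm (J x' - y)"
      using subgrad_Lipschitz_at_touched_point[OF C up, of "J x' - y" "x' - J x'"] subgrad_J[of x'] by simp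
    moreover have "x' - x = ((x' - J x') - \<xi>0) + (J x' - y)" by (simp add: x_def)
    ultimately show ?thesis using norm_triangle_ineq[of "(x' - J x') - \<xi>0" "J x' - y"]
      by (simp add: c_def algebra_simps)
  qed
  obtain A where A: "(J has_derivative A) (at x)" using diff unfolding differentiable_def x_def by blast
  have linA: "linear A" using has_derivative_linear[OF A] .
  have Aexp: "\<exists>d>0. \<forall>x'. norm (x' - x) < d \<longrightarrow> norm (J x' - y - A (x' - x)) \<le> e * norm (x' - x)" if "0 < e" for e
    using A that unfolding has_derivative_at_alt Jx by blast
  have Alow: "norm v \<le> 2 * c * norm (A v)" for v
  proof (cases "v = 0")
    case False
    obtain d where d: "d > 0" "\<And>x'. norm (x' - x) < d \<Longrightarrow> norm (J x' - y - A (x' - x)) \<le> 1 / (2 * c) * norm (x' - x)"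
      using Aexp[of "1 / (2 * c)"] c by auto
    define t where "t = d / (2 * norm v)"
    have t: "t > 0" "norm (t *\<^sub>R v) < d" using False d(1) by (auto simp: t_def)
    have "norm (J (x + t *\<^sub>R v) - y) \<le> norm (A (t *\<^sub>R v)) + 1 / (2 * c) * norm (t *\<^sub>R v)"
      using d(2)[of "x + t *\<^sub>R v"] t(2) norm_triangle_ineq[of "J (x + t *\<^sub>R v) - y - A (t *\<^sub>R v)" "A (t *\<^sub>R v)"] by simp
    then have "c * norm (J (x + t *\<^sub>R v) - y) \<le> c * (t * norm (A v) + 1 / (2 * c) * (t * norm v))"
      using c t by (intro mult_left_mono) (auto simp: linear_scale[OF linA])
    then have "t * norm v \<le> c * (t * norm (A v) + 1 / (2 * c) * (t * norm v))"
      using lower[of "x + t *\<^sub>R v"] t by simp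
    also have "\<dots> = t * (c * norm (A v)) + t * norm v / 2" using c by (simp add: field_simps)
    finally have "t * norm v \<le> t * (2 * c * norm (A v))" by simp
    then show ?thesis using t by simp
  qed (use c in simp)
  have "inj A" unfolding linear_injective_0[OF linA]
  proof (intro allI impI)
    fix v assume "A v = 0"
    then show "v = 0" using Alow[of v] by simp
  qed
  then obtain B where B: "linear B" "\<And>v. B (A v) = v" "\<And>v. A (B v) = v"
    using linear_injective_isomorphism[OF linA] by metis
  obtain K where K: "K > 0" "\<And>v. norm (B v) \<le> K * norm v" using linear_bounded_pos[OF B(1)] by blast
  define H where "H v = B v - v" for v
  have "linear H" unfolding H_def using B(1) by (intro linear_compose_sub) (auto intro: linear_ident)
  moreover have "\<exists>d>0. \<forall>h \<xi>. norm h < d \<longrightarrow> subgrad g (y + h) \<xi> \<longrightarrow> norm (\<xi> - \<xi>0 - H h) \<le> e * norm h" if e: "0 < e" for e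
  proof -
    obtain d where d: "d > 0" "\<And>x'. norm (x' - x) < d \<Longrightarrow> norm (J x' - y - A (x' - x)) \<le> e / (K * c) * norm (x' - x)"
      using Aexp[of "e / (K * c)"] e c K by auto
    have "norm (\<xi> - \<xi>0 - H h) \<le> e * norm h" if h: "norm h < d / c" and \<xi>: "subgrad g (y + h) \<xi>" for h \<xi>
    proof -
      define x' where "x' = y + h + \<xi>"
      have Jx': "J x' = y + h" unfolding x'_def by (rule J_eq[OF \<xi>])
      have l: "norm (x' - x) \<le> c * norm h" using lower[of x'] by (simp add: Jx')
      also have "\<dots> < d" using h c by (simp add: field_simps)
      finally have "norm (h - A (x' - x)) \<le> e / (K * c) * norm (x' - x)" using d(2)[of x'] by (simp add: Jx')
      also have "\<dots> \<le> e / (K * c) * (c * norm h)" using l e K c by (intro mult_left_mono) auto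
      finally have "norm (B (h - A (x' - x))) \<le> K * (e / (K * c) * (c * norm h))"
        using K by (meson mult_left_mono less_imp_le order_trans)
      moreover have "B (h - A (x' - x)) = - (\<xi> - \<xi>0 - H h)"
        by (simp add: linear_diff[OF B(1)] B(2) H_def x_def x'_def)
      ultimately have "norm (\<xi> - \<xi>0 - H h) \<le> K * (e / (K * c) * (c * norm h))" by (simp only: norm_minus_cancel)
      then show ?thesis using K c by simp
    qed
    then show ?thesis using d(1) c by (intro exI[of _ "d / c"]) auto
  qed
  ultimately show ?thesis by (rule that)
qed

text \<open>
  Along a segment, \<open>g(y + t h) - t \<xi>0 \<bullet> h - t\<^sup>2/2 h \<bullet> H h\<close> has slopes of size at most \<open>e |h|\<^sup>2\<close>, up to an
  error that vanishes under subdivision.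
\<close>

lemma second_order_expansion:
  assumes sub0: "subgrad g y \<xi>0" and H: "linear H"
    and ex: "\<And>e. 0 < e \<Longrightarrow> \<exists>d>0. \<forall>h \<xi>. norm h < d \<longrightarrow> subgrad g (y + h) \<xi> \<longrightarrow> norm (\<xi> - \<xi>0 - H h) \<le> e * norm h"
    and e: "0 < e"
  shows "\<exists>d>0. \<forall>h. norm h < d \<longrightarrow> \<bar>g (y + h) - g y - \<xi>0 \<bullet> h - (h \<bullet> H h) / 2\<bar> \<le> e * (norm h)\<^sup>2"
proof -
  obtain d where d: "d > 0" "\<And>h \<xi>. norm h < d \<Longrightarrow> subgrad g (y + h) \<xi> \<Longrightarrow> norm (\<xi> - \<xi>0 - H h) \<le> e * norm h"
    using ex[OF e] by blast
  have "\<bar>g (y + h) - g y - \<xi>0 \<bullet> h - (h \<bullet> H h) / 2\<bar> \<le> e * (norm h)\<^sup>2" if h: "norm h < d" for h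
  proof -
    define \<psi> where "\<psi> t = g (y + t *\<^sub>R h) - t * (\<xi>0 \<bullet> h) - t\<^sup>2 / 2 * (h \<bullet> H h)" for t
    have "\<bar>\<psi> 1 - \<psi> 0\<bar> \<le> e * (norm h)\<^sup>2"
    proof (rule small_oscillation_of_subdivisions)
      fix a b :: real assume ab: "0 \<le> a" "a \<le> b" "b \<le> 1"
      have slope: "\<bar>s (y + t *\<^sub>R h) \<bullet> h - \<xi>0 \<bullet> h - t * (h \<bullet> H h)\<bar> \<le> e * (norm h)\<^sup>2" if t: "0 \<le> t" "t \<le> 1" for t
      proof -
        have nt: "norm (t *\<^sub>R h) \<le> norm h" using t by (simp add: mult_left_le_one_le)
        have "norm (s (y + t *\<^sub>R h) - \<xi>0 - H (t *\<^sub>R h)) \<le> e * norm (t *\<^sub>R h)"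
          using d(2)[of "t *\<^sub>R h"] nt h sub by simp
        also have "\<dots> \<le> e * norm h" using nt e by simp
        finally have "\<bar>(s (y + t *\<^sub>R h) - \<xi>0 - H (t *\<^sub>R h)) \<bullet> h\<bar> \<le> e * norm h * norm h"
          using Cauchy_Schwarz_ineq2 by (meson mult_right_mono norm_ge_zero order_trans)
        then show ?thesis
          by (simp add: inner_diff_left linear_scale[OF H] power2_eq_square inner_commute[of "H h" h] mult.assoc)
      qed
      let ?q = "h \<bullet> H h"
      have up: "g (y + b *\<^sub>R h) - g (y + a *\<^sub>R h) \<le> (b - a) * (s (y + b *\<^sub>R h) \<bullet> h)"
      proof -
        have "y + a *\<^sub>R h - (y + b *\<^sub>R h) = - ((b - a) *\<^sub>R h)" by (simp add: scaleR_left_diff_distrib)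
        then show ?thesis using subgradD[OF sub, of "y + b *\<^sub>R h" "y + a *\<^sub>R h"] by simp
      qed
      have lo: "(b - a) * (s (y + a *\<^sub>R h) \<bullet> h) \<le> g (y + b *\<^sub>R h) - g (y + a *\<^sub>R h)"
      proof -
        have "y + b *\<^sub>R h - (y + a *\<^sub>R h) = (b - a) *\<^sub>R h" by (simp add: scaleR_left_diff_distrib)
        then show ?thesis using subgradD[OF sub, of "y + a *\<^sub>R h" "y + b *\<^sub>R h"] by simp
      qed
      have 1: "(b - a) * (s (y + b *\<^sub>R h) \<bullet> h - \<xi>0 \<bullet> h - b * ?q) \<le> (b - a) * (e * (norm h)\<^sup>2)"
        using slope[of b] ab by (intro mult_left_mono) (auto simp: abs_le_iff)
      have 2: "(b - a) * (- (e * (norm h)\<^sup>2)) \<le> (b - a) * (s (y + a *\<^sub>R h) \<bullet> h - \<xi>0 \<bullet> h - a * ?q)"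
        using slope[of a] ab by (intro mult_left_mono) (auto simp: abs_le_iff)
      have 3: "(b - a)\<^sup>2 * ?q \<le> (b - a)\<^sup>2 * \<bar>?q\<bar>" "(b - a)\<^sup>2 * (- ?q) \<le> (b - a)\<^sup>2 * \<bar>?q\<bar>"
        by (rule mult_left_mono; simp)+
      have e1: "\<psi> b - \<psi> a = g (y + b *\<^sub>R h) - g (y + a *\<^sub>R h) - (b - a) * (s (y + b *\<^sub>R h) \<bullet> h)
          + (b - a) * (s (y + b *\<^sub>R h) \<bullet> h - \<xi>0 \<bullet> h - b * ?q) + (b - a)\<^sup>2 * ?q / 2"
        unfolding \<psi>_def by (simp add: field_simps power2_eq_square)
      have e2: "\<psi> b - \<psi> a = g (y + b *\<^sub>R h) - g (y + a *\<^sub>R h) - (b - a) * (s (y + a *\<^sub>R h) \<bullet> h)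
          + (b - a) * (s (y + a *\<^sub>R h) \<bullet> h - \<xi>0 \<bullet> h - a * ?q) - (b - a)\<^sup>2 * ?q / 2"
        unfolding \<psi>_def by (simp add: field_simps power2_eq_square)
      have "\<psi> b - \<psi> a \<le> (b - a) * (e * (norm h)\<^sup>2) + (b - a)\<^sup>2 * (\<bar>?q\<bar> / 2)"
        using e1 up 1 3 by simp
      moreover have "- (\<psi> b - \<psi> a) \<le> (b - a) * (e * (norm h)\<^sup>2) + (b - a)\<^sup>2 * (\<bar>?q\<bar> / 2)"
        using e2 lo 2 3 by simp
      ultimately show "\<bar>\<psi> b - \<psi> a\<bar> \<le> (b - a) * (e * (norm h)\<^sup>2) + (b - a)\<^sup>2 * (\<bar>?q\<bar> / 2)"
        by (rule abs_leI)
    qed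
    moreover have "\<psi> 1 - \<psi> 0 = g (y + h) - g y - \<xi>0 \<bullet> h - (h \<bullet> H h) / 2" by (simp add: \<psi>_def)
    ultimately show ?thesis by simp
  qed
  then show ?thesis using d(1) by blast
qed

text \<open>
  Subtracting \<open>\<delta>/2 |w - w0|\<^sup>2\<close> makes the contact strict, so for every small \<open>p\<close> the function
  \<open>g w - q w - p \<bullet> (w - w0)\<close>, with \<open>q\<close> the touching quadratic plus this term, has a global maximum \<open>y\<close> near \<open>w0\<close>. There \<open>g\<close> has the subgradient \<open>\<xi>\<close> prescribed
  by \<open>p\<close>, and \<open>p = P (y + \<xi>)\<close> for a map \<open>P\<close> that is Lipschitz because \<open>J\<close> is. The set where \<open>J\<close> is not
  differentiable is null by Rademacher's theorem, and so is its image under \<open>P\<close>; some small \<open>p\<close> avoids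
  this image.
\<close>

theorem twice_differentiable_near_touched_point:
  assumes A: "linear A" "\<And>v w. v \<bullet> A w = A v \<bullet> w" and \<rho>: "0 < \<rho>"
    and touch: "\<And>w. g w \<le> g w0 + a0 \<bullet> (w - w0) + ((w - w0) \<bullet> A (w - w0)) / 2"
  obtains y \<xi> H where "norm (y - w0) < \<rho>" "norm (\<xi> - a0) < \<rho>" "linear H" "subgrad g y \<xi>"
    "\<And>\<zeta>. subgrad g y \<zeta> \<Longrightarrow> \<zeta> = \<xi>"
    "\<And>e. 0 < e \<Longrightarrow> \<exists>d>0. \<forall>h. norm h < d \<longrightarrow> \<bar>g (y + h) - g y - \<xi> \<bullet> h - (h \<bullet> H h) / 2\<bar> \<le> e * (norm h)\<^sup>2"
    "\<And>h. 0 \<le> h \<bullet> H h" "\<And>h. h \<bullet> H h \<le> h \<bullet> A h + \<rho> * (norm h)\<^sup>2"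
proof -
  obtain K where K: "K > 0" "\<And>v. norm (A v) \<le> K * norm v" using linear_bounded_pos[OF A(1)] by blast
  define \<delta> where "\<delta> = \<rho> / 2"
  have \<delta>: "\<delta> > 0" using \<rho> by (simp add: \<delta>_def)
  define r where "r = min (\<rho> * \<delta> / 4) (\<rho> / (2 * (1 + (K + \<delta>) * 2 / \<delta>)))"
  have r: "0 < r" using \<rho> \<delta> K by (simp add: r_def add_pos_pos)
  define C where "C = (K + \<delta>) / 2"
  have C: "0 \<le> C" using K \<delta> by (simp add: C_def)
  define q where "q w = a0 \<bullet> (w - w0) + ((w - w0) \<bullet> A (w - w0)) / 2 + \<delta> / 2 * (norm (w - w0))\<^sup>2" for w
  \<comment> \<open>slopes of the tilted maximisation problems, recovered from the resolvent\<close>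
  define P where "P x = x - J x - a0 - A (J x - w0) - \<delta> *\<^sub>R (J x - w0)" for x
  define \<xi>p where "\<xi>p p y = a0 + p + A (y - w0) + \<delta> *\<^sub>R (y - w0)" for p y
  have contq: "continuous_on UNIV q"
    unfolding q_def by (intro continuous_intros linear_continuous_on linear_conv_bounded_linear[THEN iffD1] continuous_on_compose2[OF linear_continuous_on[OF linear_conv_bounded_linear[THEN iffD1, OF A(1)]]]) auto
  have max_ex: "\<exists>y. dist w0 y \<le> 2 * r / \<delta> \<and> (\<forall>w. g w - q w - p \<bullet> (w - w0) \<le> g y - q y - p \<bullet> (y - w0))"
    if p: "p \<in> ball 0 r" for p
  proof -
    let ?f = "\<lambda>w. - (g w - q w - p \<bullet> (w - w0))"
    obtain y where "dist w0 y \<le> 2 * r / \<delta>" "\<And>z. ?f y \<le> ?f z"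
    proof (rule continuous_attains_min_of_coercive[of ?f "2 * r / \<delta>" w0])
      show "continuous_on UNIV ?f" using continuous_on_g contq by (intro continuous_intros) auto
      fix w assume w: "2 * r / \<delta> \<le> dist w0 w"
      define n where "n = norm (w - w0)"
      have n: "2 * r \<le> \<delta> * n" using w \<delta> by (simp add: n_def dist_norm norm_minus_commute field_simps)
      have n0: "0 \<le> n" by (simp add: n_def)
      have "- (p \<bullet> (w - w0)) \<le> norm p * n" using Cauchy_Schwarz_ineq2[of p "w - w0"] by (simp add: n_def)
      also have "\<dots> \<le> r * n" using p n0 by (intro mult_right_mono) auto
      also have "\<dots> \<le> \<delta> / 2 * n\<^sup>2" using mult_right_mono[OF n n0] by (simp add: power2_eq_square)
      finally show "?f w0 \<le> ?f w"
        using touch[of w] by (simp add: q_def n_def linear_0[OF A(1)])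
    qed (use r \<delta> in auto)
    then show ?thesis by (intro exI[of _ y]) (simp only: neg_le_iff_le simp_thms)
  qed
  have touched: "g (y + h) \<le> g y + \<xi>p p y \<bullet> h + (h \<bullet> A h) / 2 + \<delta> / 2 * (norm h)\<^sup>2"
    if "\<forall>w. g w - q w - p \<bullet> (w - w0) \<le> g y - q y - p \<bullet> (y - w0)" for p y h
  proof -
    define k where "k = y - w0"
    have yh: "y + h - w0 = k + h" "y - w0 = k" by (simp_all add: k_def)
    have "k \<bullet> A h = h \<bullet> A k" using A(2)[of k h] by (simp add: inner_commute)
    then show ?thesis using that[rule_format, of "y + h"]
      unfolding q_def \<xi>p_def yh power2_norm_eq_inner
      by (simp add: linear_add[OF A(1)] inner_add_left inner_add_right inner_commute field_simps)
  qed
  have upper: "g (y + h) \<le> g y + \<xi>p p y \<bullet> h + C * (norm h)\<^sup>2"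
    if "\<forall>w. g w - q w - p \<bullet> (w - w0) \<le> g y - q y - p \<bullet> (y - w0)" for p y h
  proof -
    have "h \<bullet> A h \<le> norm h * (K * norm h)"
      using norm_cauchy_schwarz[of h "A h"] K(2)[of h] by (meson mult_left_mono norm_ge_zero order_trans)
    then have "(h \<bullet> A h) / 2 + \<delta> / 2 * (norm h)\<^sup>2 \<le> C * (norm h)\<^sup>2"
      by (simp add: C_def power2_eq_square field_simps)
    then show ?thesis using touched[OF that, of h] by linarith
  qed
  obtain Y where Y: "\<And>p. p \<in> ball 0 r \<Longrightarrow> dist w0 (Y p) \<le> 2 * r / \<delta>"
    "\<And>p. p \<in> ball 0 r \<Longrightarrow> \<forall>w. g w - q w - p \<bullet> (w - w0) \<le> g (Y p) - q (Y p) - p \<bullet> (Y p - w0)"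
    using max_ex by metis
  define X where "X p = Y p + \<xi>p p (Y p)" for p
  have sg: "subgrad g (Y p) (\<xi>p p (Y p))" if "p \<in> ball 0 r" for p
    by (rule subgrad_of_quadratic_upper_bound(1)[OF upper[OF Y(2)[OF that]]])
  have JX: "J (X p) = Y p" if "p \<in> ball 0 r" for p
    unfolding X_def by (rule J_eq[OF sg[OF that]])
  have PX: "P (X p) = p" if "p \<in> ball 0 r" for p
    unfolding P_def JX[OF that] by (simp add: X_def \<xi>p_def)
  define N where "N = {x. \<not> J differentiable (at x)}"
  have "negligible N" unfolding N_def
    by (rule Rademacher[where L=1]) (use J_nonexpansive in simp)
  then have "negligible (P ` N)"
  proof (rule negligible_locally_Lipschitz_image[OF order_refl])
    fix x assume "x \<in> N"
    have "norm (P y - P x) \<le> (2 + K + \<delta>) * norm (y - x)" for y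
    proof -
      have "P y - P x = (y - x) - (J y - J x) - A (J y - J x) - \<delta> *\<^sub>R (J y - J x)"
        by (simp add: P_def linear_diff[OF A(1)] algebra_simps)
      also have "norm \<dots> \<le> norm (y - x) + norm (J y - J x) + norm (A (J y - J x)) + norm (\<delta> *\<^sub>R (J y - J x))"
        by (meson norm_triangle_ineq4 add_right_mono order_trans)
      also have "\<dots> \<le> norm (y - x) + norm (y - x) + K * norm (y - x) + \<delta> * norm (y - x)"
      proof -
        have "K * norm (J y - J x) \<le> K * norm (y - x)" using J_nonexpansive K by (intro mult_left_mono) auto
        moreover have "\<delta> * norm (J y - J x) \<le> \<delta> * norm (y - x)" using J_nonexpansive \<delta> by (intro mult_left_mono) auto
        moreover have "norm (\<delta> *\<^sub>R (J y - J x)) = \<delta> * norm (J y - J x)" using \<delta> by simp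
        ultimately show ?thesis using J_nonexpansive[of y x] K(2)[of "J y - J x"] by linarith
      qed
      finally show ?thesis by (simp add: algebra_simps)
    qed
    then show "\<exists>T B. open T \<and> x \<in> T \<and> (\<forall>y\<in>N \<inter> T. norm (P y - P x) \<le> B * norm (y - x))"
      by (intro exI[of _ UNIV] exI[of _ "2 + K + \<delta>"]) auto
  qed
  moreover have "\<not> negligible (ball (0::'a) r)" using r by (simp add: open_not_negligible)
  ultimately obtain p where p: "p \<in> ball 0 r" "p \<notin> P ` N" using negligible_subset by blast
  have "X p \<notin> N" using p PX by force
  then have diff: "J differentiable (at (Y p + \<xi>p p (Y p)))" by (simp add: N_def X_def)
  note up = upper[OF Y(2)[OF p(1)]]
  obtain H where H: "linear H" "\<And>e. 0 < e \<Longrightarrow> \<exists>d>0. \<forall>h \<xi>. norm h < d \<longrightarrow> subgrad g (Y p + h) \<xi> \<longrightarrow> norm (\<xi> - \<xi>p p (Y p) - H h) \<le> e * norm h"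
    using subgrad_expansion[OF C up diff] by blast
  have expn: "\<exists>d>0. \<forall>h. norm h < d \<longrightarrow> \<bar>g (Y p + h) - g (Y p) - \<xi>p p (Y p) \<bullet> h - (h \<bullet> H h) / 2\<bar> \<le> e * (norm h)\<^sup>2"
    if "0 < e" for e
    by (rule second_order_expansion[OF sg[OF p(1)] H(1) _ that]) (rule H(2))
  have scal: "\<exists>t>0. \<bar>g (Y p + t *\<^sub>R h) - g (Y p) - t * (\<xi>p p (Y p) \<bullet> h) - t\<^sup>2 * (h \<bullet> H h) / 2\<bar> \<le> t\<^sup>2 * (e * (norm h)\<^sup>2)"
    if e0: "0 < e" for e h
  proof -
    obtain d where d: "d > 0" "\<And>h. norm h < d \<Longrightarrow> \<bar>g (Y p + h) - g (Y p) - \<xi>p p (Y p) \<bullet> h - (h \<bullet> H h) / 2\<bar> \<le> e * (norm h)\<^sup>2"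
      using expn[OF e0] by blast
    define t where "t = d / (2 * (norm h + 1))"
    have n: "0 < norm h + 1" by (simp add: add_nonneg_pos)
    then have "t > 0" using d(1) by (simp add: t_def)
    have "d / (2 * x) * x = d / 2" if "0 < x" for x using that by simp
    then have "t * (norm h + 1) = d / 2" using n unfolding t_def by blast
    then have "norm (t *\<^sub>R h) < d" using d(1) \<open>t > 0\<close> by (simp add: distrib_left)
    from d(2)[OF this] show ?thesis using \<open>t > 0\<close>
      by (intro exI[of _ t]) (simp add: linear_scale[OF H(1)] power2_eq_square power_mult_distrib algebra_simps)
  qed
  have Hpos: "0 \<le> h \<bullet> H h" for h
  proof (rule field_le_epsilon)
    fix e :: real assume e: "0 < e"
    define e' where "e' = e / (2 * ((norm h)\<^sup>2 + 1))"
    have e': "e' > 0" "2 * (e' * (norm h)\<^sup>2) \<le> e"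
    proof -
      have n: "0 < (norm h)\<^sup>2 + 1" by (simp add: add_nonneg_pos)
      then show "e' > 0" using e by (simp add: e'_def)
      have "e / (2 * x) * x = e / 2" if "0 < x" for x using that by simp
      then have "e' * ((norm h)\<^sup>2 + 1) = e / 2" using n unfolding e'_def by blast
      then show "2 * (e' * (norm h)\<^sup>2) \<le> e" using \<open>e' > 0\<close> by (simp add: distrib_left)
    qed
    obtain t where t: "t > 0" "\<bar>g (Y p + t *\<^sub>R h) - g (Y p) - t * (\<xi>p p (Y p) \<bullet> h) - t\<^sup>2 * (h \<bullet> H h) / 2\<bar> \<le> t\<^sup>2 * (e' * (norm h)\<^sup>2)"
      using scal[OF e'(1)] by blast
    have "0 \<le> t\<^sup>2 * (h \<bullet> H h) / 2 + t\<^sup>2 * (e' * (norm h)\<^sup>2)"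
      using t(2) subgradD[OF sg[OF p(1)], of "Y p + t *\<^sub>R h"] by (simp add: abs_le_iff)
    then have "0 \<le> t\<^sup>2 * (h \<bullet> H h + 2 * (e' * (norm h)\<^sup>2))" by (simp add: algebra_simps)
    then show "0 \<le> h \<bullet> H h + e" using t(1) e'(2) by (simp add: zero_le_mult_iff)
  qed
  have Hup: "h \<bullet> H h \<le> h \<bullet> A h + \<rho> * (norm h)\<^sup>2" for h
  proof -
    obtain t where t: "t > 0" "\<bar>g (Y p + t *\<^sub>R h) - g (Y p) - t * (\<xi>p p (Y p) \<bullet> h) - t\<^sup>2 * (h \<bullet> H h) / 2\<bar> \<le> t\<^sup>2 * (\<rho> / 4 * (norm h)\<^sup>2)"
      using scal[of "\<rho> / 4"] \<rho> by auto
    have "g (Y p + t *\<^sub>R h) \<le> g (Y p) + t * (\<xi>p p (Y p) \<bullet> h) + t\<^sup>2 * (h \<bullet> A h) / 2 + t\<^sup>2 * (\<delta> / 2 * (norm h)\<^sup>2)"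
      using t(1) touched[OF Y(2)[OF p(1)], of "t *\<^sub>R h"]
      by (simp add: linear_scale[OF A(1)] power_mult_distrib power2_eq_square mult.assoc mult.left_commute)
    then have "t\<^sup>2 * (h \<bullet> H h) / 2 \<le> t\<^sup>2 * (h \<bullet> A h) / 2 + t\<^sup>2 * (\<delta> / 2 * (norm h)\<^sup>2) + t\<^sup>2 * (\<rho> / 4 * (norm h)\<^sup>2)"
      using t(2) unfolding abs_le_iff by linarith
    then have "t\<^sup>2 * (h \<bullet> H h) \<le> t\<^sup>2 * (h \<bullet> A h + \<rho> * (norm h)\<^sup>2)" by (simp add: \<delta>_def algebra_simps)
    then show ?thesis using t(1) by simp
  qed
  have Yd: "norm (Y p - w0) \<le> 2 * r / \<delta>" using Y(1)[OF p(1)] by (simp add: dist_norm norm_minus_commute)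
  show ?thesis
  proof (rule that[OF _ _ H(1) sg[OF p(1)] subgrad_of_quadratic_upper_bound(2)[OF up] expn Hpos Hup])
    have "2 * r / \<delta> \<le> \<rho> / 2" using \<delta> by (simp add: r_def field_simps min_le_iff_disj)
    then show "norm (Y p - w0) < \<rho>" using Yd \<rho> by simp
    have "norm (\<xi>p p (Y p) - a0) \<le> norm p + norm (A (Y p - w0)) + norm (\<delta> *\<^sub>R (Y p - w0))"
      unfolding \<xi>p_def using norm_triangle_ineq[of "p + A (Y p - w0)" "\<delta> *\<^sub>R (Y p - w0)"] norm_triangle_ineq[of p "A (Y p - w0)"]
      by (simp add: add.assoc)
    also have "\<dots> \<le> r + (K + \<delta>) * (2 * r / \<delta>)"
    proof -
      have "norm (A (Y p - w0)) \<le> K * (2 * r / \<delta>)"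
        using K(2)[of "Y p - w0"] mult_left_mono[OF Yd, of K] K(1) by linarith
      moreover have "norm (\<delta> *\<^sub>R (Y p - w0)) \<le> \<delta> * (2 * r / \<delta>)"
        using mult_left_mono[OF Yd, of \<delta>] \<delta> by simp
      moreover have "norm p < r" using p(1) by simp
      ultimately show ?thesis unfolding distrib_right by linarith
    qed
    also have "\<dots> = r * (1 + (K + \<delta>) * 2 / \<delta>)" by (simp add: algebra_simps add_divide_distrib)
    also have "\<dots> \<le> \<rho> / (2 * (1 + (K + \<delta>) * 2 / \<delta>)) * (1 + (K + \<delta>) * 2 / \<delta>)"
      using K \<delta> by (intro mult_right_mono) (auto simp: r_def add_nonneg_nonneg)
    also have "\<dots> = \<rho> / 2"
    proof -
      have "0 < 1 + (K + \<delta>) * 2 / \<delta>" using K \<delta> by (intro add_pos_pos) auto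
      moreover have "\<rho> / (2 * x) * x = \<rho> / 2" if "0 < x" for x using that by simp
      ultimately show ?thesis by blast
    qed
    also have "\<dots> < \<rho>" using \<rho> by simp
    finally show "norm (\<xi>p p (Y p) - a0) < \<rho>" .
  qed
qed

end

section \<open>The theorem on sums\<close>

text \<open>
  Test functions need a symmetric Hessian, whereas the linear map of a second-order expansion matters
  only through its quadratic form.
\<close>

lemma symmetrization:
  fixes H :: "'a::euclidean_space \<Rightarrow> 'a"
  assumes "linear H"
  obtains S where "linear S" "\<And>v w. v \<bullet> S w = S v \<bullet> w" "\<And>h. h \<bullet> S h = h \<bullet> H h"
proof
  let ?S = "\<lambda>v. (1/2) *\<^sub>R (H v + adjoint H v)"
  have a: "linear (adjoint H)" by (rule adjoint_linear[OF assms])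
  show "linear ?S" using assms a by (intro linear_compose_scale_right linear_compose_add)
  show "v \<bullet> ?S w = ?S v \<bullet> w" for v w
    using adjoint_works[OF assms, of v w] adjoint_works[OF assms, of w v]
    by (simp add: inner_add_left inner_add_right inner_commute)
  show "h \<bullet> ?S h = h \<bullet> H h" for h
    using adjoint_works[OF assms, of h h] by (simp add: inner_add_right inner_commute)
qed

text \<open>
  The sup-convolution of \<open>U\<close> with the quadratic form \<open>3/2 v \<bullet> D v\<close> is \<open>G z - 3/2 z \<bullet> D z\<close>, where the convex
  function \<open>G\<close> is a supremum of affine functions. The factor \<open>3\<close> is the one for which the bounds that
  result for the Hessians are exactly those of the structure condition on the nonlinearity.
\<close>

locale sup_convolution =
  fixes U :: "'a::euclidean_space \<Rightarrow> real" and D :: "'a \<Rightarrow> 'a" and Q :: "'a set"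
  assumes D: "linear D" "\<And>v w. v \<bullet> D w = D v \<bullet> w" and psd: "\<And>v. 0 \<le> v \<bullet> D v"
    and Q: "compact Q" "Q \<noteq> {}" and U: "continuous_on Q U"
begin

definition val :: "'a \<Rightarrow> 'a \<Rightarrow> real"
  where "val z \<xi> = U \<xi> + 3 * (D z \<bullet> \<xi>) - 3 / 2 * (\<xi> \<bullet> D \<xi>)"

lemma maximizer_exists: "\<exists>\<xi>\<in>Q. \<forall>\<xi>'\<in>Q. val z \<xi>' \<le> val z \<xi>"
proof -
  have "continuous_on Q D"
    using D(1) by (intro linear_continuous_on linear_conv_bounded_linear[THEN iffD1])
  then have "continuous_on Q (val z)"
    unfolding val_def using U by (intro continuous_intros)
  then show ?thesis using continuous_attains_sup[OF Q] by blast
qed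

definition m :: "'a \<Rightarrow> 'a" where "m z = (SOME \<xi>. \<xi> \<in> Q \<and> (\<forall>\<xi>'\<in>Q. val z \<xi>' \<le> val z \<xi>))"

definition G :: "'a \<Rightarrow> real" where "G z = val z (m z)"

lemma m: "m z \<in> Q" "\<xi> \<in> Q \<Longrightarrow> val z \<xi> \<le> G z"
  using someI_ex[of "\<lambda>\<xi>. \<xi> \<in> Q \<and> (\<forall>\<xi>'\<in>Q. val z \<xi>' \<le> val z \<xi>)"] maximizer_exists[of z]
  unfolding m_def[symmetric] G_def by blast+

lemma subgrad_G: "subgrad G z (3 *\<^sub>R D (m z))"
  unfolding subgrad_def
proof
  fix y
  have "D y \<bullet> m z = D (m z) \<bullet> y" "D z \<bullet> m z = D (m z) \<bullet> z" using D(2)[of y "m z"] D(2)[of z "m z"] by (simp_all add: inner_commute)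
  then show "G z + 3 *\<^sub>R D (m z) \<bullet> (y - z) \<le> G y"
    using m(2)[OF m(1)[of z], of y] by (simp add: G_def val_def inner_diff_right)
qed

lemma subgradients_bounded: "\<exists>R. \<forall>z. norm (3 *\<^sub>R D (m z)) \<le> R"
proof -
  obtain K where K: "K > 0" "\<And>v. norm (D v) \<le> K * norm v" using linear_bounded_pos[OF D(1)] by blast
  obtain B where "\<And>\<xi>. \<xi> \<in> Q \<Longrightarrow> norm \<xi> \<le> B" using compact_imp_bounded[OF Q(1)] bounded_iff by blast
  then have "norm (3 *\<^sub>R D (m z)) \<le> 3 * (K * B)" for z
  proof -
    have "norm (m z) \<le> B" using m(1) \<open>\<And>\<xi>. \<xi> \<in> Q \<Longrightarrow> norm \<xi> \<le> B\<close> by blast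
    then have "K * norm (m z) \<le> K * B" using K(1) by simp
    then show ?thesis using K(2)[of "m z"] by simp
  qed
  then show ?thesis by blast
qed

text \<open>
  Shifting \<open>z\<close> and the maximizer \<open>m z\<close> by the same vector shows that the sup-convolution at \<open>z\<close> grows at
  least as fast as \<open>U\<close> at \<open>m z\<close>.
\<close>

lemma expansion_transfer:
  assumes "m z + h \<in> Q"
  shows "U (m z + h) \<le> U (m z) + (G (z + h) - G z) - 3 * (D z \<bullet> h) - 3 / 2 * (h \<bullet> D h)"
proof -
  have s: "D h \<bullet> m z = m z \<bullet> D h" "h \<bullet> D (m z) = m z \<bullet> D h" "D h \<bullet> h = h \<bullet> D h" using D(2)[of "m z" h] by (simp_all add: inner_commute)
  have "U (m z + h) \<le> G (z + h) - 3 * (D (z + h) \<bullet> (m z + h)) + 3 / 2 * ((m z + h) \<bullet> D (m z + h))"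
    using m(2)[OF assms, of "z + h"] by (simp add: val_def)
  also have "\<dots> = U (m z) + (G (z + h) - G z) - 3 * (D z \<bullet> h) - 3 / 2 * (h \<bullet> D h)"
    by (simp add: G_def val_def linear_add[OF D(1)] inner_add_left inner_add_right s algebra_simps)
  finally show ?thesis .
qed

end

text \<open>This is \<open>(a + b + c)\<^sup>2 \<le> 3 (a\<^sup>2 + b\<^sup>2 + c\<^sup>2)\<close> for the quadratic form of \<open>D\<close>.\<close>

lemma psd_three_term:
  fixes D :: "'a::euclidean_space \<Rightarrow> 'a"
  assumes D: "linear D" "\<And>v w. v \<bullet> D w = D v \<bullet> w" and psd: "\<And>v. 0 \<le> v \<bullet> D v"
  shows "(a + b + c) \<bullet> D (a + b + c) \<le> 3 * (a \<bullet> D a + b \<bullet> D b + c \<bullet> D c)"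
proof -
  have s: "b \<bullet> D a = a \<bullet> D b" "c \<bullet> D a = a \<bullet> D c" "c \<bullet> D b = b \<bullet> D c"
    using D(2)[of a b] D(2)[of a c] D(2)[of b c] by (simp_all add: inner_commute)
  show ?thesis using psd[of "a - b"] psd[of "b - c"] psd[of "a - c"]
    by (simp add: linear_add[OF D(1)] linear_diff[OF D(1)] inner_add_left inner_add_right inner_diff_left inner_diff_right s)
qed

text \<open>
  With \<open>|v|\<^sub>D\<^sup>2 = v \<bullet> D v\<close>, the inequality \<open>|\<xi> - \<zeta>|\<^sub>D\<^sup>2 \<le> 3 (|\<xi> - z|\<^sub>D\<^sup>2 + |z - z'|\<^sub>D\<^sup>2 + |z' - \<zeta>|\<^sub>D\<^sup>2)\<close> shows
  that the two sup-convolutions minus \<open>3/2 |z - z'|\<^sub>D\<^sup>2\<close> stay below the maximal value. Equality holds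
  when the three differences on the right coincide, which for \<open>\<xi>0, \<zeta>0\<close> means that \<open>z, z'\<close> divide the
  segment between them into thirds; this point is \<open>w0\<close>. The sum of the two convex functions is therefore
  touched from above by a quadratic at \<open>w0\<close>, and its second-order expansion near \<open>w0\<close> splits into
  expansions of the summands.
\<close>

theorem theorem_on_sums:
  fixes U W :: "'a::euclidean_space \<Rightarrow> real" and D :: "'a \<Rightarrow> 'a"
  assumes D: "linear D" "\<And>v w. v \<bullet> D w = D v \<bullet> w" and c: "0 < c" "\<And>v. c * (norm v)\<^sup>2 \<le> v \<bullet> D v"
    and Q1: "compact Q1" "continuous_on Q1 U" "\<xi>0 \<in> Q1" and Q2: "compact Q2" "continuous_on Q2 W" "\<zeta>0 \<in> Q2"
    and max: "\<And>\<xi> \<zeta>. \<xi> \<in> Q1 \<Longrightarrow> \<zeta> \<in> Q2 \<Longrightarrow>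
      U \<xi> + W \<zeta> - ((\<xi> - \<zeta>) \<bullet> D (\<xi> - \<zeta>)) / 2 \<le> U \<xi>0 + W \<zeta>0 - ((\<xi>0 - \<zeta>0) \<bullet> D (\<xi>0 - \<zeta>0)) / 2"
    and \<rho>: "0 < \<rho>"
  obtains \<xi> \<zeta> P1 P2 H1 H2 where "\<xi> \<in> Q1" "\<zeta> \<in> Q2" "norm (\<xi> - \<xi>0) < \<rho>" "norm (\<zeta> - \<zeta>0) < \<rho>"
    "norm (P1 - D (\<xi>0 - \<zeta>0)) < \<rho>" "norm (P2 + D (\<xi>0 - \<zeta>0)) < \<rho>"
    "linear H1" "\<And>v w. v \<bullet> H1 w = H1 v \<bullet> w" "linear H2" "\<And>v w. v \<bullet> H2 w = H2 v \<bullet> w"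
    "\<And>e. 0 < e \<Longrightarrow> \<exists>d>0. \<forall>h. norm h < d \<longrightarrow> \<xi> + h \<in> Q1 \<longrightarrow> U (\<xi> + h) \<le> U \<xi> + P1 \<bullet> h + (h \<bullet> H1 h) / 2 + e * (norm h)\<^sup>2"
    "\<And>e. 0 < e \<Longrightarrow> \<exists>d>0. \<forall>h. norm h < d \<longrightarrow> \<zeta> + h \<in> Q2 \<longrightarrow> W (\<zeta> + h) \<le> W \<zeta> + P2 \<bullet> h + (h \<bullet> H2 h) / 2 + e * (norm h)\<^sup>2"
    "\<And>h. - 3 * (h \<bullet> D h) \<le> h \<bullet> H1 h" "\<And>h. - 3 * (h \<bullet> D h) \<le> h \<bullet> H2 h"
    "\<And>h k. h \<bullet> H1 h + k \<bullet> H2 k \<le> 3 * ((h - k) \<bullet> D (h - k)) + \<rho> * ((norm h)\<^sup>2 + (norm k)\<^sup>2)"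
proof -
  have psd: "0 \<le> v \<bullet> D v" for v using c(1) order_trans[OF _ c(2)[of v]] by simp
  have ne: "Q1 \<noteq> {}" "Q2 \<noteq> {}" using Q1(3) Q2(3) by auto
  interpret U: sup_convolution U D Q1 by (rule sup_convolution.intro) (fact D psd Q1 ne)+
  interpret W: sup_convolution W D Q2 by (rule sup_convolution.intro) (fact D psd Q2 ne)+
  obtain K where K: "K > 0" "\<And>v. norm (D v) \<le> K * norm v" using linear_bounded_pos[OF D(1)] by blast
  define g where "g w = U.G (fst w) + W.G (snd w)" for w
  define s where "s w = (3 *\<^sub>R D (U.m (fst w)), 3 *\<^sub>R D (W.m (snd w)))" for w
  obtain R1 R2 where R: "\<And>z. norm (3 *\<^sub>R D (U.m z)) \<le> R1" "\<And>z. norm (3 *\<^sub>R D (W.m z)) \<le> R2"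
    using U.subgradients_bounded W.subgradients_bounded by blast
  interpret bounded_subgradients g s "R1 + R2"
  proof
    show "subgrad g z (s z)" for z
      unfolding subgrad_def
    proof
      fix y
      show "g z + s z \<bullet> (y - z) \<le> g y"
        using subgradD[OF U.subgrad_G, of "fst z" "fst y"] subgradD[OF W.subgrad_G, of "snd z" "snd y"]
        by (simp add: g_def s_def inner_prod_def)
    qed
    show "norm (s z) \<le> R1 + R2" for z
      unfolding s_def using norm_Pair_le[of "3 *\<^sub>R D (U.m (fst z))" "3 *\<^sub>R D (W.m (snd z))"] R[of "fst z"] R(2)[of "snd z"] by linarith
  qed
  define A where "A w = (3 *\<^sub>R (D (fst w) + D (fst w - snd w)), 3 *\<^sub>R (D (snd w) - D (fst w - snd w)))" for w
  have linA: "linear A"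
    by (rule linearI) (simp_all add: A_def linear_add[OF D(1)] linear_diff[OF D(1)] linear_scale[OF D(1)] algebra_simps)
  have symA: "v \<bullet> A w = A v \<bullet> w" for v w
    using D(2)[of "fst v" "fst w"] D(2)[of "fst v" "snd w"] D(2)[of "snd v" "fst w"] D(2)[of "snd v" "snd w"]
    by (simp add: A_def inner_prod_def linear_diff[OF D(1)] inner_add_left inner_add_right inner_diff_left inner_diff_right algebra_simps)
  have formA: "w \<bullet> A w = 3 * (fst w \<bullet> D (fst w) + snd w \<bullet> D (snd w) + (fst w - snd w) \<bullet> D (fst w - snd w))" for w
    by (simp add: A_def inner_prod_def inner_add_right inner_diff_right inner_diff_left algebra_simps)
  define w0 where "w0 = ((1/3) *\<^sub>R (2 *\<^sub>R \<xi>0 + \<zeta>0), (1/3) *\<^sub>R (\<xi>0 + 2 *\<^sub>R \<zeta>0))"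
  define M where "M = U \<xi>0 + W \<zeta>0 - ((\<xi>0 - \<zeta>0) \<bullet> D (\<xi>0 - \<zeta>0)) / 2"
  have above: "g w \<le> M + (w \<bullet> A w) / 2" for w
  proof -
    obtain z z' where w: "w = (z, z')" by (cases w)
    define \<xi> \<zeta> where "\<xi> = U.m z" and "\<zeta> = W.m z'"
    have "U \<xi> + W \<zeta> \<le> M + ((\<xi> - \<zeta>) \<bullet> D (\<xi> - \<zeta>)) / 2"
      using max[OF U.m(1)[of z] W.m(1)[of z']] by (simp add: M_def \<xi>_def \<zeta>_def)
    moreover have "(\<xi> - \<zeta>) \<bullet> D (\<xi> - \<zeta>) \<le> 3 * ((\<xi> - z) \<bullet> D (\<xi> - z) + (z - z') \<bullet> D (z - z') + (z' - \<zeta>) \<bullet> D (z' - \<zeta>))"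
      using psd_three_term[OF D psd, of "\<xi> - z" "z - z'" "z' - \<zeta>"] by simp
    moreover have "(\<xi> - z) \<bullet> D (\<xi> - z) = \<xi> \<bullet> D \<xi> - 2 * (D z \<bullet> \<xi>) + z \<bullet> D z"
      using D(2)[of z \<xi>] by (simp add: linear_diff[OF D(1)] inner_diff_left inner_diff_right inner_commute)
    moreover have "(z' - \<zeta>) \<bullet> D (z' - \<zeta>) = \<zeta> \<bullet> D \<zeta> - 2 * (D z' \<bullet> \<zeta>) + z' \<bullet> D z'"
      using D(2)[of z' \<zeta>] by (simp add: linear_diff[OF D(1)] inner_diff_left inner_diff_right inner_commute)
    ultimately show ?thesis unfolding formA
      by (simp add: g_def w U.G_def W.G_def U.val_def W.val_def \<xi>_def[symmetric] \<zeta>_def[symmetric]) argo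
  qed
  have below: "M + (w0 \<bullet> A w0) / 2 \<le> g w0"
  proof -
    have sym: "\<zeta>0 \<bullet> D \<xi>0 = \<xi>0 \<bullet> D \<zeta>0" "D \<xi>0 \<bullet> \<zeta>0 = \<xi>0 \<bullet> D \<zeta>0" "D \<zeta>0 \<bullet> \<xi>0 = \<xi>0 \<bullet> D \<zeta>0"
      "D \<xi>0 \<bullet> \<xi>0 = \<xi>0 \<bullet> D \<xi>0" "D \<zeta>0 \<bullet> \<zeta>0 = \<zeta>0 \<bullet> D \<zeta>0"
      using D(2)[of \<xi>0 \<zeta>0] by (simp_all add: inner_commute)
    have "M + (w0 \<bullet> A w0) / 2 = U.val (fst w0) \<xi>0 + W.val (snd w0) \<zeta>0"
      unfolding formA
      by (simp add: M_def U.val_def W.val_def w0_def linear_add[OF D(1)] linear_diff[OF D(1)] linear_scale[OF D(1)]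
          inner_add_left inner_add_right inner_diff_left inner_diff_right sym field_simps)
    then show ?thesis using U.m(2)[OF Q1(3), of "fst w0"] W.m(2)[OF Q2(3), of "snd w0"] by (simp add: g_def)
  qed
  \<comment> \<open>the subgradients that \<open>\<xi>0\<close> and \<open>\<zeta>0\<close> induce as maximizers; as \<open>D\<close> is coercive, closeness of subgradients gives closeness of maximizers\<close>
  have Aw0: "A w0 = (3 *\<^sub>R D \<xi>0, 3 *\<^sub>R D \<zeta>0)"
  proof -
    have "fst w0 + (fst w0 - snd w0) = \<xi>0" "snd w0 - (fst w0 - snd w0) = \<zeta>0"
    proof -
      have "(4/3) *\<^sub>R v = v + (1/3) *\<^sub>R v" "(2/3) *\<^sub>R v = (1/3) *\<^sub>R v + (1/3) *\<^sub>R v" for v :: 'a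
        using scaleR_add_left[of 1 "1/3" v] scaleR_add_left[of "1/3" "1/3" v] by simp_all
      moreover have "(1/3) *\<^sub>R v + ((1/3) *\<^sub>R v + (1/3) *\<^sub>R v) = v" for v :: 'a
        by (simp add: scaleR_add_left[symmetric])
      ultimately show "fst w0 + (fst w0 - snd w0) = \<xi>0" "snd w0 - (fst w0 - snd w0) = \<zeta>0"
        by (simp_all add: w0_def algebra_simps)
    qed
    then show ?thesis unfolding A_def linear_add[OF D(1), symmetric] linear_diff[OF D(1), symmetric] by simp
  qed
  have touch: "g w \<le> g w0 + A w0 \<bullet> (w - w0) + ((w - w0) \<bullet> A (w - w0)) / 2" for w
  proof -
    have "(w - w0) \<bullet> A (w - w0) = w \<bullet> A w - 2 * (A w0 \<bullet> w) + w0 \<bullet> A w0"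
      using symA[of w0 w] inner_commute[of w "A w0"]
      by (simp add: linear_diff[OF linA] inner_diff_left inner_diff_right)
    moreover have "A w0 \<bullet> (w - w0) = A w0 \<bullet> w - w0 \<bullet> A w0"
      by (simp add: inner_diff_right inner_commute[of "A w0" w0])
    ultimately show ?thesis using above[of w] below by argo
  qed
  define \<rho>' where "\<rho>' = min \<rho> (min (3 * c * \<rho>) (\<rho> / (1 + 3 * K)))"
  have \<rho>': "0 < \<rho>'" "\<rho>' \<le> \<rho>" "\<rho>' \<le> 3 * c * \<rho>" "\<rho>' \<le> \<rho> / (1 + 3 * K)" using \<rho> c K by (auto simp: \<rho>'_def)
  have \<rho>'K: "\<rho>' * (1 + 3 * K) \<le> \<rho>" using \<rho>'(4) K by (simp add: field_simps)
  obtain y \<xi>' H where y: "norm (y - w0) < \<rho>'" "norm (\<xi>' - A w0) < \<rho>'" "linear H"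
      "subgrad g y \<xi>'" "\<And>\<zeta>. subgrad g y \<zeta> \<Longrightarrow> \<zeta> = \<xi>'"
    and ex: "\<And>e. 0 < e \<Longrightarrow> \<exists>d>0. \<forall>h. norm h < d \<longrightarrow> \<bar>g (y + h) - g y - \<xi>' \<bullet> h - (h \<bullet> H h) / 2\<bar> \<le> e * (norm h)\<^sup>2"
    and Hb: "\<And>h. 0 \<le> h \<bullet> H h" "\<And>h. h \<bullet> H h \<le> h \<bullet> A h + \<rho>' * (norm h)\<^sup>2"
    using twice_differentiable_near_touched_point[OF linA symA \<rho>'(1) touch] by blast
  obtain z z' where yz: "y = (z, z')" by (cases y)
  have \<xi>': "\<xi>' = (3 *\<^sub>R D (U.m z), 3 *\<^sub>R D (W.m z'))" using y(5)[OF sub, symmetric] by (simp add: s_def yz)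
  define F1 where "F1 h = fst (H (h, 0)) - 3 *\<^sub>R D h" for h
  define F2 where "F2 h = snd (H (0, h)) - 3 *\<^sub>R D h" for h
  have linF: "linear F1" "linear F2"
  proof -
    have "linear (\<lambda>h. H (h, 0))" using linear_compose[of "\<lambda>h. (h, 0)" H] y(3) by (simp add: comp_def linearI)
    then have "linear (\<lambda>h. fst (H (h, 0)))" using linear_compose[OF _ linear_fst] by (simp add: comp_def)
    then show "linear F1" unfolding F1_def by (intro linear_compose_sub linear_compose_scale_right D(1))
    have "linear (\<lambda>h. H (0, h))" using linear_compose[of "\<lambda>h. (0, h)" H] y(3) by (simp add: comp_def linearI)
    then have "linear (\<lambda>h. snd (H (0, h)))" using linear_compose[OF _ linear_snd] by (simp add: comp_def)
    then show "linear F2" unfolding F2_def by (intro linear_compose_sub linear_compose_scale_right D(1))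
  qed
  have form1: "h \<bullet> F1 h = (h, 0) \<bullet> H (h, 0) - 3 * (h \<bullet> D h)" for h
    by (simp add: F1_def inner_prod_def inner_diff_right)
  have form2: "h \<bullet> F2 h = (0, h) \<bullet> H (0, h) - 3 * (h \<bullet> D h)" for h
    by (simp add: F2_def inner_prod_def inner_diff_right)
  have close: "norm (\<xi> - \<xi>0) < \<rho>" if "norm (3 *\<^sub>R D \<xi> - 3 *\<^sub>R D \<xi>0) < \<rho>'" for \<xi> \<xi>0
  proof -
    define v where "v = \<xi> - \<xi>0"
    have "norm (3 *\<^sub>R D v) < 3 * c * \<rho>" using that \<rho>'(3) by (simp add: v_def linear_diff[OF D(1)] scaleR_diff_right)
    moreover have "c * (norm v)\<^sup>2 \<le> norm v * norm (D v)" using c(2)[of v] norm_cauchy_schwarz[of v "D v"] by linarith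
    then have "c * norm v \<le> norm (D v)" by (cases "v = 0") (auto simp: power2_eq_square)
    ultimately have "c * norm v < c * \<rho>" by simp
    then show ?thesis using c(1) by (simp add: v_def)
  qed
  have comps: "norm (fst p) \<le> norm p" "norm (snd p) \<le> norm p" for p :: "'a \<times> 'a"
    by (cases p; simp add: norm_fst_le norm_snd_le)+
  have n: "norm (3 *\<^sub>R D (U.m z) - 3 *\<^sub>R D \<xi>0) < \<rho>'" "norm (3 *\<^sub>R D (W.m z') - 3 *\<^sub>R D \<zeta>0) < \<rho>'"
    "norm (z - fst w0) < \<rho>'" "norm (z' - snd w0) < \<rho>'"
    using y(1,2) comps[of "\<xi>' - A w0"] comps[of "y - w0"] by (simp_all add: \<xi>' Aw0 yz)
  define P1 where "P1 = 3 *\<^sub>R D (U.m z) - 3 *\<^sub>R D z"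
  define P2 where "P2 = 3 *\<^sub>R D (W.m z') - 3 *\<^sub>R D z'"
  have bd: "norm (a - 3 *\<^sub>R D b) < \<rho>" if "norm a < \<rho>'" "norm b < \<rho>'" for a b
  proof -
    have "norm (a - 3 *\<^sub>R D b) \<le> norm a + 3 * norm (D b)" using norm_triangle_ineq4[of a "3 *\<^sub>R D b"] by simp
    also have "\<dots> < \<rho>' + 3 * (K * \<rho>')"
      using that K(2)[of b] mult_strict_left_mono[OF that(2) K(1)] by linarith
    also have "\<dots> = \<rho>' * (1 + 3 * K)" by (simp add: algebra_simps)
    also have "\<dots> \<le> \<rho>" by (rule \<rho>'K)
    finally show ?thesis .
  qed
  have P1: "norm (P1 - D (\<xi>0 - \<zeta>0)) < \<rho>"
  proof -
    have "3 *\<^sub>R v = v + v + v" for v :: 'a using scaleR_add_left[of 2 1 v] scaleR_2[of v] by simp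
    then have "3 *\<^sub>R fst w0 = 3 *\<^sub>R \<xi>0 - (\<xi>0 - \<zeta>0)" by (simp add: w0_def scaleR_2)
    then have "3 *\<^sub>R D (fst w0) = 3 *\<^sub>R D \<xi>0 - D (\<xi>0 - \<zeta>0)"
      by (metis linear_diff[OF D(1)] linear_scale[OF D(1)])
    then have "P1 - D (\<xi>0 - \<zeta>0) = (3 *\<^sub>R D (U.m z) - 3 *\<^sub>R D \<xi>0) - 3 *\<^sub>R D (z - fst w0)"
      by (simp add: P1_def linear_diff[OF D(1)] scaleR_diff_right)
    then show ?thesis using bd[OF n(1,3)] by simp
  qed
  have P2: "norm (P2 + D (\<xi>0 - \<zeta>0)) < \<rho>"
  proof -
    have "3 *\<^sub>R v = v + v + v" for v :: 'a using scaleR_add_left[of 2 1 v] scaleR_2[of v] by simp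
    then have "3 *\<^sub>R snd w0 = 3 *\<^sub>R \<zeta>0 + (\<xi>0 - \<zeta>0)" by (simp add: w0_def scaleR_2)
    then have "3 *\<^sub>R D (snd w0) = 3 *\<^sub>R D \<zeta>0 + D (\<xi>0 - \<zeta>0)"
      by (metis linear_add[OF D(1)] linear_scale[OF D(1)])
    then have "P2 + D (\<xi>0 - \<zeta>0) = (3 *\<^sub>R D (W.m z') - 3 *\<^sub>R D \<zeta>0) - 3 *\<^sub>R D (z' - snd w0)"
      by (simp add: P2_def linear_diff[OF D(1)] scaleR_diff_right)
    then show ?thesis using bd[OF n(2,4)] by simp
  qed
  have exp1: "\<exists>d>0. \<forall>h. norm h < d \<longrightarrow> U.m z + h \<in> Q1 \<longrightarrow> U (U.m z + h) \<le> U (U.m z) + P1 \<bullet> h + (h \<bullet> F1 h) / 2 + e * (norm h)\<^sup>2"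
    if e: "0 < e" for e
  proof -
    obtain d where d: "d > 0" "\<And>h. norm h < d \<Longrightarrow> \<bar>g (y + h) - g y - \<xi>' \<bullet> h - (h \<bullet> H h) / 2\<bar> \<le> e * (norm h)\<^sup>2"
      using ex[OF e] by blast
    have "U (U.m z + h) \<le> U (U.m z) + P1 \<bullet> h + (h \<bullet> F1 h) / 2 + e * (norm h)\<^sup>2"
      if "norm h < d" "U.m z + h \<in> Q1" for h
    proof -
      have "U.G (z + h) - U.G z \<le> (3 *\<^sub>R D (U.m z)) \<bullet> h + ((h, 0) \<bullet> H (h, 0)) / 2 + e * (norm h)\<^sup>2"
        using d(2)[of "(h, 0)"] that(1) by (simp add: abs_le_iff g_def yz \<xi>' inner_prod_def norm_Pair)
      then show ?thesis using U.expansion_transfer[OF that(2)]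
        unfolding form1 by (simp add: P1_def inner_diff_left diff_divide_distrib)
    qed
    then show ?thesis using d(1) by blast
  qed
  have exp2: "\<exists>d>0. \<forall>h. norm h < d \<longrightarrow> W.m z' + h \<in> Q2 \<longrightarrow> W (W.m z' + h) \<le> W (W.m z') + P2 \<bullet> h + (h \<bullet> F2 h) / 2 + e * (norm h)\<^sup>2"
    if e: "0 < e" for e
  proof -
    obtain d where d: "d > 0" "\<And>h. norm h < d \<Longrightarrow> \<bar>g (y + h) - g y - \<xi>' \<bullet> h - (h \<bullet> H h) / 2\<bar> \<le> e * (norm h)\<^sup>2"
      using ex[OF e] by blast
    have "W (W.m z' + h) \<le> W (W.m z') + P2 \<bullet> h + (h \<bullet> F2 h) / 2 + e * (norm h)\<^sup>2"
      if "norm h < d" "W.m z' + h \<in> Q2" for h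
    proof -
      have "W.G (z' + h) - W.G z' \<le> (3 *\<^sub>R D (W.m z')) \<bullet> h + ((0, h) \<bullet> H (0, h)) / 2 + e * (norm h)\<^sup>2"
        using d(2)[of "(0, h)"] that(1) by (simp add: abs_le_iff g_def yz \<xi>' inner_prod_def norm_Pair)
      then show ?thesis using W.expansion_transfer[OF that(2)]
        unfolding form2 by (simp add: P2_def inner_diff_left diff_divide_distrib)
    qed
    then show ?thesis using d(1) by blast
  qed
  \<comment> \<open>\<open>g\<close> is a sum of functions of separate variables, so the mixed part of \<open>H\<close> vanishes\<close>
  have mixed: "(h, 0) \<bullet> H (h, 0) + (0, k) \<bullet> H (0, k) \<le> (h, k) \<bullet> H (h, k)" for h k
  proof (rule field_le_epsilon)
    fix e :: real assume e: "0 < e"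
    define N where "N = (norm h)\<^sup>2 + (norm k)\<^sup>2 + 1"
    have N: "N > 0" by (simp add: N_def add_nonneg_pos)
    define e' where "e' = e / (6 * N)"
    have e': "e' > 0" using e N by (simp add: e'_def)
    obtain d where d: "d > 0" "\<And>h. norm h < d \<Longrightarrow> \<bar>g (y + h) - g y - \<xi>' \<bullet> h - (h \<bullet> H h) / 2\<bar> \<le> e' * (norm h)\<^sup>2"
      using ex[OF e'] by blast
    define t where "t = d / (2 * N)"
    have t: "t > 0" using d(1) N by (simp add: t_def)
    have nN: "norm p < 2 * N" if "(norm p)\<^sup>2 \<le> N" for p :: "'a \<times> 'a"
    proof -
      have "0 \<le> (norm p - 1)\<^sup>2" by simp
      then have "2 * norm p \<le> (norm p)\<^sup>2 + 1" by (simp add: power2_eq_square algebra_simps)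
      then have "2 * norm p \<le> N + 1" using that by simp
      then show ?thesis using N_def by (smt (verit) zero_le_power2)
    qed
    have exq: "\<bar>g (y + t *\<^sub>R p) - g y - t * (\<xi>' \<bullet> p) - t\<^sup>2 * (p \<bullet> H p) / 2\<bar> \<le> t\<^sup>2 * (e / 6)" if p: "(norm p)\<^sup>2 \<le> N" for p
    proof -
      have "norm (t *\<^sub>R p) < d" using nN[OF p] t d(1) N by (simp add: t_def field_simps)
      then have "\<bar>g (y + t *\<^sub>R p) - g y - \<xi>' \<bullet> (t *\<^sub>R p) - ((t *\<^sub>R p) \<bullet> H (t *\<^sub>R p)) / 2\<bar> \<le> e' * (norm (t *\<^sub>R p))\<^sup>2" by (rule d(2))
      also have "\<dots> = t\<^sup>2 * (e' * (norm p)\<^sup>2)" by (simp add: power_mult_distrib)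
      also have "\<dots> \<le> t\<^sup>2 * (e' * N)" using p e' by (intro mult_left_mono) auto
      also have "e' * N = e / 6" using N by (simp add: e'_def)
      finally show ?thesis by (simp add: linear_scale[OF y(3)] power2_eq_square mult.assoc)
    qed
    have N3: "(norm (h, 0::'a))\<^sup>2 \<le> N" "(norm (0::'a, k))\<^sup>2 \<le> N" "(norm (h, k))\<^sup>2 \<le> N"
      by (simp_all add: N_def norm_Pair)
    have gsum: "g (y + t *\<^sub>R (h, k)) - g y = (g (y + t *\<^sub>R (h, 0)) - g y) + (g (y + t *\<^sub>R (0, k)) - g y)"
      by (simp add: g_def yz)
    have isum: "\<xi>' \<bullet> (h, k) = \<xi>' \<bullet> (h, 0) + \<xi>' \<bullet> (0, k)" by (simp add: inner_prod_def)
    have "t\<^sup>2 * ((h, 0) \<bullet> H (h, 0)) + t\<^sup>2 * ((0, k) \<bullet> H (0, k)) \<le> t\<^sup>2 * ((h, k) \<bullet> H (h, k)) + 6 * (t\<^sup>2 * (e / 6))"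
      using exq[OF N3(1)] exq[OF N3(2)] exq[OF N3(3)] gsum unfolding isum abs_le_iff distrib_left by linarith
    then have "t\<^sup>2 * ((h, 0) \<bullet> H (h, 0) + (0, k) \<bullet> H (0, k)) \<le> t\<^sup>2 * ((h, k) \<bullet> H (h, k) + e)"
      by (simp add: algebra_simps)
    then show "(h, 0) \<bullet> H (h, 0) + (0, k) \<bullet> H (0, k) \<le> (h, k) \<bullet> H (h, k) + e" using t by simp
  qed
  have low: "- 3 * (h \<bullet> D h) \<le> h \<bullet> F1 h" "- 3 * (h \<bullet> D h) \<le> h \<bullet> F2 h" for h
    using Hb(1)[of "(h, 0)"] Hb(1)[of "(0, h)"] unfolding form1 form2 by simp_all
  have upp: "h \<bullet> F1 h + k \<bullet> F2 k \<le> 3 * ((h - k) \<bullet> D (h - k)) + \<rho> * ((norm h)\<^sup>2 + (norm k)\<^sup>2)" for h k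
  proof -
    have "\<rho>' * (norm (h, k))\<^sup>2 \<le> \<rho> * ((norm h)\<^sup>2 + (norm k)\<^sup>2)"
      using \<rho>'(2) by (simp add: norm_Pair mult_right_mono)
    then show ?thesis using mixed[of h k] Hb(2)[of "(h, k)"] unfolding form1 form2 formA by simp
  qed
  obtain H1 where H1: "linear H1" "\<And>v w. v \<bullet> H1 w = H1 v \<bullet> w" "\<And>h. h \<bullet> H1 h = h \<bullet> F1 h"
    using symmetrization[OF linF(1)] by blast
  obtain H2 where H2: "linear H2" "\<And>v w. v \<bullet> H2 w = H2 v \<bullet> w" "\<And>h. h \<bullet> H2 h = h \<bullet> F2 h"
    using symmetrization[OF linF(2)] by blast
  show ?thesis
    by (rule that[OF U.m(1)[of z] W.m(1)[of z'] close[OF n(1)] close[OF n(2)] P1 P2 H1(1,2) H2(1,2)])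
       (use exp1 exp2 low upp in \<open>simp_all add: H1(3) H2(3)\<close>)
qed

section \<open>Symmetric matrices and their quadratic forms\<close>

lemma sym_mats_iff: "A \<in> sym_mats \<longleftrightarrow> (\<forall>v w. v \<bullet> (A *v w) = (A *v v) \<bullet> w)"
proof -
  have "A \<in> sym_mats \<longleftrightarrow> (\<forall>v. v v* A = A *v v)"
    unfolding sym_mats_def mem_Collect_eq matrix_eq[of "transpose A" A] by simp
  also have "\<dots> \<longleftrightarrow> (\<forall>v w. v \<bullet> (A *v w) = (A *v v) \<bullet> w)"
    by (metis dot_lmul_matrix vector_eq_rdot)
  finally show ?thesis .
qed

lemma subspace_sym_mats: "subspace sym_mats"
  unfolding subspace_def
  by (auto simp: sym_mats_iff matrix_vector_mult_add_rdistrib scaleR_matrix_vector_assoc[symmetric] inner_add_left inner_add_right)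

lemma mat_1_sym: "mat 1 \<in> sym_mats"
  by (simp add: sym_mats_def transpose_mat)

lemmas sym_mats_add = subspace_add[OF subspace_sym_mats]
  and sym_mats_diff = subspace_diff[OF subspace_sym_mats]
  and sym_mats_minus = subspace_neg[OF subspace_sym_mats]
  and sym_mats_scaleR = subspace_scale[OF subspace_sym_mats]

lemma matrix_vector_mult_minus: "(- A) *v (v :: real ^ 'n) = - (A *v v)"
  using scaleR_matrix_vector_assoc[of "-1" A v] by simp

lemma form_diff: fixes v :: "real ^ 'n" shows "v \<bullet> ((A - B) *v v) = v \<bullet> (A *v v) - v \<bullet> (B *v v)"
  by (simp add: matrix_vector_mult_diff_rdistrib inner_diff_right)

lemma mat_le_iff: "A \<preceq> B \<longleftrightarrow> B - A \<in> sym_mats \<and> (\<forall>v. v \<bullet> (A *v v) \<le> v \<bullet> (B *v v))"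
  by (simp add: mat_le_def psd_def form_diff)

text \<open>
  Polarization bounds each entry by the quadratic form.
\<close>

lemma norm_sym_mat_le:
  fixes A :: "real ^ 'n ^ 'n"
  assumes "A \<in> sym_mats" "\<And>v. \<bar>v \<bullet> (A *v v)\<bar> \<le> b * (norm v)\<^sup>2"
  shows "norm A \<le> real CARD('n) * (real CARD('n) * (2 * b))"
proof -
  have entry: "\<bar>A $ i $ j\<bar> \<le> 2 * b" for i j
  proof -
    define e where "e = (axis i 1 :: real ^ 'n)"
    define f where "f = (axis j 1 :: real ^ 'n)"
    have n: "(norm (e + f))\<^sup>2 + (norm (e - f))\<^sup>2 = 4"
      unfolding power2_norm_eq_inner by (simp add: inner_add_left inner_add_right inner_diff_left inner_diff_right e_def f_def inner_axis_axis)
    have "A $ i $ j = e \<bullet> (A *v f)"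
      by (simp add: e_def f_def matrix_vector_mult_basis inner_axis' column_def)
    moreover have "4 * (e \<bullet> (A *v f)) = (e + f) \<bullet> (A *v (e + f)) - (e - f) \<bullet> (A *v (e - f))"
      using assms(1)[unfolded sym_mats_iff, rule_format, of f e]
      by (simp add: matrix_vector_right_distrib matrix_vector_mult_diff_distrib inner_add_left inner_add_right inner_diff_left inner_diff_right inner_commute)
    ultimately have "4 * \<bar>A $ i $ j\<bar> \<le> b * (norm (e + f))\<^sup>2 + b * (norm (e - f))\<^sup>2"
      using assms(2)[of "e + f"] assms(2)[of "e - f"] by linarith
    also have "\<dots> = 4 * b" using n by (simp add: distrib_left[symmetric])
    finally show ?thesis using assms(2)[of e] by (simp add: e_def)
  qed
  have "norm (A $ i) \<le> real CARD('n) * (2 * b)" for i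
    using norm_le_l1_cart[of "A $ i"] sum_bounded_above[of UNIV "\<lambda>j. \<bar>A $ i $ j\<bar>" "2 * b"] entry by simp
  then have "(\<Sum>i\<in>UNIV. norm (A $ i)) \<le> real CARD('n) * (real CARD('n) * (2 * b))"
    using sum_bounded_above[of UNIV "\<lambda>i. norm (A $ i)" "real CARD('n) * (2 * b)"] by simp
  moreover have "norm A \<le> (\<Sum>i\<in>UNIV. norm (A $ i))"
    unfolding norm_vec_def by (rule L2_set_le_sum) simp
  ultimately show ?thesis by simp
qed

lemma sum_UNIV_Plus:
  "(\<Sum>i\<in>UNIV. f (i :: 'n::finite + 'm::finite)) = (\<Sum>a\<in>UNIV. f (Inl a)) + (\<Sum>a\<in>UNIV. f (Inr a))"
  unfolding UNIV_Plus_UNIV[symmetric] by (subst sum.Plus) auto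

lemma block_mat_form:
  fixes V :: "real ^ ('n::finite + 'n)"
  defines "h \<equiv> \<chi> a. V $ Inl a" and "k \<equiv> \<chi> a. V $ Inr a"
  shows "V \<bullet> (block_mat A B C E *v V) = h \<bullet> (A *v h) + h \<bullet> (B *v k) + k \<bullet> (C *v h) + k \<bullet> (E *v k)"
  by (simp add: block_mat_def inner_vec_def matrix_vector_mult_def sum_UNIV_Plus h_def k_def
      distrib_left sum.distrib)

lemma block_mat_scaleR: "c *\<^sub>R block_mat A B C E = block_mat (c *\<^sub>R A) (c *\<^sub>R B) (c *\<^sub>R C) (c *\<^sub>R E)"
  by (auto simp: block_mat_def vec_eq_iff split: sum.split)

lemma block_mat_diff: "block_mat A B C E - block_mat A' B' C' E' = block_mat (A - A') (B - B') (C - C') (E - E')"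
  by (auto simp: block_mat_def vec_eq_iff split: sum.split)

lemma block_mat_sym:
  assumes "transpose A = A" "transpose B = C" "transpose E = E"
  shows "block_mat A B C E \<in> sym_mats"
proof -
  have "A $ i $ j = A $ j $ i" "B $ i $ j = C $ j $ i" "E $ i $ j = E $ j $ i" for i j
    using assms by (auto simp: vec_eq_iff transpose_def)
  then show ?thesis
    by (auto simp: sym_mats_def block_mat_def vec_eq_iff transpose_def split: sum.split)
qed

text \<open>
  The two block inequalities of the structure condition, read as inequalities between quadratic forms.
\<close>

lemma block_bounds_of_forms:
  fixes X Y :: "real ^ 'n ^ 'n"
  assumes X: "X \<in> sym_mats" and Y: "Y \<in> sym_mats"
    and lo: "\<And>h k. - 3 * \<alpha> * ((norm h)\<^sup>2 + (norm k)\<^sup>2) \<le> h \<bullet> (X *v h) - k \<bullet> (Y *v k)"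
    and up: "\<And>h k. h \<bullet> (X *v h) - k \<bullet> (Y *v k) \<le> 3 * \<alpha> * (norm (h - k))\<^sup>2"
  shows "(- 3 * \<alpha>) *\<^sub>R block_mat (mat 1) 0 0 (mat 1) \<preceq> block_mat X 0 0 (- Y)"
    "block_mat X 0 0 (- Y) \<preceq> (3 * \<alpha>) *\<^sub>R block_mat (mat 1) (- mat 1) (- mat 1) (mat 1)"
proof -
  have t: "transpose X = X" "transpose Y = Y" "transpose (mat 1 :: real ^ 'n ^ 'n) = mat 1"
    using X Y by (auto simp: sym_mats_def transpose_mat)
  have ts: "transpose (A - B) = transpose A - transpose B" "transpose (c *\<^sub>R A) = c *\<^sub>R transpose A" "transpose (- A) = - transpose A" "transpose (0::real ^ 'n ^ 'n) = 0"
    for A B :: "real ^ 'n ^ 'n" and c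
    by (auto simp: vec_eq_iff transpose_def)
  show "(- 3 * \<alpha>) *\<^sub>R block_mat (mat 1) 0 0 (mat 1) \<preceq> block_mat X 0 0 (- Y)"
    unfolding mat_le_iff
  proof (intro conjI allI)
    show "block_mat X 0 0 (- Y) - (- 3 * \<alpha>) *\<^sub>R block_mat (mat 1) 0 0 (mat 1) \<in> sym_mats"
      unfolding block_mat_scaleR block_mat_diff by (rule block_mat_sym) (simp_all only: ts t diff_0 diff_self scaleR_zero_right minus_zero)
    fix V :: "real ^ ('n + 'n)"
    show "V \<bullet> ((- 3 * \<alpha>) *\<^sub>R block_mat (mat 1) 0 0 (mat 1) *v V) \<le> V \<bullet> (block_mat X 0 0 (- Y) *v V)"
      using lo[of "\<chi> a. V $ Inl a" "\<chi> a. V $ Inr a"]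
      by (simp add: scaleR_matrix_vector_assoc[symmetric] block_mat_form matrix_vector_mult_minus power2_norm_eq_inner)
  qed
  show "block_mat X 0 0 (- Y) \<preceq> (3 * \<alpha>) *\<^sub>R block_mat (mat 1) (- mat 1) (- mat 1) (mat 1)"
    unfolding mat_le_iff
  proof (intro conjI allI)
    show "(3 * \<alpha>) *\<^sub>R block_mat (mat 1) (- mat 1) (- mat 1) (mat 1) - block_mat X 0 0 (- Y) \<in> sym_mats"
      unfolding block_mat_scaleR block_mat_diff by (rule block_mat_sym) (simp_all only: ts t diff_0_right)
    fix V :: "real ^ ('n + 'n)"
    show "V \<bullet> (block_mat X 0 0 (- Y) *v V) \<le> V \<bullet> ((3 * \<alpha>) *\<^sub>R block_mat (mat 1) (- mat 1) (- mat 1) (mat 1) *v V)"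
      using up[of "\<chi> a. V $ Inl a" "\<chi> a. V $ Inr a"]
      by (simp add: scaleR_matrix_vector_assoc[symmetric] block_mat_form matrix_vector_mult_minus power2_norm_eq_inner
         inner_diff_left inner_diff_right inner_commute algebra_simps)
  qed
qed

section \<open>Subsolutions tested by quadratic functions\<close>

text \<open>
  The spatial Hessian of \<open>z \<bullet> H z / 2\<close>.
\<close>

definition space_block :: "(real \<times> (real ^ 'n) \<Rightarrow> real \<times> (real ^ 'n)) \<Rightarrow> real ^ 'n ^ 'n"
  where "space_block H = matrix (\<lambda>v. snd (H (0, v)))"

lemma space_block_mult:
  assumes "linear H" shows "space_block H *v v = snd (H (0, v))"
proof -
  have "linear (\<lambda>v. H (0, v))" using linear_compose[of "\<lambda>v. (0, v)" H] assms by (simp add: comp_def linearI)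
  then have "linear (\<lambda>v. snd (H (0, v)))" using linear_compose[OF _ linear_snd] by (simp add: comp_def)
  from matrix_vector_mul(2)[OF this] show ?thesis unfolding space_block_def by metis
qed

lemma space_block_sym:
  assumes "linear H" "\<And>v w. v \<bullet> H w = H v \<bullet> w"
  shows "space_block H \<in> sym_mats"
  unfolding sym_mats_iff space_block_mult[OF assms(1)]
  using assms(2)[of "(0, v)" "(0, w)" for v w] by (simp add: inner_prod_def)

lemma space_block_form: "linear H \<Longrightarrow> v \<bullet> (space_block H *v v) = (0, v) \<bullet> H (0, v)"
  by (simp add: space_block_mult inner_prod_def)

text \<open>
  Only quadratic test functions in time and space are admitted. They are all that the comparison
  argument produces, and for them the passage from \<open>u\<close> to \<open>exp(-\<Lambda>t) u\<close> is explicit.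
\<close>

definition jet_subsolution ::
    "'n::finite nonlinearity \<Rightarrow> (real \<times> (real ^ 'n)) set \<Rightarrow> (real \<times> (real ^ 'n) \<Rightarrow> real) \<Rightarrow> bool"
  where "jet_subsolution F D w \<longleftrightarrow>
    (\<forall>z\<in>D. \<forall>P H. linear H \<longrightarrow> (\<forall>v w. v \<bullet> H w = H v \<bullet> w) \<longrightarrow>
      (\<exists>d>0. \<forall>h. norm h < d \<longrightarrow> z + h \<in> D \<longrightarrow> w (z + h) \<le> w z + P \<bullet> h + (h \<bullet> H h) / 2) \<longrightarrow>
      fst P \<le> F (fst z) (snd z) (w z) (snd P) (space_block H))"

text \<open>
  The nonlinearity of the equation solved by \<open>exp(-\<Lambda>t) u\<close>.
\<close>

definition damped :: "real \<Rightarrow> 'n::finite nonlinearity \<Rightarrow> 'n nonlinearity"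
  where "damped \<Lambda> F t x r p X =
    exp (- \<Lambda> * t) * F t x (exp (\<Lambda> * t) * r) (exp (\<Lambda> * t) *\<^sub>R p) (exp (\<Lambda> * t) *\<^sub>R X) - \<Lambda> * r"

text \<open>
  The nonlinearity of the equation solved by \<open>-u\<close>; it turns supersolutions into subsolutions.
\<close>

definition reflected :: "'n::finite nonlinearity \<Rightarrow> 'n nonlinearity"
  where "reflected F t x r p X = - F t x (- r) (- p) (- X)"

lemma reflected_damped: "reflected (damped \<Lambda> F) = damped \<Lambda> (reflected F)"
  by (intro ext) (simp add: reflected_def damped_def)

lemma viscosity_subsolution_reflected:
  assumes "viscosity_supersolution F D u"
  shows "viscosity_subsolution (reflected F) D (\<lambda>z. - u z)"
  unfolding viscosity_subsolution_def
proof (intro conjI allI impI)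
  have "lsc_on D u" using assms by (simp add: viscosity_supersolution_def)
  then show "usc_on D (\<lambda>z. - u z)"
    unfolding lsc_on_def usc_on_def
  proof (intro ballI allI impI)
    fix z c assume l: "\<forall>z\<in>D. \<forall>c<u z. \<forall>\<^sub>F w in at z within D. c < u w" and z: "z \<in> D" "- u z < c"
    have "- c < u z" using z(2) by linarith
    then have "\<forall>\<^sub>F w in at z within D. - c < u w" using l z(1) by blast
    then show "\<forall>\<^sub>F w in at z within D. - u w < c" by (rule eventually_mono) linarith
  qed
next
  fix t x \<phi> \<phi>t D\<phi> D2\<phi>
  assume a: "(t, x) \<in> D \<and> C12_near (t, x) \<phi> \<phi>t D\<phi> D2\<phi> \<and> local_max_rel D (\<lambda>z. - u z - \<phi> z) (t, x)"
  have "C12_near (t, x) (\<lambda>z. - \<phi> z) (\<lambda>z. - \<phi>t z) (\<lambda>z. - D\<phi> z) (\<lambda>z. - D2\<phi> z)"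
  proof -
    obtain U where U: "open U" "(t, x) \<in> U"
      "\<forall>(t, x)\<in>U. ((\<lambda>s. \<phi> (s, x)) has_real_derivative \<phi>t (t, x)) (at t) \<and>
        ((\<lambda>y. \<phi> (t, y)) has_derivative (\<lambda>h. D\<phi> (t, x) \<bullet> h)) (at x) \<and>
        ((\<lambda>y. D\<phi> (t, y)) has_derivative (\<lambda>h. D2\<phi> (t, x) *v h)) (at x)"
      "continuous_on U \<phi>t" "continuous_on U D\<phi>" "continuous_on U D2\<phi>"
      using a unfolding C12_near_def by blast
    have "\<forall>(s, y)\<in>U. ((\<lambda>s. - \<phi> (s, y)) has_real_derivative - \<phi>t (s, y)) (at s) \<and>
        ((\<lambda>y. - \<phi> (s, y)) has_derivative (\<lambda>h. (- D\<phi> (s, y)) \<bullet> h)) (at y) \<and>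
        ((\<lambda>y. - D\<phi> (s, y)) has_derivative (\<lambda>h. (- D2\<phi> (s, y)) *v h)) (at y)"
    proof (rule ballI)
      fix p assume "p \<in> U"
      obtain s y where p: "p = (s, y)" by (cases p)
      from U(3) \<open>p \<in> U\<close> have d: "((\<lambda>s. \<phi> (s, y)) has_real_derivative \<phi>t (s, y)) (at s)"
        "((\<lambda>y. \<phi> (s, y)) has_derivative (\<lambda>h. D\<phi> (s, y) \<bullet> h)) (at y)"
        "((\<lambda>y. D\<phi> (s, y)) has_derivative (\<lambda>h. D2\<phi> (s, y) *v h)) (at y)" unfolding p by auto
      show "case p of (s, y) \<Rightarrow> ((\<lambda>s. - \<phi> (s, y)) has_real_derivative - \<phi>t (s, y)) (at s) \<and>
        ((\<lambda>y. - \<phi> (s, y)) has_derivative (\<lambda>h. (- D\<phi> (s, y)) \<bullet> h)) (at y) \<and>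
        ((\<lambda>y. - D\<phi> (s, y)) has_derivative (\<lambda>h. (- D2\<phi> (s, y)) *v h)) (at y)"
        unfolding p prod.case inner_minus_left matrix_vector_mult_minus
        by (intro conjI DERIV_minus has_derivative_minus d)
    qed
    then show ?thesis
      unfolding C12_near_def using U(1,2,4-6) by (intro exI[of _ U] conjI continuous_on_minus)
  qed
  moreover have "local_min_rel D (\<lambda>z. u z - (- \<phi> z)) (t, x)"
    using a unfolding local_max_rel_def local_min_rel_def by (auto elim!: eventually_mono)
  ultimately have "- \<phi>t (t, x) - F t x (u (t, x)) (- D\<phi> (t, x)) (- D2\<phi> (t, x)) \<ge> 0"
    using assms a unfolding viscosity_supersolution_def by blast
  then show "\<phi>t (t, x) - reflected F t x (- u (t, x)) (D\<phi> (t, x)) (D2\<phi> (t, x)) \<le> 0"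
    by (simp add: reflected_def)
qed

lemma jet_subsolution_damped:
  fixes F :: "'n::finite nonlinearity"
  assumes sub: "viscosity_subsolution F D u"
  shows "jet_subsolution (damped \<Lambda> F) D (\<lambda>z. exp (- \<Lambda> * fst z) * u z)"
  unfolding jet_subsolution_def
proof (intro ballI allI impI)
  fix z P H
  assume z: "z \<in> D" and H: "linear H" "\<forall>v w. v \<bullet> H w = H v \<bullet> w"
    and "\<exists>d>0. \<forall>h. norm h < d \<longrightarrow> z + h \<in> D \<longrightarrow> exp (- \<Lambda> * fst (z + h)) * u (z + h) \<le> exp (- \<Lambda> * fst z) * u z + P \<bullet> h + (h \<bullet> H h) / 2"
  then obtain d where d: "d > 0" "\<And>h. norm h < d \<Longrightarrow> z + h \<in> D \<Longrightarrow>
      exp (- \<Lambda> * fst (z + h)) * u (z + h) \<le> exp (- \<Lambda> * fst z) * u z + P \<bullet> h + (h \<bullet> H h) / 2" by blast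
  define w0 where "w0 = exp (- \<Lambda> * fst z) * u z"
  define q where "q y = w0 + P \<bullet> (y - z) + ((y - z) \<bullet> H (y - z)) / 2" for y
  define g where "g y = P + H (y - z)" for y
  \<comment> \<open>the damping turns the quadratic test function for \<open>w\<close> into \<open>\<phi>\<close> for \<open>u\<close>\<close>
  define \<phi> where "\<phi> y = exp (\<Lambda> * fst y) * q y" for y
  have blH: "bounded_linear H" using H(1) by (simp add: linear_conv_bounded_linear)
  have dq: "(q has_derivative (\<lambda>h. g y \<bullet> h)) (at y)" for y
  proof -
    have dI: "((\<lambda>y. y - z) has_derivative (\<lambda>h. h)) (at y)" by (auto intro!: derivative_eq_intros)
    note dH = bounded_linear.has_derivative[OF blH dI]
    have q: "q = (\<lambda>y. w0 + P \<bullet> (y - z) + 1 / 2 * ((y - z) \<bullet> H (y - z)))" by (auto simp: q_def)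
    have sw: "(y - z) \<bullet> H h = h \<bullet> H (y - z)" for h using H(2) by (metis inner_commute)
    show ?thesis unfolding q
      by (rule has_derivative_eq_rhs[OF has_derivative_add[OF has_derivative_add[OF has_derivative_const
          has_derivative_inner_right[OF dI]] has_derivative_mult_right[OF has_derivative_inner[OF dI dH]]]])
        (auto simp: g_def inner_add_left sw inner_commute[of "H (y - z)"])
  qed
  have contq: "continuous_on UNIV q"
    using dq by (intro has_derivative_continuous_on) (auto intro: has_derivative_at_withinI)
  have contg: "continuous_on UNIV g"
    unfolding g_def by (intro continuous_intros bounded_linear.continuous_on[OF blH])
  have dt: "((\<lambda>s. q (s, x)) has_real_derivative fst (g (t, x))) (at t)" for t x
  proof -
    have "((\<lambda>s. q (s, x)) has_derivative (\<lambda>h. g (t, x) \<bullet> (h, 0))) (at t)"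
      by (rule has_derivative_compose[of "\<lambda>s. (s, x)" "\<lambda>h. (h, 0)", OF _ dq]) (auto intro!: derivative_eq_intros)
    then show ?thesis unfolding has_field_derivative_def
      by (rule has_derivative_eq_rhs) (auto simp: inner_prod_def)
  qed
  have dx: "((\<lambda>y. q (t, y)) has_derivative (\<lambda>h. snd (g (t, x)) \<bullet> h)) (at x)" for t x
  proof -
    have "((\<lambda>y. q (t, y)) has_derivative (\<lambda>h. g (t, x) \<bullet> (0, h))) (at x)"
      by (rule has_derivative_compose[of "\<lambda>y. (t, y)" "\<lambda>h. (0, h)", OF _ dq]) (auto intro!: derivative_eq_intros)
    then show ?thesis by (rule has_derivative_eq_rhs) (auto simp: inner_prod_def)
  qed
  have dxx: "((\<lambda>y. snd (g (t, y))) has_derivative (\<lambda>h. space_block H *v h)) (at x)" for t x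
  proof -
    have "((\<lambda>y. H ((t, y) - z)) has_derivative (\<lambda>h. H (0, h))) (at x)"
      by (rule bounded_linear.has_derivative[OF blH]) (auto intro!: derivative_eq_intros)
    then have "((\<lambda>y. snd (g (t, y))) has_derivative (\<lambda>h. 0 + snd (H (0, h)))) (at x)"
      unfolding g_def snd_add by (intro has_derivative_add has_derivative_const has_derivative_snd)
    then show ?thesis by (simp add: space_block_mult[OF H(1)])
  qed
  let ?\<phi>t = "\<lambda>y. \<Lambda> * exp (\<Lambda> * fst y) * q y + exp (\<Lambda> * fst y) * fst (g y)"
  let ?D\<phi> = "\<lambda>y. exp (\<Lambda> * fst y) *\<^sub>R snd (g y)"
  let ?D2\<phi> = "\<lambda>y. exp (\<Lambda> * fst y) *\<^sub>R space_block H"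
  have C12: "C12_near z \<phi> ?\<phi>t ?D\<phi> ?D2\<phi>"
    unfolding C12_near_def
  proof (intro exI[of _ UNIV] conjI ballI)
    fix y :: "real \<times> (real ^ 'n)" assume "y \<in> UNIV"
    obtain t x where y: "y = (t, x)" by (cases y)
    have 1: "((\<lambda>s. \<phi> (s, x)) has_real_derivative ?\<phi>t (t, x)) (at t)"
      unfolding \<phi>_def fst_conv by (rule derivative_eq_intros dt refl | simp)+
    have 2: "((\<lambda>y. \<phi> (t, y)) has_derivative (\<lambda>h. ?D\<phi> (t, x) \<bullet> h)) (at x)"
      unfolding \<phi>_def fst_conv using has_derivative_mult_right[OF dx[of t x], of "exp (\<Lambda> * t)"] by simp
    have 3: "((\<lambda>y. ?D\<phi> (t, y)) has_derivative (\<lambda>h. ?D2\<phi> (t, x) *v h)) (at x)"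
      unfolding fst_conv using has_derivative_scaleR_right[OF dxx[of t x], of "exp (\<Lambda> * t)"]
      by (simp add: scaleR_matrix_vector_assoc)
    show "case y of (t, x) \<Rightarrow> ((\<lambda>s. \<phi> (s, x)) has_real_derivative ?\<phi>t (t, x)) (at t) \<and>
        ((\<lambda>y. \<phi> (t, y)) has_derivative (\<lambda>h. ?D\<phi> (t, x) \<bullet> h)) (at x) \<and>
        ((\<lambda>y. ?D\<phi> (t, y)) has_derivative (\<lambda>h. ?D2\<phi> (t, x) *v h)) (at x)"
      unfolding y prod.case using 1 2 3 by blast
  qed (auto intro!: continuous_intros contq contg)
  have e1: "exp (\<Lambda> * s) * exp (- \<Lambda> * s) = 1" for s by (simp add: exp_add[symmetric])
  have \<phi>z: "\<phi> z = u z" using e1[of "fst z"] by (simp add: \<phi>_def q_def w0_def linear_0[OF H(1)] mult.assoc[symmetric])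
  have lm: "local_max_rel D (\<lambda>z. u z - \<phi> z) z"
    unfolding local_max_rel_def eventually_at
  proof (intro exI[of _ d] conjI ballI impI)
    fix y assume y: "y \<in> D" "y \<noteq> z \<and> dist y z < d"
    have "exp (- \<Lambda> * fst y) * u y \<le> q y" using d(2)[of "y - z"] y by (simp add: q_def w0_def dist_norm)
    then have "exp (\<Lambda> * fst y) * (exp (- \<Lambda> * fst y) * u y) \<le> \<phi> y" unfolding \<phi>_def by simp
    then show "u y - \<phi> y \<le> u z - \<phi> z" using e1[of "fst y"] \<phi>z by (simp add: mult.assoc[symmetric])
  qed (rule d(1))
  obtain t x where zt: "z = (t, x)" by (cases z)
  have gz: "g z = P" and qz: "q z = w0" by (simp_all add: g_def q_def linear_0[OF H(1)])
  have "?\<phi>t (t, x) - F t x (u (t, x)) (?D\<phi> (t, x)) (?D2\<phi> (t, x)) \<le> 0"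
    using sub z C12 lm unfolding viscosity_subsolution_def zt by blast
  then have *: "exp (\<Lambda> * t) * (\<Lambda> * w0 + fst P) \<le> F t x (u z) (exp (\<Lambda> * t) *\<^sub>R snd P) (exp (\<Lambda> * t) *\<^sub>R space_block H)"
    using gz qz by (simp add: zt algebra_simps)
  have uz: "exp (\<Lambda> * t) * w0 = u z" using e1[of t] by (simp add: w0_def zt mult.assoc[symmetric])
  have "\<Lambda> * w0 + fst P = exp (- \<Lambda> * t) * (exp (\<Lambda> * t) * (\<Lambda> * w0 + fst P))"
    using e1[of t] by (simp add: mult.assoc[symmetric] mult.commute)
  also have "\<dots> \<le> exp (- \<Lambda> * t) * F t x (exp (\<Lambda> * t) * w0) (exp (\<Lambda> * t) *\<^sub>R snd P) (exp (\<Lambda> * t) *\<^sub>R space_block H)"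
    unfolding uz by (intro mult_left_mono *) simp
  finally have "fst P \<le> damped \<Lambda> F t x w0 (snd P) (space_block H)"
    unfolding damped_def by linarith
  then show "fst P \<le> damped \<Lambda> F (fst z) (snd z) (exp (- \<Lambda> * fst z) * u z) (snd P) (space_block H)"
    unfolding w0_def zt by simp
qed

section \<open>Maxima of doubled functions\<close>

text \<open>
  The matrix hypothesis of the structure condition in terms of quadratic forms.
\<close>

definition form_bounds :: "real \<Rightarrow> real ^ 'n ^ 'n \<Rightarrow> real ^ 'n ^ 'n \<Rightarrow> bool"
  where "form_bounds \<alpha> X Y \<longleftrightarrow> X \<in> sym_mats \<and> Y \<in> sym_mats \<and>
    (\<forall>h k. - 3 * \<alpha> * ((norm h)\<^sup>2 + (norm k)\<^sup>2) \<le> h \<bullet> (X *v h) - k \<bullet> (Y *v k) \<and>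
      h \<bullet> (X *v h) - k \<bullet> (Y *v k) \<le> 3 * \<alpha> * (norm (h - k))\<^sup>2)"

lemma norm_le_of_form_bounds:
  fixes X Y :: "real ^ 'n ^ 'n"
  assumes "form_bounds \<alpha> X Y"
  shows "norm X \<le> 6 * (real CARD('n))\<^sup>2 * \<alpha>" "norm Y \<le> 6 * (real CARD('n))\<^sup>2 * \<alpha>"
proof -
  have b: "- 3 * \<alpha> * ((norm h)\<^sup>2 + (norm k)\<^sup>2) \<le> h \<bullet> (X *v h) - k \<bullet> (Y *v k)"
      "h \<bullet> (X *v h) - k \<bullet> (Y *v k) \<le> 3 * \<alpha> * (norm (h - k))\<^sup>2" for h k
    using assms unfolding form_bounds_def by blast+
  have "norm X \<le> real CARD('n) * (real CARD('n) * (2 * (3 * \<alpha>)))"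
  proof (rule norm_sym_mat_le)
    show "X \<in> sym_mats" using assms by (simp add: form_bounds_def)
    fix v show "\<bar>v \<bullet> (X *v v)\<bar> \<le> 3 * \<alpha> * (norm v)\<^sup>2" using b[of v 0] by (auto simp: abs_le_iff)
  qed
  then show "norm X \<le> 6 * (real CARD('n))\<^sup>2 * \<alpha>" by (simp add: power2_eq_square mult_ac)
  have "norm Y \<le> real CARD('n) * (real CARD('n) * (2 * (3 * \<alpha>)))"
  proof (rule norm_sym_mat_le)
    show "Y \<in> sym_mats" using assms by (simp add: form_bounds_def)
    fix v show "\<bar>v \<bullet> (Y *v v)\<bar> \<le> 3 * \<alpha> * (norm v)\<^sup>2" using b[of 0 v] by (auto simp: abs_le_iff)
  qed
  then show "norm Y \<le> 6 * (real CARD('n))\<^sup>2 * \<alpha>" by (simp add: power2_eq_square mult_ac)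
qed

text \<open>
  What the comparison argument uses of the damped nonlinearity: strict monotonicity in the value of the
  solution, the structure condition with an \<open>\<epsilon>\<close>-\<open>\<delta>\<close> modulus, and uniform continuity and boundedness on
  bounded sets of values, gradients and Hessians.
\<close>

locale proper_equation =
  fixes T :: real and G :: "'n::finite nonlinearity"
  assumes T_pos: "0 < T"
    and decreasing: "\<And>t x p X u v. t \<in> {0..T} \<Longrightarrow> X \<in> sym_mats \<Longrightarrow> v \<le> u \<Longrightarrow> u - v \<le> G t x v p X - G t x u p X"
    and shift: "\<And>R e. 0 < R \<Longrightarrow> 0 < e \<Longrightarrow> \<exists>\<delta>>0. \<forall>t\<in>{0..T}. \<forall>x y. \<forall>r\<in>{-R..R}. \<forall>\<alpha>>0. \<forall>X Y. form_bounds \<alpha> X Y \<longrightarrow>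
        \<alpha> * (norm (x - y))\<^sup>2 + norm (x - y) < \<delta> \<longrightarrow> G t x r (\<alpha> *\<^sub>R (x - y)) X - G t y r (\<alpha> *\<^sub>R (x - y)) Y \<le> e"
    and uniform: "\<And>R e. 0 < R \<Longrightarrow> 0 < e \<Longrightarrow> \<exists>\<delta>>0. \<forall>t\<in>{0..T}. \<forall>t'\<in>{0..T}. \<forall>x x'. \<forall>r\<in>{-R..R}. \<forall>r'\<in>{-R..R}.
        \<forall>p\<in>ball 0 R. \<forall>p'\<in>ball 0 R. \<forall>X\<in>sym_mats \<inter> ball 0 R. \<forall>X'\<in>sym_mats \<inter> ball 0 R.
        \<bar>t - t'\<bar> < \<delta> \<longrightarrow> norm (x - x') < \<delta> \<longrightarrow> \<bar>r - r'\<bar> < \<delta> \<longrightarrow> norm (p - p') < \<delta> \<longrightarrow> norm (X - X') < \<delta> \<longrightarrow>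
        \<bar>G t x r p X - G t' x' r' p' X'\<bar> \<le> e"
    and locally_bounded: "\<And>R. 0 < R \<Longrightarrow> \<exists>K. \<forall>t\<in>{0..T}. \<forall>x. \<forall>r\<in>{-R..R}. \<forall>p\<in>ball 0 R. \<forall>X\<in>sym_mats \<inter> ball 0 R. \<bar>G t x r p X\<bar> \<le> K"

lemma inverse_Taylor_upper_bound:
  fixes a k :: real
  assumes "0 < a" "\<bar>k\<bar> \<le> a / 2"
  shows "1 / (a - k) \<le> 1 / a + k / a\<^sup>2 + 2 * k\<^sup>2 / a ^ 3"
proof -
  have ak: "a / 2 \<le> a - k" "0 < a - k" using assms by (auto simp: abs_le_iff)
  have "1 / (a - k) - 1 / a - k / a\<^sup>2 = (k\<^sup>2 / a\<^sup>2) * (1 / (a - k))"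
    using assms(1) ak by (simp add: divide_simps) (simp add: algebra_simps power2_eq_square)
  also have "\<dots> \<le> (k\<^sup>2 / a\<^sup>2) * (2 / a)"
    using ak assms(1) by (intro mult_left_mono) (auto simp: field_simps)
  also have "\<dots> = 2 * k\<^sup>2 / a ^ 3" using assms(1) by (simp add: power2_eq_square power3_eq_cube)
  finally show ?thesis by simp
qed

lemma eventually_mult_less:
  assumes "0 < (d::real)" shows "\<forall>\<^sub>F \<rho> in at_right 0. c * \<rho> < d"
proof -
  have "((\<lambda>\<rho>. c * \<rho>) \<longlongrightarrow> c * 0) (at_right 0)" by (intro tendsto_intros)
  then show ?thesis using assms by (intro order_tendstoD(2)) auto
qed

text \<open>
  Adding \<open>\<beta>/2 |x|\<^sup>2 + \<eta>/(T - t)\<close> back to \<open>U\<close> shifts the expansion by the derivatives of these terms. The time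
  derivative of the barrier at \<open>T\<close> has the favourable sign and is dropped; its second-order part lies in
  the time direction, which the equation does not see.
\<close>

lemma jet_inequality_with_penalty:
  fixes w U :: "real \<times> (real ^ 'n::finite) \<Rightarrow> real"
  assumes jets: "jet_subsolution G ({0<..<T} \<times> UNIV) w"
    and U: "\<And>z. U z = w z - \<beta> / 2 * (norm (snd z))\<^sup>2 - \<eta> / (T - fst z)" and \<eta>: "0 \<le> \<eta>"
    and Q: "ball \<xi> r \<subseteq> Q" "0 < r" and \<xi>: "fst \<xi> \<in> {0<..<T}"
    and H: "linear H" "\<And>v w. v \<bullet> H w = H v \<bullet> w" and \<rho>: "0 < \<rho>"
    and ex: "\<exists>d>0. \<forall>h. norm h < d \<longrightarrow> \<xi> + h \<in> Q \<longrightarrow> U (\<xi> + h) \<le> U \<xi> + P \<bullet> h + (h \<bullet> H h) / 2 + \<rho> * (norm h)\<^sup>2"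
  shows "fst P \<le> G (fst \<xi>) (snd \<xi>) (w \<xi>) (snd P + \<beta> *\<^sub>R snd \<xi>) (space_block H + (2 * \<rho> + \<beta>) *\<^sub>R mat 1)"
proof -
  define a where "a = T - fst \<xi>"
  have a: "0 < a" using \<xi> by (simp add: a_def)
  define P' where "P' = P + (\<eta> / a\<^sup>2, \<beta> *\<^sub>R snd \<xi>)"
  define H' where "H' h = H h + (2 * \<rho>) *\<^sub>R h + (4 * \<eta> / a ^ 3 * fst h, \<beta> *\<^sub>R snd h)" for h
  have lin: "linear H'"
    by (rule linearI) (simp_all add: H'_def linear_add[OF H(1)] linear_scale[OF H(1)] algebra_simps add_divide_distrib)
  have sym: "v \<bullet> H' w = H' v \<bullet> w" for v w
    using H(2)[of v w] by (simp add: H'_def inner_add_left inner_add_right inner_prod_def algebra_simps)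
  have sb: "space_block H' = space_block H + (2 * \<rho> + \<beta>) *\<^sub>R mat 1"
    unfolding matrix_eq
    by (simp add: space_block_mult[OF lin] space_block_mult[OF H(1)] matrix_vector_mult_add_rdistrib
        scaleR_matrix_vector_assoc[symmetric] H'_def algebra_simps)
  obtain d where d: "d > 0" "\<And>h. norm h < d \<Longrightarrow> \<xi> + h \<in> Q \<Longrightarrow> U (\<xi> + h) \<le> U \<xi> + P \<bullet> h + (h \<bullet> H h) / 2 + \<rho> * (norm h)\<^sup>2"
    using ex by blast
  have "w (\<xi> + h) \<le> w \<xi> + P' \<bullet> h + (h \<bullet> H' h) / 2" if h: "norm h < min d (min r (a / 2))" for h
  proof -
    have "\<xi> + h \<in> ball \<xi> r" using h by (simp add: dist_norm)
    then have "\<xi> + h \<in> Q" using Q(1) by blast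
    then have 1: "U (\<xi> + h) \<le> U \<xi> + P \<bullet> h + (h \<bullet> H h) / 2 + \<rho> * (norm h)\<^sup>2" using d(2) h by simp
    have "\<bar>fst h\<bar> \<le> a / 2" using h norm_fst_le[of "fst h" "snd h"] by simp
    from inverse_Taylor_upper_bound[OF a this]
    have "\<eta> * (1 / (a - fst h)) \<le> \<eta> * (1 / a + fst h / a\<^sup>2 + 2 * (fst h)\<^sup>2 / a ^ 3)" using \<eta> by (rule mult_left_mono)
    then have 2: "\<eta> / (T - fst (\<xi> + h)) \<le> \<eta> / (T - fst \<xi>) + \<eta> / a\<^sup>2 * fst h + 2 * \<eta> / a ^ 3 * (fst h)\<^sup>2"
      by (simp add: a_def algebra_simps)
    have 3: "(norm (snd (\<xi> + h)))\<^sup>2 = (norm (snd \<xi>))\<^sup>2 + 2 * (snd \<xi> \<bullet> snd h) + (norm (snd h))\<^sup>2"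
      unfolding power2_norm_eq_inner by (simp add: inner_add_left inner_add_right inner_commute)
    have "w (\<xi> + h) = U (\<xi> + h) + \<beta> / 2 * (norm (snd (\<xi> + h)))\<^sup>2 + \<eta> / (T - fst (\<xi> + h))"
      "w \<xi> = U \<xi> + \<beta> / 2 * (norm (snd \<xi>))\<^sup>2 + \<eta> / (T - fst \<xi>)" by (simp_all add: U)
    moreover have "P' \<bullet> h = P \<bullet> h + \<eta> / a\<^sup>2 * fst h + \<beta> * (snd \<xi> \<bullet> snd h)"
      by (simp add: P'_def inner_add_left inner_prod_def distrib_right)
    moreover have "(h \<bullet> H' h) / 2 = (h \<bullet> H h) / 2 + \<rho> * (norm h)\<^sup>2 + 2 * \<eta> / a ^ 3 * (fst h)\<^sup>2 + \<beta> / 2 * (norm (snd h))\<^sup>2"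
    proof -
      have "h \<bullet> H' h = h \<bullet> H h + 2 * \<rho> * (h \<bullet> h) + (4 * \<eta> / a ^ 3 * (fst h * fst h) + \<beta> * (snd h \<bullet> snd h))"
        by (simp add: H'_def inner_add_right inner_prod_def[of h "(_, _)"] algebra_simps)
      then show ?thesis by (simp add: dot_square_norm power2_eq_square add_divide_distrib)
    qed
    moreover have "\<beta> / 2 * ((norm (snd \<xi>))\<^sup>2 + 2 * (snd \<xi> \<bullet> snd h) + (norm (snd h))\<^sup>2)
        = \<beta> / 2 * (norm (snd \<xi>))\<^sup>2 + \<beta> * (snd \<xi> \<bullet> snd h) + \<beta> / 2 * (norm (snd h))\<^sup>2"
      by (simp add: algebra_simps)
    ultimately show ?thesis using 1 2 unfolding 3 by linarith
  qed
  then have ex': "\<exists>d>0. \<forall>h. norm h < d \<longrightarrow> \<xi> + h \<in> {0<..<T} \<times> UNIV \<longrightarrow> w (\<xi> + h) \<le> w \<xi> + P' \<bullet> h + (h \<bullet> H' h) / 2"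
    using d(1) Q(2) a by (intro exI[of _ "min d (min r (a / 2))"]) simp
  have "fst P' \<le> G (fst \<xi>) (snd \<xi>) (w \<xi>) (snd P') (space_block H')"
    by (rule jets[unfolded jet_subsolution_def, rule_format, OF _ lin sym ex']) (use \<xi> in \<open>simp add: mem_Times_iff\<close>)
  moreover have "fst P \<le> fst P'" using \<eta> by (simp add: P'_def)
  ultimately show ?thesis by (simp add: P'_def sb)
qed

text \<open>
  The theorem on sums gives the upper bound only up to \<open>\<rho>\<close>. Subtracting \<open>\<rho>\<close> times the identity repairs it but
  worsens the lower bound to \<open>-(3\<alpha> + \<rho>)\<close>, which scaling by \<open>3\<alpha>/(3\<alpha> + \<rho>)\<close> repairs in turn. The matrices move
  by \<open>O(\<rho>)\<close>, as is needed when \<open>\<rho>\<close> tends to zero.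
\<close>

lemma form_bounds_exact:
  fixes M1 M2 :: "real ^ 'n ^ 'n"
  assumes \<alpha>: "0 < \<alpha>" and \<rho>: "0 < \<rho>" and s: "M1 \<in> sym_mats" "M2 \<in> sym_mats"
    and lo: "\<And>h. - 3 * \<alpha> * (norm h)\<^sup>2 \<le> h \<bullet> (M1 *v h)" "\<And>h. - 3 * \<alpha> * (norm h)\<^sup>2 \<le> h \<bullet> (M2 *v h)"
    and up: "\<And>h k. h \<bullet> (M1 *v h) + k \<bullet> (M2 *v k) \<le> 3 * \<alpha> * (norm (h - k))\<^sup>2 + \<rho> * ((norm h)\<^sup>2 + (norm k)\<^sup>2)"
  defines "c \<equiv> 3 * \<alpha> / (3 * \<alpha> + \<rho>)"
  defines "X \<equiv> c *\<^sub>R (M1 - \<rho> *\<^sub>R mat 1)" and "Y \<equiv> - (c *\<^sub>R (M2 - \<rho> *\<^sub>R mat 1))"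
  shows "form_bounds \<alpha> X Y"
    "norm (M1 - X) \<le> \<rho> * (2 * (real CARD('n))\<^sup>2 * (3 * \<alpha> + \<rho>) / (3 * \<alpha>) + norm (mat 1 :: real ^ 'n ^ 'n))"
    "norm (M2 + Y) \<le> \<rho> * (2 * (real CARD('n))\<^sup>2 * (3 * \<alpha> + \<rho>) / (3 * \<alpha>) + norm (mat 1 :: real ^ 'n ^ 'n))"
proof -
  have c: "0 < c" "c \<le> 1" "1 - c \<le> \<rho> / (3 * \<alpha>)" "c * (3 * \<alpha> + \<rho>) = 3 * \<alpha>"
  proof -
    show "0 < c" "c \<le> 1" "c * (3 * \<alpha> + \<rho>) = 3 * \<alpha>" using \<alpha> \<rho> by (auto simp: c_def)
    have "1 - c = \<rho> / (3 * \<alpha> + \<rho>)" using \<alpha> \<rho> by (simp add: c_def field_simps)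
    also have "\<dots> \<le> \<rho> / (3 * \<alpha>)" using \<alpha> \<rho> by (intro divide_left_mono) auto
    finally show "1 - c \<le> \<rho> / (3 * \<alpha>)" .
  qed
  have fX: "h \<bullet> (X *v h) = c * (h \<bullet> (M1 *v h) - \<rho> * (norm h)\<^sup>2)" for h
    by (simp add: X_def scaleR_matrix_vector_assoc[symmetric] form_diff power2_norm_eq_inner)
  have fY: "h \<bullet> (Y *v h) = - (c * (h \<bullet> (M2 *v h) - \<rho> * (norm h)\<^sup>2))" for h
    by (simp add: Y_def matrix_vector_mult_minus scaleR_matrix_vector_assoc[symmetric] form_diff power2_norm_eq_inner)
  show "form_bounds \<alpha> X Y"
    unfolding form_bounds_def
  proof (intro conjI allI)
    show "X \<in> sym_mats" "Y \<in> sym_mats" unfolding X_def Y_def using s mat_1_sym by (auto intro!: sym_mats_diff sym_mats_minus sym_mats_scaleR)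
    fix h k :: "real ^ 'n"
    have e: "h \<bullet> (X *v h) - k \<bullet> (Y *v k) = c * (h \<bullet> (M1 *v h) + k \<bullet> (M2 *v k) - \<rho> * ((norm h)\<^sup>2 + (norm k)\<^sup>2))"
      unfolding fX fY by (simp add: algebra_simps)
    have "c * (h \<bullet> (M1 *v h) + k \<bullet> (M2 *v k) - \<rho> * ((norm h)\<^sup>2 + (norm k)\<^sup>2)) \<le> c * (3 * \<alpha> * (norm (h - k))\<^sup>2)"
      using up[of h k] c(1) by (intro mult_left_mono) auto
    also have "\<dots> \<le> 3 * \<alpha> * (norm (h - k))\<^sup>2" using c \<alpha> by (intro mult_left_le_one_le) auto
    finally show "h \<bullet> (X *v h) - k \<bullet> (Y *v k) \<le> 3 * \<alpha> * (norm (h - k))\<^sup>2" unfolding e .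
    have "c * (- (3 * \<alpha> + \<rho>) * ((norm h)\<^sup>2 + (norm k)\<^sup>2)) \<le> c * (h \<bullet> (M1 *v h) + k \<bullet> (M2 *v k) - \<rho> * ((norm h)\<^sup>2 + (norm k)\<^sup>2))"
      using lo(1)[of h] lo(2)[of k] c(1) by (intro mult_left_mono) (auto simp: algebra_simps)
    moreover have "c * (- (3 * \<alpha> + \<rho>) * ((norm h)\<^sup>2 + (norm k)\<^sup>2)) = - (c * (3 * \<alpha> + \<rho>)) * ((norm h)\<^sup>2 + (norm k)\<^sup>2)"
      by (simp only: mult_minus_left mult_minus_right mult.assoc)
    ultimately show "- 3 * \<alpha> * ((norm h)\<^sup>2 + (norm k)\<^sup>2) \<le> h \<bullet> (X *v h) - k \<bullet> (Y *v k)"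
      unfolding e c(4) by simp
  qed
  have dist: "norm (M - c *\<^sub>R (M - \<rho> *\<^sub>R mat 1)) \<le> \<rho> * (2 * (real CARD('n))\<^sup>2 * (3 * \<alpha> + \<rho>) / (3 * \<alpha>) + norm (mat 1 :: real ^ 'n ^ 'n))"
    if M: "M \<in> sym_mats" "\<And>h. - 3 * \<alpha> * (norm h)\<^sup>2 \<le> h \<bullet> (M *v h)" "\<And>h. h \<bullet> (M *v h) \<le> (3 * \<alpha> + \<rho>) * (norm h)\<^sup>2" for M :: "real ^ 'n ^ 'n"
  proof -
    have "norm M \<le> real CARD('n) * (real CARD('n) * (2 * (3 * \<alpha> + \<rho>)))"
    proof (rule norm_sym_mat_le[OF M(1)])
      fix v :: "real ^ 'n"
      have "0 \<le> \<rho> * (norm v)\<^sup>2" using \<rho> by simp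
      then show "\<bar>v \<bullet> (M *v v)\<bar> \<le> (3 * \<alpha> + \<rho>) * (norm v)\<^sup>2"
        using M(2)[of v] M(3)[of v] by (auto simp: abs_le_iff distrib_right)
    qed
    then have nM: "norm M \<le> 2 * (real CARD('n))\<^sup>2 * (3 * \<alpha> + \<rho>)" by (simp add: power2_eq_square mult_ac)
    have "M - c *\<^sub>R (M - \<rho> *\<^sub>R mat 1) = (1 - c) *\<^sub>R M + (c * \<rho>) *\<^sub>R mat 1" by (simp add: algebra_simps)
    also have "norm \<dots> \<le> (1 - c) * norm M + (c * \<rho>) * norm (mat 1 :: real ^ 'n ^ 'n)"
      using norm_triangle_ineq[of "(1 - c) *\<^sub>R M" "(c * \<rho>) *\<^sub>R mat 1"] c \<rho> by simp
    also have "\<dots> \<le> \<rho> / (3 * \<alpha>) * (2 * (real CARD('n))\<^sup>2 * (3 * \<alpha> + \<rho>)) + \<rho> * norm (mat 1 :: real ^ 'n ^ 'n)"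
      using c \<rho> \<alpha> nM by (intro add_mono mult_mono mult_right_mono) (auto intro!: mult_left_le_one_le)
    also have "\<dots> = \<rho> * (2 * (real CARD('n))\<^sup>2 * (3 * \<alpha> + \<rho>) / (3 * \<alpha>) + norm (mat 1 :: real ^ 'n ^ 'n))"
      using \<alpha> by (simp add: field_simps)
    finally show ?thesis .
  qed
  show "norm (M1 - X) \<le> \<rho> * (2 * (real CARD('n))\<^sup>2 * (3 * \<alpha> + \<rho>) / (3 * \<alpha>) + norm (mat 1 :: real ^ 'n ^ 'n))"
    unfolding X_def using up[of _ 0] by (intro dist s lo) (simp add: distrib_right)
  have "M2 + Y = M2 - c *\<^sub>R (M2 - \<rho> *\<^sub>R mat 1)" by (simp add: Y_def)
  moreover have "h \<bullet> (M2 *v h) \<le> (3 * \<alpha> + \<rho>) * (norm h)\<^sup>2" for h using up[of 0 h] by (simp add: distrib_right)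
  ultimately show "norm (M2 + Y) \<le> \<rho> * (2 * (real CARD('n))\<^sup>2 * (3 * \<alpha> + \<rho>) / (3 * \<alpha>) + norm (mat 1 :: real ^ 'n ^ 'n))"
    using dist[OF s(2) lo(2)] by simp
qed

context proper_equation
begin

text \<open>
  The theorem on sums for the quadratic form \<open>(t-s)\<^sup>2/\<tau> + \<alpha> |x-y|\<^sup>2\<close> gives test functions for \<open>w\<close> and \<open>-w\<close> at
  points within \<open>\<rho>\<close> of the maximum. Their time derivatives cancel up to \<open>2\<rho>\<close>, so adding the two viscosity
  inequalities leaves a difference of values of \<open>G\<close>; by uniform continuity these values may be taken at
  the maximum itself, at the price of \<open>e\<close>.
\<close>

lemma interior_maximum:
  fixes w :: "real \<times> (real ^ 'n) \<Rightarrow> real"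
  assumes cont: "continuous_on ({0..T} \<times> UNIV) w"
    and sub: "jet_subsolution G ({0<..<T} \<times> UNIV) w"
    and super: "jet_subsolution (reflected G) ({0<..<T} \<times> UNIV) (\<lambda>z. - w z)"
    and pos: "0 < \<alpha>" "0 < \<tau>" "0 \<le> \<beta>" "0 \<le> \<eta>"
    and Q1: "compact Q1" "Q1 \<subseteq> {0..<T} \<times> UNIV" "z0 \<in> interior Q1" "0 < fst z0"
    and Q2: "compact Q2" "Q2 \<subseteq> {0..<T} \<times> UNIV" "y0 \<in> interior Q2" "0 < fst y0"
    and max: "\<And>z y. z \<in> Q1 \<Longrightarrow> y \<in> Q2 \<Longrightarrow>
      w z - w y - \<alpha> / 2 * (norm (snd z - snd y))\<^sup>2 - (fst z - fst y)\<^sup>2 / (2 * \<tau>)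
          - \<beta> / 2 * (norm (snd z))\<^sup>2 - \<eta> / (T - fst z) - \<eta> / (T - fst y)
      \<le> w z0 - w y0 - \<alpha> / 2 * (norm (snd z0 - snd y0))\<^sup>2 - (fst z0 - fst y0)\<^sup>2 / (2 * \<tau>)
          - \<beta> / 2 * (norm (snd z0))\<^sup>2 - \<eta> / (T - fst z0) - \<eta> / (T - fst y0)"
    and e: "0 < e"
  obtains X Y where "form_bounds \<alpha> X Y"
    "- e \<le> G (fst z0) (snd z0) (w z0) (\<alpha> *\<^sub>R (snd z0 - snd y0) + \<beta> *\<^sub>R snd z0) (X + \<beta> *\<^sub>R mat 1)
          - G (fst y0) (snd y0) (w y0) (\<alpha> *\<^sub>R (snd z0 - snd y0)) Y"
proof -
  define D where "D z = (fst z / \<tau>, \<alpha> *\<^sub>R snd z)" for z :: "real \<times> (real ^ 'n)"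
  define U where "U z = w z - \<beta> / 2 * (norm (snd z))\<^sup>2 - \<eta> / (T - fst z)" for z
  define W where "W z = - w z - \<eta> / (T - fst z)" for z
  have W_eq: "W z = - w z - 0 / 2 * (norm (snd z))\<^sup>2 - \<eta> / (T - fst z)" for z by (simp add: W_def)
  define p where "p = \<alpha> *\<^sub>R (snd z0 - snd y0)"
  define I where "I = (mat 1 :: real ^ 'n ^ 'n)"
  define B where "B = 2 * (real CARD('n))\<^sup>2 * (3 * \<alpha> + 1) / (3 * \<alpha>) + norm I"
  have B0: "0 \<le> B" using pos by (simp add: B_def)
  have linD: "linear D" by (rule linearI) (simp_all add: D_def add_divide_distrib algebra_simps)
  have symD: "v \<bullet> D w = D v \<bullet> w" for v w by (simp add: D_def inner_prod_def)
  have formD: "v \<bullet> D v = (fst v)\<^sup>2 / \<tau> + \<alpha> * (norm (snd v))\<^sup>2" for v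
    by (simp add: D_def inner_prod_def power2_eq_square power2_norm_eq_inner[symmetric])
  define c where "c = min (1 / \<tau>) \<alpha>"
  have c: "0 < c" "c * (norm v)\<^sup>2 \<le> v \<bullet> D v" for v
  proof -
    show "0 < c" using pos by (simp add: c_def)
    have "(norm v)\<^sup>2 = (fst v)\<^sup>2 + (norm (snd v))\<^sup>2"
      by (simp add: norm_prod_def)
    moreover have "c * (fst v)\<^sup>2 \<le> 1 / \<tau> * (fst v)\<^sup>2" "c * (norm (snd v))\<^sup>2 \<le> \<alpha> * (norm (snd v))\<^sup>2"
      by (intro mult_right_mono; simp add: c_def)+
    ultimately show "c * (norm v)\<^sup>2 \<le> v \<bullet> D v" by (simp add: formD distrib_left)
  qed
  have contw: "continuous_on Q w" if "Q \<subseteq> {0..<T} \<times> UNIV" for Q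
    by (rule continuous_on_subset[OF cont]) (use that in auto)
  have contU: "continuous_on Q1 U"
    unfolding U_def using Q1(2) by (intro continuous_intros contw) auto
  have contW: "continuous_on Q2 W"
    unfolding W_def using Q2(2) by (intro continuous_intros contw) auto
  have zQ: "z0 \<in> Q1" "y0 \<in> Q2" using Q1(3) Q2(3) interior_subset by blast+
  have t0: "fst z0 \<in> {0<..<T}" "fst y0 \<in> {0<..<T}" using Q1 Q2 zQ by auto
  have max': "U \<xi> + W \<zeta> - ((\<xi> - \<zeta>) \<bullet> D (\<xi> - \<zeta>)) / 2 \<le> U z0 + W y0 - ((z0 - y0) \<bullet> D (z0 - y0)) / 2"
    if "\<xi> \<in> Q1" "\<zeta> \<in> Q2" for \<xi> \<zeta>
  proof -
    have eq: "((\<xi> - \<zeta>) \<bullet> D (\<xi> - \<zeta>)) / 2 = \<alpha> / 2 * (norm (snd \<xi> - snd \<zeta>))\<^sup>2 + (fst \<xi> - fst \<zeta>)\<^sup>2 / (2 * \<tau>)" for \<xi> \<zeta>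
      unfolding formD by (simp add: add_divide_distrib)
    show ?thesis using max[OF that] unfolding U_def W_def eq by linarith
  qed
  obtain r1 where r1: "r1 > 0" "ball z0 r1 \<subseteq> Q1" using Q1(3) mem_interior by blast
  obtain r2 where r2: "r2 > 0" "ball y0 r2 \<subseteq> Q2" using Q2(3) mem_interior by blast
  define R where "R = 2 + \<bar>w z0\<bar> + \<bar>w y0\<bar> + norm p + \<beta> * norm (snd z0) + 6 * (real CARD('n))\<^sup>2 * \<alpha> + \<beta> * norm I"
  have R0: "0 < R" using pos by (simp add: R_def add_pos_nonneg)
  obtain \<delta> where \<delta>: "\<delta> > 0" and uni: "\<And>t t' x x' r r' p p' X X'. t \<in> {0..T} \<Longrightarrow> t' \<in> {0..T} \<Longrightarrow> r \<in> {-R..R} \<Longrightarrow> r' \<in> {-R..R} \<Longrightarrow>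
      p \<in> ball 0 R \<Longrightarrow> p' \<in> ball 0 R \<Longrightarrow> X \<in> sym_mats \<inter> ball 0 R \<Longrightarrow> X' \<in> sym_mats \<inter> ball 0 R \<Longrightarrow>
      \<bar>t - t'\<bar> < \<delta> \<Longrightarrow> norm (x - x') < \<delta> \<Longrightarrow> \<bar>r - r'\<bar> < \<delta> \<Longrightarrow> norm (p - p') < \<delta> \<Longrightarrow> norm (X - X') < \<delta> \<Longrightarrow>
      \<bar>G t x r p X - G t' x' r' p' X'\<bar> \<le> e / 3"
    using uniform[OF R0, of "e / 3"] e by (metis divide_pos_pos zero_less_numeral)
  define \<delta>' where "\<delta>' = min \<delta> 1"
  have \<delta>': "0 < \<delta>'" using \<delta> by (simp add: \<delta>'_def)
  obtain d1 where d1: "d1 > 0" "\<And>z. z \<in> Q1 \<Longrightarrow> norm (z - z0) < d1 \<Longrightarrow> \<bar>w z - w z0\<bar> < \<delta>'"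
    using contw[OF Q1(2)] zQ(1) \<delta>' unfolding continuous_on_iff dist_norm real_norm_def by metis
  obtain d2 where d2: "d2 > 0" "\<And>z. z \<in> Q2 \<Longrightarrow> norm (z - y0) < d2 \<Longrightarrow> \<bar>w z - w y0\<bar> < \<delta>'"
    using contw[OF Q2(2)] zQ(2) \<delta>' unfolding continuous_on_iff dist_norm real_norm_def by metis
  have "\<forall>\<^sub>F \<rho> in at_right 0. 0 < \<rho> \<and> \<rho> < 1 \<and> 1 * \<rho> < r1 \<and> 1 * \<rho> < r2 \<and> 1 * \<rho> < d1 \<and> 1 * \<rho> < d2 \<and> 1 * \<rho> < \<delta>' \<and>
      (1 + \<beta>) * \<rho> < \<delta>' \<and> (B + 2 * norm I) * \<rho> < \<delta>' \<and> 6 * \<rho> < e \<and> 1 * \<rho> < fst z0 \<and> 1 * \<rho> < fst y0 \<and> 1 * \<rho> < T - fst z0 \<and> 1 * \<rho> < T - fst y0"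
    using r1 r2 d1 d2 \<delta>' e Q1(4) Q2(4) t0 eventually_at_right_real[of 0 1]
    by (intro eventually_conj eventually_mult_less eventually_at_right_less) (auto elim: eventually_mono)
  then obtain \<rho> where \<rho>: "0 < \<rho>" "\<rho> < 1" "\<rho> < r1" "\<rho> < r2" "\<rho> < d1" "\<rho> < d2" "\<rho> < \<delta>'" "(1 + \<beta>) * \<rho> < \<delta>'"
      "(B + 2 * norm I) * \<rho> < \<delta>'" "6 * \<rho> < e" "\<rho> < fst z0" "\<rho> < fst y0" "\<rho> < T - fst z0" "\<rho> < T - fst y0"
    using eventually_happens'[OF trivial_limit_at_right_real] by (auto simp only: mult_1)
  obtain \<xi> \<zeta> P1 P2 H1 H2 where \<xi>\<zeta>: "\<xi> \<in> Q1" "\<zeta> \<in> Q2" "norm (\<xi> - z0) < \<rho>" "norm (\<zeta> - y0) < \<rho>"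
    and P: "norm (P1 - D (z0 - y0)) < \<rho>" "norm (P2 + D (z0 - y0)) < \<rho>"
    and H1: "linear H1" "\<And>v w. v \<bullet> H1 w = H1 v \<bullet> w" and H2: "linear H2" "\<And>v w. v \<bullet> H2 w = H2 v \<bullet> w"
    and ex1: "\<And>e. 0 < e \<Longrightarrow> \<exists>d>0. \<forall>h. norm h < d \<longrightarrow> \<xi> + h \<in> Q1 \<longrightarrow> U (\<xi> + h) \<le> U \<xi> + P1 \<bullet> h + (h \<bullet> H1 h) / 2 + e * (norm h)\<^sup>2"
    and ex2: "\<And>e. 0 < e \<Longrightarrow> \<exists>d>0. \<forall>h. norm h < d \<longrightarrow> \<zeta> + h \<in> Q2 \<longrightarrow> W (\<zeta> + h) \<le> W \<zeta> + P2 \<bullet> h + (h \<bullet> H2 h) / 2 + e * (norm h)\<^sup>2"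
    and lo: "\<And>h. - 3 * (h \<bullet> D h) \<le> h \<bullet> H1 h" "\<And>h. - 3 * (h \<bullet> D h) \<le> h \<bullet> H2 h"
    and up: "\<And>h k. h \<bullet> H1 h + k \<bullet> H2 k \<le> 3 * ((h - k) \<bullet> D (h - k)) + \<rho> * ((norm h)\<^sup>2 + (norm k)\<^sup>2)"
    using theorem_on_sums[OF linD symD c Q1(1) contU zQ(1) Q2(1) contW zQ(2) max' \<rho>(1)] by blast
  have comps: "\<bar>fst v\<bar> \<le> norm v" "norm (snd v) \<le> norm v" for v :: "real \<times> (real ^ 'n)"
    by (cases v; use norm_fst_le[of "fst v" "snd v"] norm_snd_le[of "snd v" "fst v"] in simp)+
  have ft: "\<bar>fst \<xi> - fst z0\<bar> < \<rho>" "norm (snd \<xi> - snd z0) < \<rho>" "\<bar>fst \<zeta> - fst y0\<bar> < \<rho>" "norm (snd \<zeta> - snd y0) < \<rho>"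
    using comps[of "\<xi> - z0"] comps[of "\<zeta> - y0"] \<xi>\<zeta>(3,4) by auto
  have t\<xi>: "fst \<xi> \<in> {0<..<T}" "fst \<zeta> \<in> {0<..<T}" using ft(1,3) \<rho>(11-14) by auto
  define M1 where "M1 = space_block H1"
  define M2 where "M2 = space_block H2"
  define s where "s = 3 * \<alpha> / (3 * \<alpha> + \<rho>)"
  define X where "X = s *\<^sub>R (M1 - \<rho> *\<^sub>R mat 1)"
  define Y where "Y = - (s *\<^sub>R (M2 - \<rho> *\<^sub>R mat 1))"
  have M: "M1 \<in> sym_mats" "M2 \<in> sym_mats" unfolding M1_def M2_def by (intro space_block_sym H1 H2)+
  have fM: "h \<bullet> (M1 *v h) = (0, h) \<bullet> H1 (0, h)" "h \<bullet> (M2 *v h) = (0, h) \<bullet> H2 (0, h)" for h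
    unfolding M1_def M2_def by (simp_all add: space_block_form H1(1) H2(1))
  have lo': "- 3 * \<alpha> * (norm h)\<^sup>2 \<le> h \<bullet> (M1 *v h)" "- 3 * \<alpha> * (norm h)\<^sup>2 \<le> h \<bullet> (M2 *v h)" for h
    using lo[of "(0, h)"] unfolding fM formD by simp_all
  have up': "h \<bullet> (M1 *v h) + k \<bullet> (M2 *v k) \<le> 3 * \<alpha> * (norm (h - k))\<^sup>2 + \<rho> * ((norm h)\<^sup>2 + (norm k)\<^sup>2)" for h k
    using up[of "(0, h)" "(0, k)"] unfolding fM formD by (simp add: norm_Pair)
  note fb = form_bounds_exact[OF pos(1) \<rho>(1) M lo' up', folded s_def, folded X_def Y_def I_def]
  have "\<rho> * (2 * (real CARD('n))\<^sup>2 * (3 * \<alpha> + \<rho>) / (3 * \<alpha>) + norm I) \<le> \<rho> * B"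
    unfolding B_def using \<rho>(1,2) pos(1) by (intro mult_left_mono add_right_mono divide_right_mono) auto
  then have MX: "norm (M1 - X) \<le> \<rho> * B" "norm (M2 + Y) \<le> \<rho> * B" using fb(2,3) by auto
  have symXY: "X \<in> sym_mats" "Y \<in> sym_mats" using fb(1) by (auto simp: form_bounds_def)
  have Isym: "I \<in> sym_mats" by (simp add: I_def mat_1_sym)
  have nXY: "norm X \<le> 6 * (real CARD('n))\<^sup>2 * \<alpha>" "norm Y \<le> 6 * (real CARD('n))\<^sup>2 * \<alpha>" using norm_le_of_form_bounds[OF fb(1)] .
  have b\<xi>: "ball \<xi> (r1 - \<rho>) \<subseteq> Q1" "ball \<zeta> (r2 - \<rho>) \<subseteq> Q2"
  proof -
    have "ball \<xi> (r1 - \<rho>) \<subseteq> ball z0 r1"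
    proof
      fix x assume "x \<in> ball \<xi> (r1 - \<rho>)"
      then show "x \<in> ball z0 r1"
        using \<xi>\<zeta>(3) dist_triangle[of z0 x \<xi>] unfolding mem_ball by (simp add: dist_norm norm_minus_commute)
    qed
    then show "ball \<xi> (r1 - \<rho>) \<subseteq> Q1" using r1 by blast
    have "ball \<zeta> (r2 - \<rho>) \<subseteq> ball y0 r2"
    proof
      fix x assume "x \<in> ball \<zeta> (r2 - \<rho>)"
      then show "x \<in> ball y0 r2"
        using \<xi>\<zeta>(4) dist_triangle[of y0 x \<zeta>] unfolding mem_ball by (simp add: dist_norm norm_minus_commute)
    qed
    then show "ball \<zeta> (r2 - \<rho>) \<subseteq> Q2" using r2 by blast
  qed
  have nonneg: "0 \<le> norm (snd z0) * \<beta>" "0 \<le> norm I * \<beta>" using pos by auto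
  have j1: "fst P1 \<le> G (fst \<xi>) (snd \<xi>) (w \<xi>) (snd P1 + \<beta> *\<^sub>R snd \<xi>) (M1 + (2 * \<rho> + \<beta>) *\<^sub>R I)"
    unfolding M1_def I_def
    by (rule jet_inequality_with_penalty[OF sub U_def pos(4) b\<xi>(1) _ t\<xi>(1) H1 \<rho>(1) ex1[OF \<rho>(1)]]) (use \<rho> in simp)
  have j2: "fst P2 \<le> reflected G (fst \<zeta>) (snd \<zeta>) (- w \<zeta>) (snd P2 + 0 *\<^sub>R snd \<zeta>) (M2 + (2 * \<rho> + 0) *\<^sub>R I)"
    unfolding M2_def I_def
    by (rule jet_inequality_with_penalty[OF super W_eq pos(4) b\<xi>(2) _ t\<xi>(2) H2 \<rho>(1) ex2[OF \<rho>(1)]]) (use \<rho> in simp)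
  have P1: "\<bar>fst P1 - (fst z0 - fst y0) / \<tau>\<bar> < \<rho>" "norm (snd P1 - p) < \<rho>"
    using comps[of "P1 - D (z0 - y0)"] P(1) by (auto simp: D_def p_def)
  have P2: "\<bar>fst P2 + (fst z0 - fst y0) / \<tau>\<bar> < \<rho>" "norm (snd P2 + p) < \<rho>"
    using comps[of "P2 + D (z0 - y0)"] P(2) by (auto simp: D_def p_def)
  have w\<xi>: "\<bar>w \<xi> - w z0\<bar> < \<delta>'" "\<bar>w \<zeta> - w y0\<bar> < \<delta>'"
    using d1(2)[OF \<xi>\<zeta>(1)] d2(2)[OF \<xi>\<zeta>(2)] \<xi>\<zeta>(3,4) \<rho> by auto
  have \<delta>'1: "\<delta>' \<le> 1" "\<delta>' \<le> \<delta>" by (simp_all add: \<delta>'_def)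
  have c1: "\<bar>G (fst \<xi>) (snd \<xi>) (w \<xi>) (snd P1 + \<beta> *\<^sub>R snd \<xi>) (M1 + (2 * \<rho> + \<beta>) *\<^sub>R I)
      - G (fst z0) (snd z0) (w z0) (p + \<beta> *\<^sub>R snd z0) (X + \<beta> *\<^sub>R I)\<bar> \<le> e / 3"
  proof -
    have dp: "norm ((snd P1 + \<beta> *\<^sub>R snd \<xi>) - (p + \<beta> *\<^sub>R snd z0)) < \<delta>'"
    proof -
      have eq: "(snd P1 + \<beta> *\<^sub>R snd \<xi>) - (p + \<beta> *\<^sub>R snd z0) = (snd P1 - p) + \<beta> *\<^sub>R (snd \<xi> - snd z0)" by (simp add: algebra_simps)
      have "norm ((snd P1 + \<beta> *\<^sub>R snd \<xi>) - (p + \<beta> *\<^sub>R snd z0)) \<le> norm (snd P1 - p) + \<beta> * norm (snd \<xi> - snd z0)"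
        unfolding eq using norm_triangle_ineq[of "snd P1 - p" "\<beta> *\<^sub>R (snd \<xi> - snd z0)"] pos(3) by simp
      also have "\<dots> \<le> \<rho> + \<beta> * \<rho>" using P1(2) ft(2) pos(3) by (intro add_mono mult_left_mono) auto
      finally show ?thesis using \<rho>(8) by (simp add: distrib_right)
    qed
    have dX: "norm ((M1 + (2 * \<rho> + \<beta>) *\<^sub>R I) - (X + \<beta> *\<^sub>R I)) < \<delta>'"
    proof -
      have eq: "(M1 + (2 * \<rho> + \<beta>) *\<^sub>R I) - (X + \<beta> *\<^sub>R I) = (M1 - X) + (2 * \<rho>) *\<^sub>R I" by (simp add: algebra_simps)
      have "norm ((M1 + (2 * \<rho> + \<beta>) *\<^sub>R I) - (X + \<beta> *\<^sub>R I)) \<le> norm (M1 - X) + 2 * \<rho> * norm I"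
        unfolding eq using norm_triangle_ineq[of "M1 - X" "(2 * \<rho>) *\<^sub>R I"] \<rho>(1) by simp
      then show ?thesis using MX(1) \<rho>(9) by (simp add: algebra_simps)
    qed
    have np: "norm (p + \<beta> *\<^sub>R snd z0) \<le> norm p + \<beta> * norm (snd z0)"
      using norm_triangle_ineq[of p "\<beta> *\<^sub>R snd z0"] pos(3) by simp
    have nX: "norm (X + \<beta> *\<^sub>R I) \<le> 6 * (real CARD('n))\<^sup>2 * \<alpha> + \<beta> * norm I"
      using norm_triangle_ineq[of X "\<beta> *\<^sub>R I"] pos(3) nXY by simp
    have np': "norm (snd P1 + \<beta> *\<^sub>R snd \<xi>) < norm (p + \<beta> *\<^sub>R snd z0) + 1"
      using norm_triangle_sub[of "snd P1 + \<beta> *\<^sub>R snd \<xi>" "p + \<beta> *\<^sub>R snd z0"] dp \<delta>'1 by linarith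
    have nX': "norm (M1 + (2 * \<rho> + \<beta>) *\<^sub>R I) < norm (X + \<beta> *\<^sub>R I) + 1"
      using norm_triangle_sub[of "M1 + (2 * \<rho> + \<beta>) *\<^sub>R I" "X + \<beta> *\<^sub>R I"] dX \<delta>'1 by linarith
    have nn: "0 \<le> norm p" "0 \<le> \<beta> * norm (snd z0)" "0 \<le> 6 * (real CARD('n))\<^sup>2 * \<alpha>" "0 \<le> \<beta> * norm I" using pos by auto
    show ?thesis
    proof (rule uni)
      show "fst \<xi> \<in> {0..T}" "fst z0 \<in> {0..T}" using t\<xi> t0 by auto
      show "w \<xi> \<in> {-R..R}" "w z0 \<in> {-R..R}" using w\<xi>(1) \<delta>'1 nn unfolding R_def atLeastAtMost_iff by linarith+
      show "snd P1 + \<beta> *\<^sub>R snd \<xi> \<in> ball 0 R" "p + \<beta> *\<^sub>R snd z0 \<in> ball 0 R"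
        using np np' nn unfolding mem_ball_0 R_def by linarith+
      show "M1 + (2 * \<rho> + \<beta>) *\<^sub>R I \<in> sym_mats \<inter> ball 0 R" "X + \<beta> *\<^sub>R I \<in> sym_mats \<inter> ball 0 R"
      proof -
        have "M1 + (2 * \<rho> + \<beta>) *\<^sub>R I \<in> sym_mats" "X + \<beta> *\<^sub>R I \<in> sym_mats"
          by (intro sym_mats_add sym_mats_scaleR[OF Isym] M symXY)+
        moreover have "norm (M1 + (2 * \<rho> + \<beta>) *\<^sub>R I) < R" "norm (X + \<beta> *\<^sub>R I) < R"
          using nX nX' nn unfolding R_def by linarith+
        ultimately show "M1 + (2 * \<rho> + \<beta>) *\<^sub>R I \<in> sym_mats \<inter> ball 0 R" "X + \<beta> *\<^sub>R I \<in> sym_mats \<inter> ball 0 R"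
          unfolding Int_iff mem_ball_0 by blast+
      qed
    qed (use ft \<rho> w\<xi> dp dX \<delta>'1 in linarith)+
  qed
  have c2: "\<bar>G (fst \<zeta>) (snd \<zeta>) (w \<zeta>) (- snd P2) (- (M2 + (2 * \<rho>) *\<^sub>R I)) - G (fst y0) (snd y0) (w y0) p Y\<bar> \<le> e / 3"
  proof -
    have dp: "norm (- snd P2 - p) < \<delta>'"
      using P2(2) \<rho>(7) norm_minus_cancel[of "snd P2 + p"] by simp
    have dX: "norm (- (M2 + (2 * \<rho>) *\<^sub>R I) - Y) < \<delta>'"
    proof -
      have eq: "- (M2 + (2 * \<rho>) *\<^sub>R I) - Y = - ((M2 + Y) + (2 * \<rho>) *\<^sub>R I)" by (simp add: algebra_simps)
      have "norm (- (M2 + (2 * \<rho>) *\<^sub>R I) - Y) \<le> norm (M2 + Y) + 2 * \<rho> * norm I"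
        unfolding eq norm_minus_cancel using norm_triangle_ineq[of "M2 + Y" "(2 * \<rho>) *\<^sub>R I"] \<rho>(1) by simp
      then show ?thesis using MX(2) \<rho>(9) by (simp add: algebra_simps)
    qed
    have np': "norm (- snd P2) < norm p + 1"
      using norm_triangle_sub[of "- snd P2" p] dp \<delta>'1 by linarith
    have nX': "norm (- (M2 + (2 * \<rho>) *\<^sub>R I)) < norm Y + 1"
      using norm_triangle_sub[of "- (M2 + (2 * \<rho>) *\<^sub>R I)" Y] dX \<delta>'1 by linarith
    have nn: "0 \<le> norm p" "0 \<le> \<beta> * norm (snd z0)" "0 \<le> 6 * (real CARD('n))\<^sup>2 * \<alpha>" "0 \<le> \<beta> * norm I" using pos by auto
    show ?thesis
    proof (rule uni)
      show "fst \<zeta> \<in> {0..T}" "fst y0 \<in> {0..T}" using t\<xi> t0 by auto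
      show "w \<zeta> \<in> {-R..R}" "w y0 \<in> {-R..R}" using w\<xi>(2) \<delta>'1 nn unfolding R_def atLeastAtMost_iff by linarith+
      show "- snd P2 \<in> ball 0 R" "p \<in> ball 0 R"
        using np' nn unfolding mem_ball_0 R_def by linarith+
      show "- (M2 + (2 * \<rho>) *\<^sub>R I) \<in> sym_mats \<inter> ball 0 R" "Y \<in> sym_mats \<inter> ball 0 R"
      proof -
        have "M2 + (2 * \<rho>) *\<^sub>R I \<in> sym_mats"
          by (intro sym_mats_add sym_mats_scaleR[OF Isym] M)
        then have "- (M2 + (2 * \<rho>) *\<^sub>R I) \<in> sym_mats" by (rule sym_mats_minus)
        moreover have "norm (- (M2 + (2 * \<rho>) *\<^sub>R I)) < R" "norm Y < R"
          using nXY nX' nn unfolding R_def by linarith+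
        ultimately show "- (M2 + (2 * \<rho>) *\<^sub>R I) \<in> sym_mats \<inter> ball 0 R" "Y \<in> sym_mats \<inter> ball 0 R"
          using symXY unfolding Int_iff mem_ball_0 by blast+
      qed
    qed (use ft \<rho> w\<xi> dp dX \<delta>'1 in linarith)+
  qed
  show ?thesis
  proof (rule that[OF fb(1)])
    have "fst P2 \<le> - G (fst \<zeta>) (snd \<zeta>) (w \<zeta>) (- snd P2) (- (M2 + (2 * \<rho>) *\<^sub>R I))"
      using j2 by (simp add: reflected_def)
    then show "- e \<le> G (fst z0) (snd z0) (w z0) (\<alpha> *\<^sub>R (snd z0 - snd y0) + \<beta> *\<^sub>R snd z0) (X + \<beta> *\<^sub>R mat 1)
          - G (fst y0) (snd y0) (w y0) (\<alpha> *\<^sub>R (snd z0 - snd y0)) Y"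
      unfolding p_def[symmetric] I_def[symmetric]
      using j1 c1 c2 P1(1) P2(1) \<rho>(10) unfolding abs_le_iff abs_less_iff by linarith
  qed
qed

end

section \<open>Moduli of continuity in time and in space\<close>

text \<open>
  Along \<open>\<alpha> = 2\<^sup>k\<close> the values cannot drop by \<open>\<sigma>\<close> every time.
\<close>

lemma bounded_slow_halving:
  fixes m :: "real \<Rightarrow> real"
  assumes bd: "\<And>\<alpha>. 1 \<le> \<alpha> \<Longrightarrow> 0 \<le> m \<alpha>" "m 1 \<le> B" and \<sigma>: "0 < \<sigma>"
  obtains \<alpha> where "1 \<le> \<alpha>" "m (\<alpha> / 2) - m \<alpha> \<le> \<sigma>"
proof (rule ccontr)
  assume "\<not> thesis"
  then have c: "\<sigma> < m (\<alpha> / 2) - m \<alpha>" if "1 \<le> \<alpha>" for \<alpha> using that \<open>\<And>\<alpha>. 1 \<le> \<alpha> \<Longrightarrow> m (\<alpha> / 2) - m \<alpha> \<le> \<sigma> \<Longrightarrow> thesis\<close> by (meson not_le)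
  have "m (2 ^ k) \<le> B - real k * \<sigma>" for k
  proof (induction k)
    case (Suc k)
    have "\<sigma> < m (2 ^ Suc k / 2) - m (2 ^ Suc k)" by (rule c) (rule one_le_power, simp)
    then show ?case using Suc by (simp add: algebra_simps)
  qed (use bd in simp)
  moreover obtain k :: nat where "B / \<sigma> < real k" using reals_Archimedean2 by blast
  then have "B < real k * \<sigma>" using \<sigma> by (simp add: divide_less_eq)
  moreover have "0 \<le> m (2 ^ k)" by (rule bd(1)) (rule one_le_power, simp)
  ultimately show False by (meson diff_less_0_iff_less less_le_trans not_le order_le_less_trans)
qed

text \<open>
  The equation is posed before the final time only; by continuity a strict inequality at the final time
  already holds earlier.
\<close>

lemma exceeds_before_right_end:
  fixes f :: "real \<Rightarrow> real"
  assumes "continuous_on {a..b} f" "a < b" "t \<in> {a..b}" "v < f t"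
  obtains s where "s \<in> {a..<b}" "v < f s" "a < t \<Longrightarrow> a < s"
proof (cases "t < b")
  case True
  show ?thesis by (rule that[of t]) (use assms True in auto)
next
  case False
  then have t: "t = b" using assms by auto
  obtain d where d: "d > 0" "\<And>s. s \<in> {a..b} \<Longrightarrow> dist s b < d \<Longrightarrow> dist (f s) (f b) < f b - v"
    using assms(1,2,4) t unfolding continuous_on_iff by (metis atLeastAtMost_iff diff_gt_0_iff_gt order_refl less_imp_le)
  define s where "s = max ((a + b) / 2) (b - d / 2)"
  have "b - d / 2 \<le> s" "(a + b) / 2 \<le> s" "s < b" using assms(2) d(1) by (auto simp: s_def)
  then have s: "s \<in> {a..<b}" "a < s" "dist s b < d" using assms(2) d(1) unfolding dist_real_def by auto
  have "dist (f s) (f b) < f b - v" by (rule d(2)) (use s in auto)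
  then have "v < f s" by (simp add: dist_real_def)
  then show ?thesis by (intro that[of s]) (use s in auto)
qed

text \<open>
  If \<open>w\<close> exceeded the barrier \<open>w(s,x) + \<epsilon> + C |y-x|\<^sup>2 + K (t-s)\<close> before \<open>T\<close>, then also after adding a small
  multiple of \<open>1/(T-t)\<close>, and the difference would have a positive maximum. At \<open>t = s\<close> the modulus in space
  excludes it, on \<open>|y-x| = 1\<close> the choice \<open>C \<ge> 2M\<close>, and near \<open>T\<close> the added term. At an interior maximum the
  equation gives \<open>K \<le> G(\<dots>)\<close> with arguments bounded independently of \<open>s\<close>, \<open>t\<close>, \<open>x\<close> and \<open>K\<close>.
\<close>

lemma upper_time_modulus:
  fixes w :: "real \<times> (real ^ 'n::finite) \<Rightarrow> real"
  assumes cont: "continuous_on ({0..T} \<times> UNIV) w"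
    and sub: "jet_subsolution G ({0<..<T} \<times> UNIV) w"
    and M: "\<And>t x. t \<in> {0..T} \<Longrightarrow> \<bar>w (t, x)\<bar> \<le> M" "1 \<le> M"
    and bound: "\<And>R. 0 < R \<Longrightarrow> \<exists>K. \<forall>t\<in>{0..T}. \<forall>x. \<forall>r\<in>{-R..R}. \<forall>p\<in>ball 0 R. \<forall>X\<in>sym_mats \<inter> ball 0 R. G t x r p X \<le> K"
    and space: "0 < \<alpha>" "\<And>t x y. t \<in> {0..T} \<Longrightarrow> w (t, x) - w (t, y) \<le> \<epsilon> + \<alpha> / 2 * (norm (x - y))\<^sup>2" and \<epsilon>: "0 < \<epsilon>"
  shows "\<exists>K\<ge>0. \<forall>s\<in>{0..T}. \<forall>t\<in>{s..T}. \<forall>x. w (t, x) - w (s, x) \<le> \<epsilon> + K * (t - s)"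
proof -
  define I where "I = (mat 1 :: real ^ 'n ^ 'n)"
  define C where "C = \<alpha> / 2 + 2 * M"
  have C: "0 < C" "2 * M \<le> C" "\<alpha> / 2 \<le> C" using space(1) M(2) by (auto simp: C_def)
  define R where "R = 2 * C + M + (2 + 2 * C) * norm I + 1"
  have n0: "0 \<le> (2 + 2 * C) * norm I" using C by simp
  then have R: "0 < R" "M \<le> R" using C M(2) by (simp_all add: R_def add_pos_nonneg)
  obtain K0 where K0: "\<forall>t\<in>{0..T}. \<forall>x. \<forall>r\<in>{-R..R}. \<forall>p\<in>ball 0 R. \<forall>X\<in>sym_mats \<inter> ball 0 R. G t x r p X \<le> K0"
    using bound[OF R(1)] by blast
  define K where "K = max 0 K0 + 1"
  have K: "0 \<le> K" "K0 < K" by (auto simp: K_def)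
  have "w (t, x) - w (s, x) \<le> \<epsilon> + K * (t - s)" if st: "s \<in> {0..T}" "t \<in> {s..T}" for s t x
  proof (rule ccontr)
    assume "\<not> w (t, x) - w (s, x) \<le> \<epsilon> + K * (t - s)"
    then have gt: "\<epsilon> < w (t, x) - K * (t - s) - w (s, x)" by simp
    have "t \<noteq> s" using gt \<epsilon> by auto
    then have sT: "s < T" "s < t" using st by auto
    have contl: "continuous_on {s..T} (\<lambda>t. w (t, x) - K * (t - s) - w (s, x))"
      using st(1) by (intro continuous_intros continuous_on_compose2[OF cont]) auto
    obtain t1 where t1: "t1 \<in> {s..<T}" "\<epsilon> < w (t1, x) - K * (t1 - s) - w (s, x)" "s < t1"
      using exceeds_before_right_end[OF contl sT(1) _ gt] st(2) sT(2) by auto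
    define gap where "gap = w (t1, x) - K * (t1 - s) - w (s, x) - \<epsilon>"
    define \<eta> where "\<eta> = min (gap / 2 * (T - t1)) (2 * M * (T - t1))"
    have \<eta>: "0 < \<eta>" "\<eta> / (T - t1) < gap" "\<eta> / (T - t1) \<le> 2 * M"
    proof -
      show "0 < \<eta>" using t1 M(2) by (auto simp: \<eta>_def gap_def)
      have "\<eta> / (T - t1) \<le> gap / 2" "\<eta> / (T - t1) \<le> 2 * M" using t1 by (auto simp: \<eta>_def divide_le_eq)
      moreover have "0 < gap" using t1 by (simp add: gap_def)
      ultimately show "\<eta> / (T - t1) < gap" "\<eta> / (T - t1) \<le> 2 * M" by linarith+
    qed
    define b where "b = T - \<eta> / (2 * M)"
    have b: "b < T" "t1 \<le> b" using \<eta> M(2) t1 by (auto simp: b_def field_simps)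
    define f where "f z = w z - w (s, x) - \<epsilon> - C * (norm (snd z - x))\<^sup>2 - K * (fst z - s) - \<eta> / (T - fst z)" for z
    define Q where "Q = {s..b} \<times> cball x 1"
    have "compact Q" unfolding Q_def by (intro compact_Times compact_Icc compact_cball)
    moreover have "continuous_on Q f" unfolding f_def
      by (intro continuous_intros continuous_on_subset[OF cont]) (use st b in \<open>auto simp: Q_def\<close>)
    moreover have t1Q: "(t1, x) \<in> Q" using t1 b by (auto simp: Q_def)
    ultimately obtain z0 where z0: "z0 \<in> Q" "\<And>z. z \<in> Q \<Longrightarrow> f z \<le> f z0"
      using continuous_attains_sup[of Q f] by blast
    have "0 < f (t1, x)" using \<eta>(2) by (simp add: f_def gap_def)
    then have f0: "0 < f z0" using z0(2)[OF t1Q] by simp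
    have z0T: "fst z0 \<in> {s..b}" "norm (snd z0 - x) \<le> 1" using z0(1) by (auto simp: Q_def mem_Times_iff dist_norm norm_minus_commute)
    have z0T': "fst z0 \<in> {0..T}" using z0T st b by auto
    have wM: "w z0 - w (s, x) \<le> 2 * M" using M(1)[of "fst z0" "snd z0"] M(1)[OF st(1), of x] z0T' by simp
    have pen: "0 \<le> C * (norm (snd z0 - x))\<^sup>2" "0 \<le> K * (fst z0 - s)" "0 \<le> \<eta> / (T - fst z0)"
      using C K z0T b \<eta> by auto
    have "fst z0 \<noteq> s"
    proof
      assume a: "fst z0 = s"
      have "w z0 - w (s, x) \<le> \<epsilon> + \<alpha> / 2 * (norm (snd z0 - x))\<^sup>2" using space(2)[OF st(1), of "snd z0" x] a by (metis prod.collapse)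
      moreover have "\<alpha> / 2 * (norm (snd z0 - x))\<^sup>2 \<le> C * (norm (snd z0 - x))\<^sup>2" using C by (intro mult_right_mono) auto
      ultimately show False using f0 pen unfolding f_def by linarith
    qed
    moreover have "fst z0 \<noteq> b"
    proof
      assume "fst z0 = b"
      then have "\<eta> / (T - fst z0) = 2 * M" using \<eta> M(2) by (simp add: b_def)
      then show False using f0 pen wM \<epsilon> unfolding f_def by linarith
    qed
    moreover have n1: "norm (snd z0 - x) \<noteq> 1"
    proof
      assume "norm (snd z0 - x) = 1"
      then have "2 * M \<le> C * (norm (snd z0 - x))\<^sup>2" using C by simp
      then show False using f0 pen wM \<epsilon> unfolding f_def by linarith
    qed
    ultimately have int: "fst z0 \<in> {s<..<b}" "norm (snd z0 - x) < 1" using z0T by auto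
    have "z0 \<in> {s<..<b} \<times> ball x 1" using int by (auto simp: mem_Times_iff dist_norm norm_minus_commute)
    moreover have "open ({s<..<b} \<times> ball x 1)" by (intro open_Times) auto
    ultimately obtain r where r: "r > 0" "ball z0 r \<subseteq> {s<..<b} \<times> ball x 1" using openE by blast
    then have rQ: "ball z0 r \<subseteq> Q" by (force simp: Q_def)
    define U where "U z = w z - (2 * C) / 2 * (norm (snd z))\<^sup>2 - \<eta> / (T - fst z)" for z
    define P where "P = (K, - (2 * C) *\<^sub>R x)"
    have Uf: "U z = f z + w (s, x) + \<epsilon> + C * (norm x)\<^sup>2 - 2 * C * (snd z \<bullet> x) + K * (fst z - s)" for z
      unfolding U_def f_def power2_norm_eq_inner by (simp add: inner_diff_left inner_diff_right inner_commute algebra_simps)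
    have "fst P \<le> G (fst z0) (snd z0) (w z0) (snd P + (2 * C) *\<^sub>R snd z0) (space_block (\<lambda>h. 0) + (2 * 1 + 2 * C) *\<^sub>R mat 1)"
    proof (rule jet_inequality_with_penalty[OF sub U_def _ rQ r(1)])
      show "\<exists>d>0. \<forall>h. norm h < d \<longrightarrow> z0 + h \<in> Q \<longrightarrow> U (z0 + h) \<le> U z0 + P \<bullet> h + (h \<bullet> 0) / 2 + 1 * (norm h)\<^sup>2"
      proof (intro exI[of _ 1] conjI allI impI)
        fix h assume "z0 + h \<in> Q"
        then have "f (z0 + h) \<le> f z0" by (rule z0(2))
        then have "f (z0 + h) \<le> f z0 + (norm h)\<^sup>2" by (rule add_increasing2[rotated]) simp
        then show "U (z0 + h) \<le> U z0 + P \<bullet> h + (h \<bullet> 0) / 2 + 1 * (norm h)\<^sup>2"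
          unfolding Uf by (simp add: P_def inner_prod_def inner_add_left inner_commute algebra_simps)
      qed simp
    qed (use \<eta> int st b in \<open>auto simp: linear_iff\<close>)
    moreover have "space_block (\<lambda>h. 0) = (0 :: real ^ 'n ^ 'n)"
      unfolding matrix_eq by (subst space_block_mult) (auto simp: linear_iff)
    ultimately have KG: "K \<le> G (fst z0) (snd z0) (w z0) ((2 * C) *\<^sub>R (snd z0 - x)) ((2 + 2 * C) *\<^sub>R I)"
      by (simp add: P_def I_def algebra_simps)
    have "w z0 \<in> {-R..R}" using M(1)[OF z0T', of "snd z0"] R(2) by (simp add: abs_le_iff)
    moreover have "(2 * C) *\<^sub>R (snd z0 - x) \<in> ball 0 R"
    proof -
      have "norm ((2 * C) *\<^sub>R (snd z0 - x)) \<le> 2 * C" using int(2) C by simp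
      then show ?thesis using n0 M(2) unfolding mem_ball_0 R_def by linarith
    qed
    moreover have "(2 + 2 * C) *\<^sub>R I \<in> sym_mats \<inter> ball 0 R"
    proof -
      have "norm ((2 + 2 * C) *\<^sub>R I) = (2 + 2 * C) * norm I" using C by simp
      then have "norm ((2 + 2 * C) *\<^sub>R I) < R" using C M(2) unfolding R_def by linarith
      moreover have "(2 + 2 * C) *\<^sub>R I \<in> sym_mats" unfolding I_def by (rule sym_mats_scaleR[OF mat_1_sym])
      ultimately show ?thesis unfolding Int_iff mem_ball_0 by blast
    qed
    ultimately have "G (fst z0) (snd z0) (w z0) ((2 * C) *\<^sub>R (snd z0 - x)) ((2 + 2 * C) *\<^sub>R I) \<le> K0"
      using K0 z0T' by blast
    then show False using KG K(2) by simp
  qed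
  then show ?thesis using K(1) by blast
qed

context proper_equation
begin

text \<open>
  Let \<open>m \<alpha>\<close> be the supremum of \<open>w(t,x) - w(t,y) - \<alpha>/2 |x-y|\<^sup>2\<close>, which is assumed to stay above \<open>\<epsilon>\<close>. Since \<open>m\<close>
  is bounded, some \<open>\<alpha> \<ge> 1\<close> has \<open>m(\<alpha>/2) - m \<alpha> \<le> \<sigma>\<close>, and this forces \<open>\<alpha> |x-y|\<^sup>2 \<le> 12 \<sigma>\<close> at every
  near-maximum: the quantity that has to be small in the structure condition. The remaining parameters
  are chosen in the order \<open>\<beta>\<close> (penalty at infinity), \<open>\<eta>\<close> (barrier at \<open>T\<close>), \<open>\<tau>\<close> (doubling of time). The last
  may depend on \<open>\<beta>\<close>, so that only uniform continuity of \<open>w\<close> on a compact set is needed to compare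
  the times \<open>t0\<close> and \<open>s0\<close>.
\<close>

theorem spatial_modulus:
  fixes w :: "real \<times> (real ^ 'n) \<Rightarrow> real"
  assumes cont: "continuous_on ({0..T} \<times> UNIV) w"
    and sub: "jet_subsolution G ({0<..<T} \<times> UNIV) w"
    and super: "jet_subsolution (reflected G) ({0<..<T} \<times> UNIV) (\<lambda>z. - w z)"
    and M: "\<And>t x. t \<in> {0..T} \<Longrightarrow> \<bar>w (t, x)\<bar> \<le> M" "1 \<le> M"
    and init: "uniformly_continuous_on UNIV (\<lambda>x. w (0, x))"
    and \<epsilon>: "0 < \<epsilon>"
  shows "\<exists>\<alpha>>0. \<forall>t\<in>{0..T}. \<forall>x y. w (t, x) - w (t, y) \<le> \<epsilon> + \<alpha> / 2 * (norm (x - y))\<^sup>2"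
proof (rule ccontr)
  assume neg: "\<not> (\<exists>\<alpha>>0. \<forall>t\<in>{0..T}. \<forall>x y. w (t, x) - w (t, y) \<le> \<epsilon> + \<alpha> / 2 * (norm (x - y))\<^sup>2)"
  define \<Phi> where "\<Phi> \<alpha> = (\<lambda>(t, x, y). w (t, x) - w (t, y) - \<alpha> / 2 * (norm (x - y))\<^sup>2)" for \<alpha>
  define S where "S = {0..T} \<times> (UNIV :: (real ^ 'n) set) \<times> (UNIV :: (real ^ 'n) set)"
  define m where "m \<alpha> = (SUP q\<in>S. \<Phi> \<alpha> q)" for \<alpha>
  have le2M: "w (t, x) - w (t', y) \<le> 2 * M" if "t \<in> {0..T}" "t' \<in> {0..T}" for t t' x y
    using M(1)[OF that(1), of x] M(1)[OF that(2), of y] by (simp add: abs_le_iff)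
  have \<Phi>bd: "\<Phi> \<alpha> q \<le> 2 * M" if "0 < \<alpha>" "q \<in> S" for \<alpha> q
  proof -
    obtain t x y where q: "q = (t, x, y)" by (cases q)
    have "0 \<le> \<alpha> / 2 * (norm (x - y))\<^sup>2" using that by simp
    then show ?thesis using le2M[of t t x y] that(2) by (simp add: \<Phi>_def S_def q)
  qed
  have bdd: "bdd_above (\<Phi> \<alpha> ` S)" if "0 < \<alpha>" for \<alpha> using \<Phi>bd[OF that] by (auto intro!: bdd_aboveI)
  have Sne: "S \<noteq> {}" using T_pos by (auto simp: S_def)
  have mub: "\<Phi> \<alpha> q \<le> m \<alpha>" if "0 < \<alpha>" "q \<in> S" for \<alpha> q
    unfolding m_def by (rule cSUP_upper[OF that(2) bdd[OF that(1)]])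
  have m\<epsilon>: "\<epsilon> \<le> m \<alpha>" if \<alpha>: "0 < \<alpha>" for \<alpha>
  proof -
    obtain t x y where "t \<in> {0..T}" "\<epsilon> + \<alpha> / 2 * (norm (x - y))\<^sup>2 < w (t, x) - w (t, y)"
      using neg \<alpha> by (meson not_le)
    then show ?thesis using mub[OF \<alpha>, of "(t, x, y)"] by (simp add: \<Phi>_def S_def)
  qed
  have "0 < \<epsilon> / 8" using \<epsilon> by simp
  obtain \<delta>S where \<delta>S: "\<delta>S > 0" "\<forall>t\<in>{0..T}. \<forall>x y. \<forall>r\<in>{-M..M}. \<forall>\<alpha>>0. \<forall>X Y. form_bounds \<alpha> X Y \<longrightarrow>
        \<alpha> * (norm (x - y))\<^sup>2 + norm (x - y) < \<delta>S \<longrightarrow> G t x r (\<alpha> *\<^sub>R (x - y)) X - G t y r (\<alpha> *\<^sub>R (x - y)) Y \<le> \<epsilon> / 8"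
    using shift[of M, OF _ \<open>0 < \<epsilon> / 8\<close>] M(2) by auto
  obtain \<delta>0 where \<delta>0: "\<delta>0 > 0" "\<And>x y. norm (x - y) < \<delta>0 \<Longrightarrow> \<bar>w (0, x) - w (0, y)\<bar> < \<epsilon> / 4"
    using init[unfolded uniformly_continuous_on_def, rule_format, of "\<epsilon> / 4"] \<epsilon> by (auto simp: dist_norm norm_minus_commute)
  \<comment> \<open>bound for \<open>|x - y|\<close> at the maximum; it follows from \<open>\<alpha> |x - y|\<^sup>2 \<le> 12 \<sigma>\<close> and \<open>\<alpha> \<ge> 1\<close>\<close>
  define \<kappa> where "\<kappa> = min 1 (min (\<delta>S / 3) (\<delta>0 / 2))"
  have \<kappa>: "0 < \<kappa>" "\<kappa> \<le> 1" "\<kappa> < \<delta>0" "2 * \<kappa> < \<delta>S" using \<delta>S(1) \<delta>0(1) by (auto simp: \<kappa>_def)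
  define \<sigma> where "\<sigma> = min (\<epsilon> / 8) (\<kappa>\<^sup>2 / 12)"
  have \<sigma>: "0 < \<sigma>" "\<sigma> \<le> \<epsilon> / 8" "12 * \<sigma> \<le> \<kappa>\<^sup>2" using \<epsilon> \<kappa> by (auto simp: \<sigma>_def)
  have "m 1 \<le> 2 * M" unfolding m_def by (rule cSUP_least[OF Sne \<Phi>bd]) auto
  then obtain \<alpha> where \<alpha>: "1 \<le> \<alpha>" "m (\<alpha> / 2) - m \<alpha> \<le> \<sigma>"
    using bounded_slow_halving[of m "2 * M" \<sigma>] m\<epsilon> \<epsilon> \<sigma>(1) by (metis less_le_trans less_imp_le zero_less_one)
  have \<alpha>0: "0 < \<alpha>" using \<alpha> by simp
  obtain t1 x1 y1 where 1: "t1 \<in> {0..T}" "m \<alpha> - \<sigma> / 2 < w (t1, x1) - w (t1, y1) - \<alpha> / 2 * (norm (x1 - y1))\<^sup>2"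
  proof -
    have "m \<alpha> - \<sigma> / 2 < (SUP q\<in>S. \<Phi> \<alpha> q)" using \<sigma>(1) by (simp add: m_def)
    then obtain q where "q \<in> S" "m \<alpha> - \<sigma> / 2 < \<Phi> \<alpha> q" using less_cSUP_iff[OF Sne bdd[OF \<alpha>0]] by blast
    then show ?thesis by (intro that[of "fst q" "fst (snd q)" "snd (snd q)"]) (auto simp: S_def \<Phi>_def case_prod_beta)
  qed
  have contl: "continuous_on {0..T} (\<lambda>t. w (t, x1) - w (t, y1) - \<alpha> / 2 * (norm (x1 - y1))\<^sup>2)"
    by (intro continuous_intros continuous_on_compose2[OF cont]) auto
  obtain t2 where t2: "t2 \<in> {0..<T}" "m \<alpha> - \<sigma> / 2 < w (t2, x1) - w (t2, y1) - \<alpha> / 2 * (norm (x1 - y1))\<^sup>2"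
    using exceeds_before_right_end[OF contl T_pos 1] by blast
  define I where "I = (mat 1 :: real ^ 'n ^ 'n)"
  define B where "B = 6 * (real CARD('n))\<^sup>2 * \<alpha>"
  have B: "0 \<le> B" using \<alpha>0 by (simp add: B_def)
  define R where "R = M + \<alpha> * \<kappa> + 2 + B + norm I"
  have R0: "0 < R" "M \<le> R" using M(2) \<alpha>0 \<kappa>(1) B by (simp_all add: R_def add_pos_nonneg)
  obtain \<delta>C where \<delta>C: "\<delta>C > 0" and uni: "\<And>t t' x x' r r' p p' X X'. t \<in> {0..T} \<Longrightarrow> t' \<in> {0..T} \<Longrightarrow> r \<in> {-R..R} \<Longrightarrow> r' \<in> {-R..R} \<Longrightarrow>
      p \<in> ball 0 R \<Longrightarrow> p' \<in> ball 0 R \<Longrightarrow> X \<in> sym_mats \<inter> ball 0 R \<Longrightarrow> X' \<in> sym_mats \<inter> ball 0 R \<Longrightarrow>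
      \<bar>t - t'\<bar> < \<delta>C \<Longrightarrow> norm (x - x') < \<delta>C \<Longrightarrow> \<bar>r - r'\<bar> < \<delta>C \<Longrightarrow> norm (p - p') < \<delta>C \<Longrightarrow> norm (X - X') < \<delta>C \<Longrightarrow>
      \<bar>G t x r p X - G t' x' r' p' X'\<bar> \<le> \<epsilon> / 16"
    using uniform[OF R0(1), of "\<epsilon> / 16"] \<epsilon> by (metis divide_pos_pos zero_less_numeral)
  define \<mu> where "\<mu> = min 1 \<delta>C"
  have \<mu>: "0 < \<mu>" "\<mu> \<le> 1" "\<mu> \<le> \<delta>C" using \<delta>C by (auto simp: \<mu>_def)
  \<comment> \<open>weight of the penalty at infinity, so small that at the maximum its gradient \<open>\<beta> x0\<close> and its Hessian \<open>\<beta> I\<close> have norm below \<open>\<mu>\<close>\<close>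
  define \<beta> where "\<beta> = min 1 (min (\<sigma> / (2 * ((norm x1)\<^sup>2 + 1))) (min (\<mu>\<^sup>2 / (4 * M)) (\<mu> / (2 * (norm I + 1)))))"
  have nx: "0 < (norm x1)\<^sup>2 + 1" "0 < norm I + 1" by (simp_all add: add_nonneg_pos)
  have \<beta>: "0 < \<beta>" "\<beta> \<le> 1" "\<beta> / 2 * (norm x1)\<^sup>2 \<le> \<sigma> / 4" "4 * M * \<beta> \<le> \<mu>\<^sup>2" "\<beta> * norm I < \<mu>"
  proof -
    show b0: "0 < \<beta>" using \<sigma>(1) \<mu>(1) M(2) nx by (simp add: \<beta>_def)
    show "\<beta> \<le> 1" by (simp add: \<beta>_def)
    have "\<beta> \<le> \<sigma> / (2 * ((norm x1)\<^sup>2 + 1))" by (simp add: \<beta>_def)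
    then have "\<beta> * (2 * ((norm x1)\<^sup>2 + 1)) \<le> \<sigma>" using nx(1) by (simp add: pos_le_divide_eq)
    then show "\<beta> / 2 * (norm x1)\<^sup>2 \<le> \<sigma> / 4" using b0 by (simp add: algebra_simps)
    have "\<beta> \<le> \<mu>\<^sup>2 / (4 * M)" by (simp add: \<beta>_def)
    then show "4 * M * \<beta> \<le> \<mu>\<^sup>2" using M(2) by (simp add: field_simps)
    have "\<beta> \<le> \<mu> / (2 * (norm I + 1))" by (simp add: \<beta>_def)
    then have "\<beta> * (2 * (norm I + 1)) \<le> \<mu>" using nx(2) by (simp add: pos_le_divide_eq)
    moreover have "\<beta> * norm I < \<beta> * (2 * (norm I + 1))" 
    proof (rule mult_strict_left_mono[OF _ b0])
      have "norm I < norm I + 1" "norm I + 1 < (norm I + 1) + (norm I + 1)" using nx(2) by simp_all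
      then show "norm I < 2 * (norm I + 1)" by simp
    qed
    ultimately show "\<beta> * norm I < \<mu>" by simp
  qed
  define \<eta> where "\<eta> = \<sigma> * (T - t2) / 8"
  have \<eta>: "0 < \<eta>" "\<eta> / (T - t2) = \<sigma> / 8"
  proof -
    have gen: "\<sigma> * x / 8 / x = \<sigma> / 8" if "0 < x" for x using that by simp
    have pos: "0 < T - t2" using t2(1) by simp
    then show "0 < \<eta>" using \<sigma>(1) by (simp add: \<eta>_def)
    show "\<eta> / (T - t2) = \<sigma> / 8" unfolding \<eta>_def using pos by (rule gen)
  qed
  have \<epsilon>M: "\<epsilon> \<le> 2 * M" using m\<epsilon>[of 1] \<open>m 1 \<le> 2 * M\<close> by simp
  \<comment> \<open>beyond \<open>b\<close> the barrier exceeds the oscillation of \<open>w\<close>\<close>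
  define b where "b = T - \<eta> / (2 * M)"
  have b: "b < T" "t2 \<le> b"
  proof -
    show "b < T" using \<eta>(1) M(2) by (simp add: b_def)
    have "\<eta> = \<sigma> / 8 * (T - t2)" by (simp add: \<eta>_def)
    also have "\<dots> \<le> (2 * M) * (T - t2)" using \<sigma>(2) \<epsilon>M t2(1) M(2) by (intro mult_right_mono) auto
    finally show "t2 \<le> b" using M(2) by (simp add: b_def field_simps)
  qed
  define r1 where "r1 = sqrt (4 * M / \<beta>)"
  define r2 where "r2 = r1 + sqrt (4 * M / \<alpha>)"
  have in_r1: "norm x < r1" if "\<beta> / 2 * (norm x)\<^sup>2 < 2 * M" for x :: "real ^ 'n"
    unfolding r1_def by (rule real_less_rsqrt) (use that \<beta>(1) in \<open>simp add: field_simps\<close>)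
  have in_r2: "norm y < r2" if "norm x < r1" "\<alpha> / 2 * (norm (x - y))\<^sup>2 < 2 * M" for x y :: "real ^ 'n"
  proof -
    have "norm (x - y) < sqrt (4 * M / \<alpha>)"
      by (rule real_less_rsqrt) (use that(2) \<alpha>0 in \<open>simp add: field_simps\<close>)
    then show ?thesis using that(1) norm_triangle_sub[of y x] by (simp add: r2_def norm_minus_commute)
  qed
  have "0 \<le> sqrt (4 * M / \<alpha>)" using M(2) \<alpha>0 by simp
  then have r12: "r1 \<le> r2" by (simp add: r2_def)
  define Z where "Z = {0..T} \<times> cball (0 :: real ^ 'n) r2"
  have "compact Z" unfolding Z_def by (intro compact_Times compact_Icc compact_cball)
  moreover have "continuous_on Z w" by (rule continuous_on_subset[OF cont]) (auto simp: Z_def)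
  ultimately have "uniformly_continuous_on Z w" by (rule compact_uniformly_continuous[rotated])
  then obtain \<delta>u where \<delta>u: "\<delta>u > 0" "\<And>z z'. z \<in> Z \<Longrightarrow> z' \<in> Z \<Longrightarrow> dist z z' < \<delta>u \<Longrightarrow> \<bar>w z - w z'\<bar> < \<sigma>"
    using \<sigma>(1) unfolding uniformly_continuous_on_def dist_real_def by (metis abs_minus_commute)
  define d where "d = min \<delta>u \<delta>C"
  have d: "0 < d" "d \<le> \<delta>u" "d \<le> \<delta>C" using \<delta>u(1) \<delta>C by (auto simp: d_def)
  define \<tau> where "\<tau> = d\<^sup>2 / (4 * M)"
  have \<tau>: "0 < \<tau>" "4 * M * \<tau> = d\<^sup>2" using d(1) M(2) by (auto simp: \<tau>_def)
  define f where "f q = w (fst q) - w (snd q) - \<alpha> / 2 * (norm (snd (fst q) - snd (snd q)))\<^sup>2 - (fst (fst q) - fst (snd q))\<^sup>2 / (2 * \<tau>)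
      - \<beta> / 2 * (norm (snd (fst q)))\<^sup>2 - \<eta> / (T - fst (fst q)) - \<eta> / (T - fst (snd q))" for q
  define Q1 where "Q1 = {0..b} \<times> cball (0 :: real ^ 'n) r1"
  define Q2 where "Q2 = {0..b} \<times> cball (0 :: real ^ 'n) r2"
  have Qc: "compact Q1" "compact Q2" unfolding Q1_def Q2_def by (intro compact_Times compact_Icc compact_cball)+
  have QT: "Q1 \<subseteq> {0..<T} \<times> UNIV" "Q2 \<subseteq> {0..<T} \<times> UNIV" using b by (auto simp: Q1_def Q2_def)
  have contf: "continuous_on (Q1 \<times> Q2) f"
    unfolding f_def
    by (intro continuous_intros continuous_on_compose2[OF cont]) (use QT \<tau> in \<open>auto simp: mem_Times_iff subset_iff\<close>)
  have \<Phi>2: "m \<alpha> - \<sigma> < f ((t2, x1), (t2, y1))"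
    using t2(2) \<beta>(3) \<eta>(2) by (simp add: f_def)
  have m\<sigma>: "0 < m \<alpha> - \<sigma>" using m\<epsilon>[OF \<alpha>0] \<sigma> \<epsilon> by simp
  have q2: "((t2, x1), (t2, y1)) \<in> Q1 \<times> Q2"
  proof -
    have "\<beta> / 2 * (norm x1)\<^sup>2 < 2 * M" using \<beta>(3) \<sigma>(1,2) \<epsilon>M M(2) by linarith
    then have x: "norm x1 < r1" by (rule in_r1)
    have "\<alpha> / 2 * (norm (x1 - y1))\<^sup>2 < 2 * M"
      using t2 le2M[of t2 t2 x1 y1] m\<sigma> \<sigma>(1) by simp
    then have "norm y1 < r2" by (rule in_r2[OF x])
    then show ?thesis using x t2(1) b by (auto simp: Q1_def Q2_def)
  qed
  obtain q0 where q0: "q0 \<in> Q1 \<times> Q2" "\<And>q. q \<in> Q1 \<times> Q2 \<Longrightarrow> f q \<le> f q0"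
    using continuous_attains_sup[OF compact_Times[OF Qc] _ contf] q2 by blast
  obtain t0 x0 s0 y0 where q0e: "q0 = ((t0, x0), (s0, y0))" by (metis prod.collapse)
  have ts: "t0 \<in> {0..b}" "s0 \<in> {0..b}" "t0 \<in> {0..T}" "s0 \<in> {0..T}" using q0(1) b by (auto simp: q0e Q1_def Q2_def)
  have f0: "m \<alpha> - \<sigma> < f q0" using q0(2)[OF q2] \<Phi>2 by simp
  have f0e: "f q0 = w (t0, x0) - w (s0, y0) - \<alpha> / 2 * (norm (x0 - y0))\<^sup>2 - (t0 - s0)\<^sup>2 / (2 * \<tau>)
      - \<beta> / 2 * (norm x0)\<^sup>2 - \<eta> / (T - t0) - \<eta> / (T - s0)" by (simp add: f_def q0e)
  have pen: "0 \<le> \<alpha> / 2 * (norm (x0 - y0))\<^sup>2" "0 \<le> (t0 - s0)\<^sup>2 / (2 * \<tau>)" "0 \<le> \<beta> / 2 * (norm x0)\<^sup>2" "0 \<le> \<eta> / (T - t0)" "0 \<le> \<eta> / (T - s0)"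
    using \<alpha>0 \<tau> \<beta>(1) \<eta>(1) ts b by auto
  have w2M: "w (t0, x0) - w (s0, y0) \<le> 2 * M" by (rule le2M[OF ts(3,4)])
  have lt2M: "\<alpha> / 2 * (norm (x0 - y0))\<^sup>2 < 2 * M" "(t0 - s0)\<^sup>2 / (2 * \<tau>) < 2 * M" "\<beta> / 2 * (norm x0)\<^sup>2 < 2 * M"
      "\<eta> / (T - t0) < 2 * M" "\<eta> / (T - s0) < 2 * M"
    using f0 m\<sigma> pen w2M unfolding f0e by linarith+
  have x0: "norm x0 < r1" by (rule in_r1[OF lt2M(3)])
  have y0: "norm y0 < r2" by (rule in_r2[OF x0 lt2M(1)])
  have dt: "\<bar>t0 - s0\<bar> < d"
  proof -
    have "(t0 - s0)\<^sup>2 < 4 * M * \<tau>" using lt2M(2) \<tau>(1) by (simp add: field_simps)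
    then have "\<bar>t0 - s0\<bar>\<^sup>2 < d\<^sup>2" by (simp add: \<tau>(2))
    then show ?thesis by (rule power_less_imp_less_base) (use d(1) in simp)
  qed
  have wt: "\<bar>w (t0, x) - w (s0, x)\<bar> < \<sigma>" if "norm x \<le> r2" for x
    by (rule \<delta>u(2)) (use that ts dt d in \<open>auto simp: Z_def dist_Pair_Pair dist_real_def\<close>)
  have wtx: "\<bar>w (t0, x0) - w (s0, x0)\<bar> < \<sigma>" and wty: "\<bar>w (t0, y0) - w (s0, y0)\<bar> < \<sigma>"
    using wt[of x0] wt[of y0] x0 y0 r12 by auto
  have close: "\<alpha> * (norm (x0 - y0))\<^sup>2 \<le> \<kappa>\<^sup>2"
  proof -
    have "m \<alpha> - 2 * \<sigma> \<le> w (t0, x0) - w (t0, y0) - \<alpha> / 2 * (norm (x0 - y0))\<^sup>2"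
      using f0 pen wty unfolding f0e by linarith
    moreover have "w (t0, x0) - w (t0, y0) - (\<alpha> / 2) / 2 * (norm (x0 - y0))\<^sup>2 \<le> m (\<alpha> / 2)"
      using mub[of "\<alpha> / 2" "(t0, x0, y0)"] \<alpha>0 ts by (simp add: \<Phi>_def S_def)
    ultimately have "\<alpha> / 4 * (norm (x0 - y0))\<^sup>2 \<le> 3 * \<sigma>" using \<alpha>(2) by simp
    then show ?thesis using \<sigma>(3) by simp
  qed
  have close': "norm (x0 - y0) \<le> \<kappa>"
  proof -
    have "1 * (norm (x0 - y0))\<^sup>2 \<le> \<alpha> * (norm (x0 - y0))\<^sup>2" using \<alpha>(1) by (rule mult_right_mono) simp
    then have "(norm (x0 - y0))\<^sup>2 \<le> \<kappa>\<^sup>2" using close by simp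
    then show ?thesis by (rule power2_le_imp_le) (use \<kappa> in simp)
  qed
  have big: "\<epsilon> - \<sigma> \<le> w (t0, x0) - w (s0, y0)" using f0 pen m\<epsilon>[OF \<alpha>0] unfolding f0e by linarith
  have init0: "w (0, x0) - w (0, y0) < \<epsilon> / 4" using \<delta>0(2)[OF le_less_trans[OF close' \<kappa>(3)]] unfolding abs_less_iff by linarith
  have "t0 \<noteq> 0"
  proof
    assume "t0 = 0"
    then show False using init0 big wty \<sigma>(2) \<epsilon> unfolding abs_less_iff by simp
  qed
  moreover have "s0 \<noteq> 0"
  proof
    assume "s0 = 0"
    then show False using init0 big wtx \<sigma>(2) \<epsilon> unfolding abs_less_iff by simp
  qed
  moreover have "t0 \<noteq> b" "s0 \<noteq> b"
  proof -
    have "\<eta> / (T - b) = 2 * M" using \<eta>(1) M(2) by (simp add: b_def)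
    then show "t0 \<noteq> b" "s0 \<noteq> b" using lt2M(4,5) by auto
  qed
  ultimately have ts': "t0 \<in> {0<..<b}" "s0 \<in> {0<..<b}" using ts by auto
  have int: "(t0, x0) \<in> interior Q1" "(s0, y0) \<in> interior Q2"
    using ts' x0 y0 by (simp_all add: Q1_def Q2_def interior_Times)
  define p where "p = \<alpha> *\<^sub>R (x0 - y0)"
  have e16: "0 < \<epsilon> / 16" using \<epsilon> by simp
  have max: "w z - w y - \<alpha> / 2 * (norm (snd z - snd y))\<^sup>2 - (fst z - fst y)\<^sup>2 / (2 * \<tau>)
          - \<beta> / 2 * (norm (snd z))\<^sup>2 - \<eta> / (T - fst z) - \<eta> / (T - fst y)
      \<le> w (t0, x0) - w (s0, y0) - \<alpha> / 2 * (norm (snd (t0, x0) - snd (s0, y0)))\<^sup>2 - (fst (t0, x0) - fst (s0, y0))\<^sup>2 / (2 * \<tau>)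
          - \<beta> / 2 * (norm (snd (t0, x0)))\<^sup>2 - \<eta> / (T - fst (t0, x0)) - \<eta> / (T - fst (s0, y0))"
    if "z \<in> Q1" "y \<in> Q2" for z y
    using q0(2)[of "(z, y)"] that unfolding f_def q0e by simp
  obtain X Y where XY: "form_bounds \<alpha> X Y"
    and ineq: "- (\<epsilon> / 16) \<le> G t0 x0 (w (t0, x0)) (p + \<beta> *\<^sub>R x0) (X + \<beta> *\<^sub>R I) - G s0 y0 (w (s0, y0)) p Y"
  proof (rule interior_maximum[OF cont sub super \<alpha>0 \<tau>(1) less_imp_le[OF \<beta>(1)] less_imp_le[OF \<eta>(1)] Qc(1) QT(1) int(1) _ Qc(2) QT(2) int(2) _ max e16])
    fix X Y
    assume "form_bounds \<alpha> X Y" "- (\<epsilon> / 16) \<le> G (fst (t0, x0)) (snd (t0, x0)) (w (t0, x0)) (\<alpha> *\<^sub>R (snd (t0, x0) - snd (s0, y0)) + \<beta> *\<^sub>R snd (t0, x0)) (X + \<beta> *\<^sub>R mat 1)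
          - G (fst (s0, y0)) (snd (s0, y0)) (w (s0, y0)) (\<alpha> *\<^sub>R (snd (t0, x0) - snd (s0, y0))) Y"
    then show thesis by (intro that[of X Y]) (simp_all add: p_def I_def)
  qed (use ts' in auto)
  have sXY: "X \<in> sym_mats" "Y \<in> sym_mats" using XY by (auto simp: form_bounds_def)
  have nXY: "norm X \<le> B" "norm Y \<le> B" using norm_le_of_form_bounds[OF XY] by (auto simp: B_def)
  have np: "norm p \<le> \<alpha> * \<kappa>" using close' \<alpha>0 by (simp add: p_def)
  have n\<beta>: "norm (\<beta> *\<^sub>R x0) < \<mu>"
  proof -
    have "\<beta> * (norm x0)\<^sup>2 < 4 * M" using lt2M(3) by simp
    then have "\<beta> * (\<beta> * (norm x0)\<^sup>2) < \<beta> * (4 * M)" using \<beta>(1) by (rule mult_strict_left_mono)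
    then have "(\<beta> * norm x0)\<^sup>2 < \<mu>\<^sup>2" using \<beta>(4) by (simp add: power_mult_distrib power2_eq_square mult_ac)
    then have "\<beta> * norm x0 < \<mu>" by (rule power_less_imp_less_base) (use \<mu> in simp)
    then show ?thesis using \<beta>(1) by simp
  qed
  have n\<beta>I: "norm (\<beta> *\<^sub>R I) < \<mu>" using \<beta>(1,5) by simp
  have wR: "w (t0, x0) \<in> {-R..R}" "w (s0, y0) \<in> {-R..R}"
    using M(1)[OF ts(3), of x0] M(1)[OF ts(4), of y0] R0(2) by (auto simp: abs_le_iff)
  have \<alpha>\<kappa>: "0 \<le> \<alpha> * \<kappa>" using \<alpha>0 \<kappa>(1) by simp
  have pR: "p \<in> ball 0 R" "p + \<beta> *\<^sub>R x0 \<in> ball 0 R"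
    using np n\<beta> \<mu>(2) M(2) B norm_triangle_ineq[of p "\<beta> *\<^sub>R x0"] norm_ge_zero[of I] unfolding mem_ball_0 R_def by linarith+
  have Isym: "I \<in> sym_mats" by (simp add: I_def mat_1_sym)
  have XR: "X \<in> sym_mats \<inter> ball 0 R" "Y \<in> sym_mats \<inter> ball 0 R" "X + \<beta> *\<^sub>R I \<in> sym_mats \<inter> ball 0 R"
  proof -
    have "norm X < R" "norm Y < R" "norm (X + \<beta> *\<^sub>R I) < R"
      using nXY n\<beta>I \<mu>(2) M(2) \<alpha>\<kappa> norm_triangle_ineq[of X "\<beta> *\<^sub>R I"] norm_ge_zero[of I] unfolding R_def by linarith+
    moreover have "X + \<beta> *\<^sub>R I \<in> sym_mats" by (intro sym_mats_add sXY sym_mats_scaleR[OF Isym])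
    ultimately show "X \<in> sym_mats \<inter> ball 0 R" "Y \<in> sym_mats \<inter> ball 0 R" "X + \<beta> *\<^sub>R I \<in> sym_mats \<inter> ball 0 R"
      using sXY unfolding Int_iff mem_ball_0 by blast+
  qed
  have c1: "\<bar>G t0 x0 (w (t0, x0)) (p + \<beta> *\<^sub>R x0) (X + \<beta> *\<^sub>R I) - G t0 x0 (w (t0, x0)) p X\<bar> \<le> \<epsilon> / 16"
    by (rule uni) (use ts wR pR XR \<delta>C n\<beta> n\<beta>I \<mu>(3) in auto)
  have c2: "\<bar>G s0 y0 (w (s0, y0)) p Y - G t0 y0 (w (s0, y0)) p Y\<bar> \<le> \<epsilon> / 16"
    by (rule uni) (use ts wR pR XR \<delta>C dt d(3) in auto)
  have le: "w (s0, y0) \<le> w (t0, x0)" using big \<sigma>(2) \<epsilon> by simp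
  have c3: "w (t0, x0) - w (s0, y0) \<le> G t0 y0 (w (s0, y0)) p Y - G t0 y0 (w (t0, x0)) p Y"
    by (rule decreasing[OF ts(3) sXY(2) le])
  have c4: "G t0 x0 (w (t0, x0)) p X - G t0 y0 (w (t0, x0)) p Y \<le> \<epsilon> / 8"
  proof -
    have "\<kappa>\<^sup>2 \<le> \<kappa>" using \<kappa> by (simp add: power2_eq_square mult_left_le_one_le)
    then have "\<alpha> * (norm (x0 - y0))\<^sup>2 + norm (x0 - y0) < \<delta>S" using close close' \<kappa>(4) by linarith
    moreover have "w (t0, x0) \<in> {-M..M}" using M(1)[OF ts(3), of x0] by (auto simp: abs_le_iff)
    ultimately show ?thesis unfolding p_def using \<delta>S(2) ts(3) \<alpha>0 XY by blast
  qed
  show False using ineq c1 c2 c3 c4 big \<sigma>(2) \<epsilon> unfolding abs_le_iff by linarith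
qed

end

section \<open>Reduction to a proper equation\<close>

text \<open>
  The value \<open>\<theta> 0\<close> is arbitrary, so the structure condition says nothing for \<open>x = y\<close>. In that case the upper
  form bound at \<open>h = k\<close> gives \<open>X \<preceq> Y\<close>, and degenerate ellipticity takes over.
\<close>

lemma A2_shift_modulus:
  fixes F :: "'n::finite nonlinearity"
  assumes A0: "A0 T F" and A2: "A2 T F" and R: "0 < R" and e: "0 < e"
  shows "\<exists>\<delta>>0. \<forall>t\<in>{0..T}. \<forall>x y. \<forall>r\<in>{-R..R}. \<forall>\<alpha>>0. \<forall>X Y. form_bounds \<alpha> X Y \<longrightarrow>
        \<alpha> * (norm (x - y))\<^sup>2 + norm (x - y) < \<delta> \<longrightarrow> F t x r (\<alpha> *\<^sub>R (x - y)) X - F t y r (\<alpha> *\<^sub>R (x - y)) Y \<le> e"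
proof -
  obtain \<theta> :: "ennreal \<Rightarrow> ennreal" where \<theta>: "(\<theta> \<longlongrightarrow> 0) (at_right 0)"
    and le: "\<And>t x y r \<alpha> X Y. t \<in> {0..T} \<Longrightarrow> r \<in> {-R..R} \<Longrightarrow> 0 < \<alpha> \<Longrightarrow> X \<in> sym_mats \<Longrightarrow> Y \<in> sym_mats \<Longrightarrow>
        (- 3 * \<alpha>) *\<^sub>R block_mat (mat 1) 0 0 (mat 1) \<preceq> block_mat X 0 0 (- Y) \<Longrightarrow>
        block_mat X 0 0 (- Y) \<preceq> (3 * \<alpha>) *\<^sub>R block_mat (mat 1) (- mat 1) (- mat 1) (mat 1) \<Longrightarrow>
        ereal (F t x r (\<alpha> *\<^sub>R (x - y)) X - F t y r (\<alpha> *\<^sub>R (x - y)) Y)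
          \<le> enn2ereal (\<theta> (ennreal (\<alpha> * (norm (x - y))\<^sup>2 + norm (x - y))))"
    using A2 R unfolding A2_def by metis
  have "\<forall>\<^sub>F s in at_right 0. \<theta> s < ennreal e" by (rule order_tendstoD(2)[OF \<theta>]) (use e in simp)
  then obtain b where b: "0 < b" "\<And>s. 0 < s \<Longrightarrow> s < b \<Longrightarrow> \<theta> s < ennreal e"
    unfolding eventually_at_right[OF zero_less_one] by blast
  define \<delta> where "\<delta> = enn2real (min b 1)"
  have fin: "min b 1 < top" by (simp add: min_less_iff_disj)
  have \<delta>: "0 < \<delta>" "ennreal \<delta> \<le> b"
    using b(1) fin by (auto simp: \<delta>_def enn2real_positive_iff)
  have "F t x r (\<alpha> *\<^sub>R (x - y)) X - F t y r (\<alpha> *\<^sub>R (x - y)) Y \<le> e"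
    if t: "t \<in> {0..T}" and r: "r \<in> {-R..R}" and \<alpha>: "0 < \<alpha>" and fb: "form_bounds \<alpha> X Y"
      and small: "\<alpha> * (norm (x - y))\<^sup>2 + norm (x - y) < \<delta>" for t x y r \<alpha> X Y
  proof (cases "x = y")
    case True
    have s: "X \<in> sym_mats" "Y \<in> sym_mats" using fb by (auto simp: form_bounds_def)
    have "0 \<preceq> Y - X"
      unfolding mat_le_iff
    proof (intro conjI allI)
      show "Y - X - 0 \<in> sym_mats" using s by (simp add: sym_mats_diff)
      fix v
      have "v \<bullet> (X *v v) - v \<bullet> (Y *v v) \<le> 3 * \<alpha> * (norm (v - v))\<^sup>2" using fb unfolding form_bounds_def by blast
      then show "v \<bullet> (0 *v v) \<le> v \<bullet> ((Y - X) *v v)" by (simp add: form_diff)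
    qed
    then have "F t y r (\<alpha> *\<^sub>R (x - y)) X \<le> F t y r (\<alpha> *\<^sub>R (x - y)) (X + (Y - X))"
      using A0 t s sym_mats_diff[OF s(2,1)] unfolding A0_def by blast
    then show ?thesis using True e by simp
  next
    case False
    define a where "a = \<alpha> * (norm (x - y))\<^sup>2 + norm (x - y)"
    have "0 < a" using False \<alpha> by (simp add: a_def add_nonneg_pos)
    moreover have "ennreal a < ennreal \<delta>" using small \<delta>(1) by (intro ennreal_lessI) (simp_all add: a_def)
    ultimately have "0 < ennreal a" "ennreal a < b"
      using less_le_trans[OF _ \<delta>(2)] by simp_all
    then have lt: "\<theta> (ennreal a) < ennreal e" by (rule b(2))
    have s: "X \<in> sym_mats" "Y \<in> sym_mats" using fb by (auto simp: form_bounds_def)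
    have blk: "(- 3 * \<alpha>) *\<^sub>R block_mat (mat 1) 0 0 (mat 1) \<preceq> block_mat X 0 0 (- Y)"
        "block_mat X 0 0 (- Y) \<preceq> (3 * \<alpha>) *\<^sub>R block_mat (mat 1) (- mat 1) (- mat 1) (mat 1)"
      by (rule block_bounds_of_forms[OF s]; use fb in \<open>auto simp: form_bounds_def\<close>)+
    have "ereal (F t x r (\<alpha> *\<^sub>R (x - y)) X - F t y r (\<alpha> *\<^sub>R (x - y)) Y) \<le> enn2ereal (\<theta> (ennreal a))"
      unfolding a_def by (rule le[OF t r \<alpha> s blk])
    also have "\<dots> < enn2ereal (ennreal e)" using lt by (simp add: less_ennreal.rep_eq)
    also have "\<dots> = ereal e" using e by (simp add: enn2ereal_ennreal)
    finally show ?thesis by simp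
  qed
  then show ?thesis using \<delta>(1) by blast
qed

lemma dist_Pair_le: "dist (a, b) (c, d) \<le> dist a c + dist b d"
  unfolding dist_Pair_Pair by (rule sqrt_sum_squares_le_sum) auto

lemma norm_scaleR_diff_le: "norm (a *\<^sub>R v - b *\<^sub>R w) \<le> \<bar>a\<bar> * norm (v - w) + \<bar>a - b\<bar> * norm w"
  for v w :: "'a::real_normed_vector"
proof -
  have "a *\<^sub>R v - b *\<^sub>R w = a *\<^sub>R (v - w) + (a - b) *\<^sub>R w" by (simp add: algebra_simps)
  then show ?thesis using norm_triangle_ineq[of "a *\<^sub>R (v - w)" "(a - b) *\<^sub>R w"] by simp
qed

lemma uniformly_continuous_exp_Icc:
  fixes c T :: real
  assumes "0 < e"
  shows "\<exists>d>0. \<forall>t\<in>{0..T}. \<forall>t'\<in>{0..T}. \<bar>t - t'\<bar> < d \<longrightarrow> \<bar>exp (c * t) - exp (c * t')\<bar> < e"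
proof -
  have "uniformly_continuous_on {0..T} (\<lambda>t. exp (c * t))"
    by (intro compact_uniformly_continuous continuous_intros) auto
  then show ?thesis using assms unfolding uniformly_continuous_on_def dist_real_def by (metis abs_minus_commute)
qed

text \<open>
  With \<open>\<Lambda> = |\<gamma>| + 1\<close> the term \<open>-\<Lambda> r\<close> outweighs \<open>\<gamma>\<close>. The other properties carry over because \<open>exp(\<Lambda>t)\<close> lies
  between \<open>1\<close> and \<open>exp(\<Lambda>T)\<close>, and because the structure condition for \<open>F\<close> with \<open>exp(\<Lambda>t) \<alpha>\<close> is the one for the
  damped equation with \<open>\<alpha>\<close>.
\<close>

lemma proper_equation_damped:
  fixes F :: "'n::finite nonlinearity"
  assumes T: "0 < T" and A: "A0 T F" "A1 T F" "A2 T F" "A3' T F"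
  shows "\<exists>\<Lambda>\<ge>0. proper_equation T (damped \<Lambda> F)"
proof -
  obtain \<gamma> where \<gamma>: "\<And>t x p X u v. t \<in> {0..T} \<Longrightarrow> X \<in> sym_mats \<Longrightarrow> v \<le> u \<Longrightarrow> \<gamma> * (u - v) \<le> F t x v p X - F t x u p X"
    using A(2) unfolding A1_def by blast
  define \<Lambda> where "\<Lambda> = \<bar>\<gamma>\<bar> + 1"
  have \<Lambda>: "0 \<le> \<Lambda>" "1 \<le> \<gamma> + \<Lambda>" by (auto simp: \<Lambda>_def)
  define L where "L = exp (\<Lambda> * T)"
  have L: "1 \<le> L" using \<Lambda> T by (simp add: L_def)
  have E: "0 < exp (\<Lambda> * t)" "exp (\<Lambda> * t) \<le> L" "exp (- \<Lambda> * t) \<le> 1" if "t \<in> {0..T}" for t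
    using that \<Lambda> by (auto simp: L_def intro!: mult_left_mono)
  have inv: "exp (- \<Lambda> * t) * exp (\<Lambda> * t) = 1" for t by (simp add: exp_add[symmetric])
  have scaled: "exp (\<Lambda> * t) * r \<in> {-(L * R)..L * R}" "exp (\<Lambda> * t) *\<^sub>R p \<in> ball 0 (L * R)" "exp (\<Lambda> * t) *\<^sub>R X \<in> ball 0 (L * R) \<inter> sym_mats"
    if "t \<in> {0..T}" "r \<in> {-R..R}" "p \<in> ball 0 R" "X \<in> sym_mats \<inter> ball 0 R" for t r R and X :: "real ^ 'n ^ 'n" and p :: "real ^ 'n"
  proof -
    have b: "\<bar>exp (\<Lambda> * t) * a\<bar> \<le> L * \<bar>a\<bar>" for a using E[OF that(1)] by (simp add: abs_mult mult_right_mono)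
    have "\<bar>r\<bar> \<le> R" using that(2) by (auto simp: abs_le_iff)
    then have "\<bar>exp (\<Lambda> * t) * r\<bar> \<le> L * R" using b[of r] mult_left_mono[of "\<bar>r\<bar>" R L] L by linarith
    then show "exp (\<Lambda> * t) * r \<in> {-(L * R)..L * R}" by (auto simp: abs_le_iff)
    have lt: "exp (\<Lambda> * t) * a < L * R" if "0 \<le> a" "a < R" for a
    proof -
      have "L * a < L * R" using that(2) L by simp
      moreover have "exp (\<Lambda> * t) * a \<le> L * a" using b[of a] that(1) by (simp add: abs_mult)
      ultimately show ?thesis by simp
    qed
    show "exp (\<Lambda> * t) *\<^sub>R p \<in> ball 0 (L * R)" using lt[of "norm p"] that(3) by simp
    show "exp (\<Lambda> * t) *\<^sub>R X \<in> ball 0 (L * R) \<inter> sym_mats" using lt[of "norm X"] that(4) sym_mats_scaleR[of X] by simp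
  qed
  have bounded_F: "\<exists>K\<ge>0. \<forall>t\<in>{0..T}. \<forall>x. \<forall>r\<in>{-R..R}. \<forall>p\<in>ball 0 R. \<forall>X\<in>ball 0 R \<inter> sym_mats. \<bar>F t x r p X\<bar> \<le> K"
    if R: "0 < R" for R
  proof -
    have "bounded ((\<lambda>(t, x, r, p, X). F t x r p X) ` ({0..T} \<times> UNIV \<times> {-R..R} \<times> ball 0 R \<times> (ball 0 R \<inter> sym_mats)))"
      using A(4) R unfolding A3'_def Let_def by blast
    then obtain K where K: "\<forall>q\<in>{0..T} \<times> UNIV \<times> {-R..R} \<times> ball 0 R \<times> (ball 0 R \<inter> sym_mats). \<bar>(\<lambda>(t, x, r, p, X). F t x r p X) q\<bar> \<le> K"
      unfolding bounded_iff by auto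
    have "\<bar>F t x r p X\<bar> \<le> \<bar>K\<bar>" if "t \<in> {0..T}" "r \<in> {-R..R}" "p \<in> ball 0 R" "X \<in> ball 0 R \<inter> sym_mats" for t x r p X
    proof -
      have "(t, x, r, p, X) \<in> {0..T} \<times> UNIV \<times> {-R..R} \<times> ball 0 R \<times> (ball 0 R \<inter> sym_mats)" using that by simp
      from bspec[OF K this] show ?thesis by simp
    qed
    then show ?thesis by (intro exI[of _ "\<bar>K\<bar>"]) auto
  qed
  have "proper_equation T (damped \<Lambda> F)"
  proof
    show "0 < T" by (rule T)
  next
    fix t x p and X :: "real ^ 'n ^ 'n" and u v :: real
    assume a: "t \<in> {0..T}" "X \<in> sym_mats" "v \<le> u"
    let ?D = "F t x (exp (\<Lambda> * t) * v) (exp (\<Lambda> * t) *\<^sub>R p) (exp (\<Lambda> * t) *\<^sub>R X) - F t x (exp (\<Lambda> * t) * u) (exp (\<Lambda> * t) *\<^sub>R p) (exp (\<Lambda> * t) *\<^sub>R X)"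
    have "\<gamma> * (exp (\<Lambda> * t) * u - exp (\<Lambda> * t) * v) \<le> ?D"
      using a by (intro \<gamma> sym_mats_scaleR[of X]) auto
    then have "exp (- \<Lambda> * t) * (\<gamma> * (exp (\<Lambda> * t) * u - exp (\<Lambda> * t) * v)) \<le> exp (- \<Lambda> * t) * ?D"
      by (rule mult_left_mono) simp
    moreover have "exp (- \<Lambda> * t) * (\<gamma> * (exp (\<Lambda> * t) * u - exp (\<Lambda> * t) * v)) = (exp (- \<Lambda> * t) * exp (\<Lambda> * t)) * (\<gamma> * (u - v))"
      by (simp add: algebra_simps)
    ultimately have "\<gamma> * (u - v) \<le> exp (- \<Lambda> * t) * ?D" by (simp only: inv mult_1)
    moreover have "1 * (u - v) \<le> (\<gamma> + \<Lambda>) * (u - v)" using \<Lambda>(2) a(3) by (intro mult_right_mono) auto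
    ultimately show "u - v \<le> damped \<Lambda> F t x v p X - damped \<Lambda> F t x u p X"
      unfolding damped_def by (simp add: algebra_simps)
  next
    fix R e :: real assume R: "0 < R" and e: "0 < e"
    have LR: "0 < L * R" using L R by simp
    obtain \<delta> where \<delta>: "\<delta> > 0" "\<forall>t\<in>{0..T}. \<forall>x y. \<forall>r\<in>{-(L * R)..L * R}. \<forall>\<alpha>>0. \<forall>X Y. form_bounds \<alpha> X Y \<longrightarrow>
        \<alpha> * (norm (x - y))\<^sup>2 + norm (x - y) < \<delta> \<longrightarrow> F t x r (\<alpha> *\<^sub>R (x - y)) X - F t y r (\<alpha> *\<^sub>R (x - y)) Y \<le> e"
      using A2_shift_modulus[OF A(1,3) LR e] by blast
    have "damped \<Lambda> F t x r (\<alpha> *\<^sub>R (x - y)) X - damped \<Lambda> F t y r (\<alpha> *\<^sub>R (x - y)) Y \<le> e"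
      if a: "t \<in> {0..T}" "r \<in> {-R..R}" "0 < \<alpha>" "form_bounds \<alpha> X Y" "\<alpha> * (norm (x - y))\<^sup>2 + norm (x - y) < \<delta> / L" for t x y r \<alpha> X Y
    proof -
      let ?E = "exp (\<Lambda> * t)"
      have Er: "?E * r \<in> {-(L * R)..L * R}"
        using scaled(1)[OF a(1,2), of 0 0] R subspace_0[OF subspace_sym_mats] by simp
      have fb: "form_bounds (?E * \<alpha>) (?E *\<^sub>R X) (?E *\<^sub>R Y)"
        unfolding form_bounds_def
      proof (intro conjI allI)
        show "?E *\<^sub>R X \<in> sym_mats" "?E *\<^sub>R Y \<in> sym_mats"
          using a(4) sym_mats_scaleR unfolding form_bounds_def by blast+
        fix h k
        have eq: "h \<bullet> (?E *\<^sub>R X *v h) - k \<bullet> (?E *\<^sub>R Y *v k) = ?E * (h \<bullet> (X *v h) - k \<bullet> (Y *v k))"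
          by (simp add: scaleR_matrix_vector_assoc[symmetric] algebra_simps)
        have "?E * (- 3 * \<alpha> * ((norm h)\<^sup>2 + (norm k)\<^sup>2)) \<le> ?E * (h \<bullet> (X *v h) - k \<bullet> (Y *v k))"
          "?E * (h \<bullet> (X *v h) - k \<bullet> (Y *v k)) \<le> ?E * (3 * \<alpha> * (norm (h - k))\<^sup>2)"
          using a(4) unfolding form_bounds_def by (intro mult_left_mono; simp)+
        then show "- 3 * (?E * \<alpha>) * ((norm h)\<^sup>2 + (norm k)\<^sup>2) \<le> h \<bullet> (?E *\<^sub>R X *v h) - k \<bullet> (?E *\<^sub>R Y *v k)"
          "h \<bullet> (?E *\<^sub>R X *v h) - k \<bullet> (?E *\<^sub>R Y *v k) \<le> 3 * (?E * \<alpha>) * (norm (h - k))\<^sup>2"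
          unfolding eq by (simp_all only: mult_ac)
      qed
      have "?E * \<alpha> * (norm (x - y))\<^sup>2 + norm (x - y) \<le> L * (\<alpha> * (norm (x - y))\<^sup>2 + norm (x - y))"
      proof -
        have "?E * (\<alpha> * (norm (x - y))\<^sup>2) \<le> L * (\<alpha> * (norm (x - y))\<^sup>2)" using E[OF a(1)] a(3) by (intro mult_right_mono) auto
        moreover have "1 * norm (x - y) \<le> L * norm (x - y)" using L by (intro mult_right_mono) auto
        ultimately show ?thesis by (simp add: distrib_left mult.assoc)
      qed
      also have "\<dots> < \<delta>" using a(5) L by (simp add: field_simps)
      finally have sm: "?E * \<alpha> * (norm (x - y))\<^sup>2 + norm (x - y) < \<delta>" .
      have "0 < ?E * \<alpha>" using a(3) by simp
      then have *: "F t x (?E * r) ((?E * \<alpha>) *\<^sub>R (x - y)) (?E *\<^sub>R X) - F t y (?E * r) ((?E * \<alpha>) *\<^sub>R (x - y)) (?E *\<^sub>R Y) \<le> e"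
        using \<delta>(2) a(1) Er fb sm by blast
      have "damped \<Lambda> F t x r (\<alpha> *\<^sub>R (x - y)) X - damped \<Lambda> F t y r (\<alpha> *\<^sub>R (x - y)) Y
        = exp (- \<Lambda> * t) * (F t x (?E * r) ((?E * \<alpha>) *\<^sub>R (x - y)) (?E *\<^sub>R X) - F t y (?E * r) ((?E * \<alpha>) *\<^sub>R (x - y)) (?E *\<^sub>R Y))"
        by (simp add: damped_def right_diff_distrib)
      also have "\<dots> \<le> exp (- \<Lambda> * t) * e" using * by (intro mult_left_mono) auto
      also have "\<dots> \<le> e" using E(3)[OF a(1)] e by (intro mult_left_le_one_le) auto
      finally show ?thesis .
    qed
    then show "\<exists>\<delta>>0. \<forall>t\<in>{0..T}. \<forall>x y. \<forall>r\<in>{-R..R}. \<forall>\<alpha>>0. \<forall>X Y. form_bounds \<alpha> X Y \<longrightarrow>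
        \<alpha> * (norm (x - y))\<^sup>2 + norm (x - y) < \<delta> \<longrightarrow> damped \<Lambda> F t x r (\<alpha> *\<^sub>R (x - y)) X - damped \<Lambda> F t y r (\<alpha> *\<^sub>R (x - y)) Y \<le> e"
      using \<delta>(1) L by (intro exI[of _ "\<delta> / L"]) auto
  next
    fix R e :: real assume R: "0 < R" and e: "0 < e"
    define R' where "R' = L * R"
    have R': "0 < R'" using L R by (simp add: R'_def)
    define S where "S = {0..T} \<times> (UNIV :: (real ^ 'n) set) \<times> {-R'..R'} \<times> ball (0 :: real ^ 'n) R' \<times> (ball (0 :: real ^ 'n ^ 'n) R' \<inter> sym_mats)"
    define FF where "FF = (\<lambda>(t, x, r, p, X). F t x r p X)"
    have "uniformly_continuous_on S FF" using A(4) R' unfolding A3'_def Let_def S_def FF_def by blast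
    then obtain \<delta>1 where \<delta>1: "\<delta>1 > 0" "\<And>q q'. q \<in> S \<Longrightarrow> q' \<in> S \<Longrightarrow> dist q q' < \<delta>1 \<Longrightarrow> \<bar>FF q - FF q'\<bar> < e / 3"
      unfolding uniformly_continuous_on_def dist_real_def using e
      by (metis (no_types, lifting) abs_minus_commute dist_commute divide_pos_pos zero_less_numeral)
    obtain K where K: "0 \<le> K" "\<forall>t\<in>{0..T}. \<forall>x. \<forall>r\<in>{-R'..R'}. \<forall>p\<in>ball 0 R'. \<forall>X\<in>ball 0 R' \<inter> sym_mats. \<bar>F t x r p X\<bar> \<le> K"
      using bounded_F[OF R'] by blast
    have pos: "0 < \<delta>1 / (12 * (R + 1))" "0 < e / (3 * (K + 1))" using \<delta>1(1) R e K(1) by auto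
    obtain d2 where d2: "d2 > 0" "\<forall>t\<in>{0..T}. \<forall>t'\<in>{0..T}. \<bar>t - t'\<bar> < d2 \<longrightarrow> \<bar>exp (\<Lambda> * t) - exp (\<Lambda> * t')\<bar> < \<delta>1 / (12 * (R + 1))"
      using uniformly_continuous_exp_Icc[OF pos(1), of T \<Lambda>] by blast
    obtain d3 where d3: "d3 > 0" "\<forall>t\<in>{0..T}. \<forall>t'\<in>{0..T}. \<bar>t - t'\<bar> < d3 \<longrightarrow> \<bar>exp (- \<Lambda> * t) - exp (- \<Lambda> * t')\<bar> < e / (3 * (K + 1))"
      using uniformly_continuous_exp_Icc[OF pos(2), of T "- \<Lambda>"] by blast
    define \<delta> where "\<delta> = min (min d2 d3) (min (\<delta>1 / (8 * (L + 1))) (e / (3 * (\<Lambda> + 1))))"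
    have \<delta>: "0 < \<delta>" "\<delta> \<le> d2" "\<delta> \<le> d3" "8 * (L + 1) * \<delta> \<le> \<delta>1" "3 * (\<Lambda> + 1) * \<delta> \<le> e"
    proof -
      show "0 < \<delta>" using d2(1) d3(1) \<delta>1(1) L e \<Lambda>(1) by (simp add: \<delta>_def)
      show "\<delta> \<le> d2" "\<delta> \<le> d3" by (simp_all add: \<delta>_def)
      have "\<delta> \<le> \<delta>1 / (8 * (L + 1))" "\<delta> \<le> e / (3 * (\<Lambda> + 1))" by (simp_all add: \<delta>_def)
      then show "8 * (L + 1) * \<delta> \<le> \<delta>1" "3 * (\<Lambda> + 1) * \<delta> \<le> e" using L \<Lambda>(1) by (simp_all add: pos_le_divide_eq mult.commute)
    qed
    have main: "\<bar>damped \<Lambda> F t x r p X - damped \<Lambda> F t' x' r' p' X'\<bar> \<le> e"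
      if a: "t \<in> {0..T}" "t' \<in> {0..T}" "r \<in> {-R..R}" "r' \<in> {-R..R}" "p \<in> ball 0 R" "p' \<in> ball 0 R"
        "X \<in> sym_mats \<inter> ball 0 R" "X' \<in> sym_mats \<inter> ball 0 R"
        and d: "\<bar>t - t'\<bar> < \<delta>" "norm (x - x') < \<delta>" "\<bar>r - r'\<bar> < \<delta>" "norm (p - p') < \<delta>" "norm (X - X') < \<delta>" for t t' x x' r r' p p' X X'
    proof -
      define E1 E2 where "E1 = exp (\<Lambda> * t)" and "E2 = exp (\<Lambda> * t')"
      define e1 e2 where "e1 = exp (- \<Lambda> * t)" and "e2 = exp (- \<Lambda> * t')"
      define f f' where "f = F t x (E1 * r) (E1 *\<^sub>R p) (E1 *\<^sub>R X)" and "f' = F t' x' (E2 * r') (E2 *\<^sub>R p') (E2 *\<^sub>R X')"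
      have in1: "(t, x, E1 * r, E1 *\<^sub>R p, E1 *\<^sub>R X) \<in> S" "(t', x', E2 * r', E2 *\<^sub>R p', E2 *\<^sub>R X') \<in> S"
        using scaled[OF a(1,3,5,7)] scaled[OF a(2,4,6,8)] a(1,2) unfolding S_def R'_def E1_def E2_def by blast+
      have E12: "\<bar>E1 - E2\<bar> * (R + 1) \<le> \<delta>1 / 12"
      proof -
        have "\<bar>E1 - E2\<bar> < \<delta>1 / (12 * (R + 1))" using d2(2) a(1,2) d(1) \<delta>(2) unfolding E1_def E2_def by force
        then have "\<bar>E1 - E2\<bar> * (12 * (R + 1)) < \<delta>1" using R by (simp add: pos_less_divide_eq)
        moreover have "\<bar>E1 - E2\<bar> * (12 * (R + 1)) = 12 * (\<bar>E1 - E2\<bar> * (R + 1))" by (simp only: mult_ac)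
        ultimately show ?thesis by linarith
      qed
      have sc: "norm (E1 *\<^sub>R v - E2 *\<^sub>R v') < L * \<delta> + \<delta>1 / 12" if "norm (v - v') < \<delta>" "norm v' \<le> R" for v v' :: "'c::real_normed_vector"
      proof -
        have "norm (E1 *\<^sub>R v - E2 *\<^sub>R v') \<le> \<bar>E1\<bar> * norm (v - v') + \<bar>E1 - E2\<bar> * norm v'" by (rule norm_scaleR_diff_le)
        also have "\<bar>E1\<bar> * norm (v - v') < L * \<delta>"
          using E[OF a(1)] that(1) L unfolding E1_def by (intro mult_le_less_imp_less) auto
        also have "\<bar>E1 - E2\<bar> * norm v' \<le> \<delta>1 / 12"
        proof -
          have "\<bar>E1 - E2\<bar> * norm v' \<le> \<bar>E1 - E2\<bar> * (R + 1)" using that(2) by (intro mult_left_mono) auto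
          then show ?thesis using E12 by simp
        qed
        finally show ?thesis by simp
      qed
      have "dist (t, x, E1 * r, E1 *\<^sub>R p, E1 *\<^sub>R X) (t', x', E2 * r', E2 *\<^sub>R p', E2 *\<^sub>R X')
        \<le> dist t t' + (dist x x' + (dist (E1 * r) (E2 * r') + (dist (E1 *\<^sub>R p) (E2 *\<^sub>R p') + dist (E1 *\<^sub>R X) (E2 *\<^sub>R X'))))"
        by (intro order_trans[OF dist_Pair_le] add_left_mono) (rule order_refl)
      also have "\<dots> < \<delta> + (\<delta> + ((L * \<delta> + \<delta>1 / 12) + ((L * \<delta> + \<delta>1 / 12) + (L * \<delta> + \<delta>1 / 12))))"
      proof (intro add_strict_mono)
        show "dist (E1 * r) (E2 * r') < L * \<delta> + \<delta>1 / 12"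
          using sc[of r r'] d(3) a(4) by (simp add: dist_real_def abs_le_iff)
        show "dist (E1 *\<^sub>R p) (E2 *\<^sub>R p') < L * \<delta> + \<delta>1 / 12"
          using sc[of p p'] d(4) a(6) by (simp add: dist_norm)
        show "dist (E1 *\<^sub>R X) (E2 *\<^sub>R X') < L * \<delta> + \<delta>1 / 12"
          using sc[of X X'] d(5) a(8) by (simp add: dist_norm)
      qed (use d in \<open>simp_all add: dist_norm\<close>)
      also have "\<dots> \<le> \<delta>1"
      proof -
        have "8 * (L * \<delta>) + 8 * \<delta> \<le> \<delta>1" using \<delta>(4) by (simp add: algebra_simps)
        moreover have "0 \<le> L * \<delta>" using L \<delta>(1) by simp
        ultimately show ?thesis using \<delta>(1) \<delta>1(1) by linarith
      qed
      finally have "\<bar>FF (t, x, E1 * r, E1 *\<^sub>R p, E1 *\<^sub>R X) - FF (t', x', E2 * r', E2 *\<^sub>R p', E2 *\<^sub>R X')\<bar> < e / 3"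
        by (rule \<delta>1(2)[OF in1])
      then have ff: "\<bar>f - f'\<bar> < e / 3" by (simp add: FF_def f_def f'_def)
      have fK: "\<bar>f'\<bar> \<le> K" unfolding f'_def E2_def
        using K(2) a(2) scaled[OF a(2,4,6,8), folded R'_def] by blast
      have "\<bar>e1 * f - e2 * f'\<bar> \<le> \<bar>e1\<bar> * \<bar>f - f'\<bar> + \<bar>e1 - e2\<bar> * \<bar>f'\<bar>"
        using norm_scaleR_diff_le[of e1 f e2 f'] by simp
      also have "\<bar>e1\<bar> * \<bar>f - f'\<bar> \<le> 1 * (e / 3)"
        using E(3)[OF a(1)] ff unfolding e1_def by (intro mult_mono) auto
      also have "\<bar>e1 - e2\<bar> * \<bar>f'\<bar> \<le> e / 3"
      proof -
        have "\<bar>e1 - e2\<bar> < e / (3 * (K + 1))" using d3(2) a(1,2) d(1) \<delta>(3) unfolding e1_def e2_def by force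
        then have "\<bar>e1 - e2\<bar> * (3 * (K + 1)) < e" using K(1) by (simp add: pos_less_divide_eq)
        moreover have "\<bar>e1 - e2\<bar> * (3 * (K + 1)) = 3 * (\<bar>e1 - e2\<bar> * (K + 1))" by (simp only: mult_ac)
        moreover have "\<bar>e1 - e2\<bar> * \<bar>f'\<bar> \<le> \<bar>e1 - e2\<bar> * (K + 1)" using fK by (intro mult_left_mono) auto
        ultimately show ?thesis by linarith
      qed
      finally have 1: "\<bar>e1 * f - e2 * f'\<bar> \<le> 2 * e / 3" by simp
      have "\<bar>\<Lambda> * r - \<Lambda> * r'\<bar> \<le> e / 3"
      proof -
        have "\<bar>\<Lambda> * r - \<Lambda> * r'\<bar> = \<Lambda> * \<bar>r - r'\<bar>" using \<Lambda>(1) by (simp add: right_diff_distrib[symmetric] abs_mult)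
        also have "\<dots> \<le> (\<Lambda> + 1) * \<delta>" using d(3) \<Lambda>(1) by (intro mult_mono) auto
        finally show ?thesis using \<delta>(5) unfolding mult.assoc by linarith
      qed
      then show ?thesis using 1 unfolding damped_def f_def f'_def e1_def e2_def E1_def E2_def abs_le_iff by linarith
    qed
    show "\<exists>\<delta>>0. \<forall>t\<in>{0..T}. \<forall>t'\<in>{0..T}. \<forall>x x'. \<forall>r\<in>{-R..R}. \<forall>r'\<in>{-R..R}.
        \<forall>p\<in>ball 0 R. \<forall>p'\<in>ball 0 R. \<forall>X\<in>sym_mats \<inter> ball 0 R. \<forall>X'\<in>sym_mats \<inter> ball 0 R.
        \<bar>t - t'\<bar> < \<delta> \<longrightarrow> norm (x - x') < \<delta> \<longrightarrow> \<bar>r - r'\<bar> < \<delta> \<longrightarrow> norm (p - p') < \<delta> \<longrightarrow> norm (X - X') < \<delta> \<longrightarrow>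
        \<bar>damped \<Lambda> F t x r p X - damped \<Lambda> F t' x' r' p' X'\<bar> \<le> e"
      by (intro exI[of _ \<delta>] conjI ballI allI impI \<delta>(1)) (rule main; assumption)
  next
    fix R :: real assume R: "0 < R"
    have LR: "0 < L * R" using L R by simp
    obtain K where K: "0 \<le> K" "\<forall>t\<in>{0..T}. \<forall>x. \<forall>r\<in>{-(L * R)..L * R}. \<forall>p\<in>ball 0 (L * R). \<forall>X\<in>ball 0 (L * R) \<inter> sym_mats. \<bar>F t x r p X\<bar> \<le> K"
      using bounded_F[OF LR] by blast
    have "\<bar>damped \<Lambda> F t x r p X\<bar> \<le> K + \<Lambda> * R"
      if a: "t \<in> {0..T}" "r \<in> {-R..R}" "p \<in> ball 0 R" "X \<in> sym_mats \<inter> ball 0 R" for t x r p X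
    proof -
      have "\<bar>F t x (exp (\<Lambda> * t) * r) (exp (\<Lambda> * t) *\<^sub>R p) (exp (\<Lambda> * t) *\<^sub>R X)\<bar> \<le> K"
        using K(2) a(1) scaled[OF a] by blast
      then have "\<bar>exp (- \<Lambda> * t) * F t x (exp (\<Lambda> * t) * r) (exp (\<Lambda> * t) *\<^sub>R p) (exp (\<Lambda> * t) *\<^sub>R X)\<bar> \<le> 1 * K"
        using E(3)[OF a(1)] unfolding abs_mult by (intro mult_mono) auto
      moreover have "\<bar>\<Lambda> * r\<bar> \<le> \<Lambda> * R" using a(2) \<Lambda>(1) by (auto simp: abs_mult abs_le_iff intro!: mult_left_mono)
      ultimately show ?thesis unfolding damped_def by linarith
    qed
    then show "\<exists>K. \<forall>t\<in>{0..T}. \<forall>x. \<forall>r\<in>{-R..R}. \<forall>p\<in>ball 0 R. \<forall>X\<in>sym_mats \<inter> ball 0 R. \<bar>damped \<Lambda> F t x r p X\<bar> \<le> K"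
      by blast
  qed
  then show ?thesis using \<Lambda>(1) by blast
qed

lemma uniformly_continuous_of_space_time_moduli:
  fixes w :: "real \<times> (real ^ 'n::finite) \<Rightarrow> real"
  assumes space: "\<And>\<epsilon>. 0 < \<epsilon> \<Longrightarrow> \<exists>\<alpha>>0. \<forall>t\<in>{0..T}. \<forall>x y. w (t, x) - w (t, y) \<le> \<epsilon> + \<alpha> / 2 * (norm (x - y))\<^sup>2"
    and time: "\<And>\<epsilon>. 0 < \<epsilon> \<Longrightarrow> \<exists>K\<ge>0. \<forall>s\<in>{0..T}. \<forall>t\<in>{s..T}. \<forall>x. w (t, x) - w (s, x) \<le> \<epsilon> + K * (t - s)"
      "\<And>\<epsilon>. 0 < \<epsilon> \<Longrightarrow> \<exists>K\<ge>0. \<forall>s\<in>{0..T}. \<forall>t\<in>{s..T}. \<forall>x. w (s, x) - w (t, x) \<le> \<epsilon> + K * (t - s)"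
  shows "uniformly_continuous_on ({0..T} \<times> UNIV) w"
  unfolding uniformly_continuous_on_def
proof (intro allI impI)
  fix e :: real assume e: "0 < e"
  then have e8: "0 < e / 8" by simp
  obtain \<alpha> where \<alpha>: "\<alpha> > 0" "\<And>t x y. t \<in> {0..T} \<Longrightarrow> w (t, x) - w (t, y) \<le> e / 8 + \<alpha> / 2 * (norm (x - y))\<^sup>2"
    using space[OF e8] by blast
  obtain K1 K2 where K: "0 \<le> K1" "0 \<le> K2" "\<And>s t x. s \<in> {0..T} \<Longrightarrow> t \<in> {s..T} \<Longrightarrow> w (t, x) - w (s, x) \<le> e / 8 + K1 * (t - s)"
    "\<And>s t x. s \<in> {0..T} \<Longrightarrow> t \<in> {s..T} \<Longrightarrow> w (s, x) - w (t, x) \<le> e / 8 + K2 * (t - s)"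
    using time(1)[OF e8] time(2)[OF e8] by blast
  define C where "C = \<alpha> / 2 + K1 + K2"
  have C: "0 < C" "\<alpha> / 2 \<le> C" "K1 \<le> C" "K2 \<le> C" using \<alpha>(1) K(1,2) by (auto simp: C_def)
  define d where "d = min 1 (e / (8 * C))"
  have d: "0 < d" "d \<le> 1" "C * d \<le> e / 8"
  proof -
    have "d \<le> e / (8 * C)" by (simp add: d_def)
    then have "d * (8 * C) \<le> e" using C(1) by (simp add: pos_le_divide_eq)
    then show "C * d \<le> e / 8" by (simp add: mult.commute mult.left_commute)
  qed (use e C in \<open>auto simp: d_def\<close>)
  show "\<exists>d>0. \<forall>z\<in>{0..T} \<times> UNIV. \<forall>z'\<in>{0..T} \<times> UNIV. dist z' z < d \<longrightarrow> dist (w z') (w z) < e"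
  proof (intro exI[of _ d] conjI ballI impI d(1))
    fix z z' :: "real \<times> (real ^ 'n)"
    assume z: "z \<in> {0..T} \<times> UNIV" "z' \<in> {0..T} \<times> UNIV" and dz: "dist z' z < d"
    obtain t x where zt: "z = (t, x)" by (cases z)
    obtain s y where zs: "z' = (s, y)" by (cases z')
    have ts: "t \<in> {0..T}" "s \<in> {0..T}" using z by (auto simp: zt zs)
    have dd: "\<bar>s - t\<bar> < d" "norm (x - y) < d"
      using dz dist_fst_le[of z' z] dist_snd_le[of z' z] by (auto simp: zt zs dist_norm norm_minus_commute)
    have sp: "\<alpha> / 2 * (norm (x - y))\<^sup>2 \<le> e / 8"
    proof -
      have "(norm (x - y))\<^sup>2 \<le> d * 1" unfolding power2_eq_square using dd d by (intro mult_mono) auto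
      then have "\<alpha> / 2 * (norm (x - y))\<^sup>2 \<le> C * d" using C \<alpha>(1) by (intro mult_mono) auto
      then show ?thesis using d(3) by simp
    qed
    have tm: "K1 * \<bar>s - t\<bar> \<le> e / 8" "K2 * \<bar>s - t\<bar> \<le> e / 8"
    proof -
      have "K1 * \<bar>s - t\<bar> \<le> C * d" "K2 * \<bar>s - t\<bar> \<le> C * d" using C K dd by (intro mult_mono; simp)+
      then show "K1 * \<bar>s - t\<bar> \<le> e / 8" "K2 * \<bar>s - t\<bar> \<le> e / 8" using d(3) by auto
    qed
    have 1: "\<bar>w (s, x) - w (s, y)\<bar> \<le> e / 4"
      using \<alpha>(2)[OF ts(2), of x y] \<alpha>(2)[OF ts(2), of y x] sp unfolding norm_minus_commute[of y x] by (intro abs_leI) linarith+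
    have 2: "\<bar>w (s, x) - w (t, x)\<bar> \<le> e / 4"
    proof (cases "s \<le> t")
      case True
      then have eq: "\<bar>s - t\<bar> = t - s" and t: "t \<in> {s..T}" using ts by auto
      show ?thesis using K(3)[OF ts(2) t, of x] K(4)[OF ts(2) t, of x] tm unfolding eq by (intro abs_leI) linarith+
    next
      case False
      then have eq: "\<bar>s - t\<bar> = s - t" and s: "s \<in> {t..T}" using ts by auto
      show ?thesis using K(3)[OF ts(1) s, of x] K(4)[OF ts(1) s, of x] tm unfolding eq by (intro abs_leI) linarith+
    qed
    show "dist (w z') (w z) < e" using 1 2 e unfolding zt zs dist_real_def by linarith
  qed
qed

lemma uniformly_continuous_on_exp_times:
  fixes w :: "real \<times> (real ^ 'n::finite) \<Rightarrow> real"
  assumes w: "uniformly_continuous_on ({0..T} \<times> UNIV) w" and M: "\<And>z. z \<in> {0..T} \<times> UNIV \<Longrightarrow> \<bar>w z\<bar> \<le> M"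
    and c: "0 \<le> c"
  shows "uniformly_continuous_on ({0..T} \<times> UNIV) (\<lambda>z. exp (c * fst z) * w z)"
  unfolding uniformly_continuous_on_def
proof (intro allI impI)
  fix e :: real assume e: "0 < e"
  define L where "L = exp (c * T)"
  define M' where "M' = \<bar>M\<bar> + 1"
  have M': "0 < M'" by (simp add: M'_def)
  have L: "0 < L" by (simp add: L_def)
  obtain d1 where d1: "d1 > 0" "\<And>z z'. z \<in> {0..T} \<times> UNIV \<Longrightarrow> z' \<in> {0..T} \<times> UNIV \<Longrightarrow> dist z' z < d1 \<Longrightarrow> \<bar>w z' - w z\<bar> < e / (2 * L)"
    using w[unfolded uniformly_continuous_on_def, rule_format, of "e / (2 * L)"] e L by (auto simp: dist_real_def)
  have "0 < e / (2 * M')" using e M' by simp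
  then obtain d2 where d2: "d2 > 0" "\<forall>t\<in>{0..T}. \<forall>t'\<in>{0..T}. \<bar>t - t'\<bar> < d2 \<longrightarrow> \<bar>exp (c * t) - exp (c * t')\<bar> < e / (2 * M')"
    using uniformly_continuous_exp_Icc by blast
  show "\<exists>d>0. \<forall>z\<in>{0..T} \<times> UNIV. \<forall>z'\<in>{0..T} \<times> UNIV. dist z' z < d \<longrightarrow>
      dist (exp (c * fst z') * w z') (exp (c * fst z) * w z) < e"
  proof (intro exI[of _ "min d1 d2"] conjI ballI impI)
    fix z z' :: "real \<times> (real ^ 'n)"
    assume z: "z \<in> {0..T} \<times> UNIV" "z' \<in> {0..T} \<times> UNIV" and dz: "dist z' z < min d1 d2"
    have ts: "fst z \<in> {0..T}" "fst z' \<in> {0..T}" using z by auto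
    have "\<bar>fst z' - fst z\<bar> < d2" using dz dist_fst_le[of z' z] by (simp add: dist_real_def)
    then have "\<bar>exp (c * fst z') - exp (c * fst z)\<bar> < e / (2 * M')" using d2(2) ts by blast
    then have "\<bar>exp (c * fst z') - exp (c * fst z)\<bar> * M' < e / 2" using M' by (simp add: field_simps)
    moreover have "\<bar>exp (c * fst z') - exp (c * fst z)\<bar> * \<bar>w z\<bar> \<le> \<bar>exp (c * fst z') - exp (c * fst z)\<bar> * M'"
      using M[OF z(1)] by (intro mult_left_mono) (auto simp: M'_def)
    moreover have "\<bar>exp (c * fst z')\<bar> * \<bar>w z' - w z\<bar> \<le> L * (e / (2 * L))"
      using d1(2)[OF z] dz ts c by (intro mult_mono) (auto simp: L_def intro!: mult_left_mono)
    moreover have "L * (e / (2 * L)) = e / 2" using L by simp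
    moreover have "\<bar>exp (c * fst z') * w z' - exp (c * fst z) * w z\<bar> \<le> \<bar>exp (c * fst z')\<bar> * \<bar>w z' - w z\<bar> + \<bar>exp (c * fst z') - exp (c * fst z)\<bar> * \<bar>w z\<bar>"
      using norm_scaleR_diff_le[of "exp (c * fst z')" "w z'" "exp (c * fst z)" "w z"] by simp
    ultimately show "dist (exp (c * fst z') * w z') (exp (c * fst z) * w z) < e" unfolding dist_real_def by linarith
  qed (use d1 d2 in auto)
qed

theorem corollary1:
  fixes T :: real
    and F :: "'n::finite nonlinearity"
    and u :: "real \<times> (real ^ 'n) \<Rightarrow> real"
  assumes "T > 0"
    and "A0 T F" and "A1 T F" and "A2 T F" and "A3' T F"
    and "bounded (u ` ({0..T} \<times> UNIV))"
    and "continuous_on ({0..T} \<times> UNIV) u"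
    and "viscosity_solution F ({0<..<T} \<times> UNIV) u"
    and "bounded (range (\<lambda>x. u (0, x)))"
    and "uniformly_continuous_on UNIV (\<lambda>x. u (0, x))"
  shows "bounded (u ` ({0..T} \<times> UNIV)) \<and> uniformly_continuous_on ({0..T} \<times> UNIV) u"
proof -
  obtain \<Lambda> where \<Lambda>: "0 \<le> \<Lambda>" "proper_equation T (damped \<Lambda> F)"
    using proper_equation_damped[OF assms(1-5)] by blast
  interpret proper_equation T "damped \<Lambda> F" by (rule \<Lambda>(2))
  define w where "w z = exp (- \<Lambda> * fst z) * u z" for z
  obtain M0 where M0: "\<And>z. z \<in> {0..T} \<times> UNIV \<Longrightarrow> \<bar>u z\<bar> \<le> M0"
    using assms(6) unfolding bounded_iff by auto
  define M where "M = \<bar>M0\<bar> + 1"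
  have M1: "1 \<le> M" by (simp add: M_def)
  have wM: "\<bar>w z\<bar> \<le> M" if "z \<in> {0..T} \<times> UNIV" for z
  proof -
    have "exp (- \<Lambda> * fst z) \<le> 1" using \<Lambda>(1) that by auto
    then have "\<bar>w z\<bar> \<le> 1 * \<bar>u z\<bar>" unfolding w_def abs_mult by (intro mult_right_mono) auto
    then show ?thesis using M0[OF that] by (simp add: M_def)
  qed
  have wM': "\<bar>w (t, x)\<bar> \<le> M" if "t \<in> {0..T}" for t x using wM that by simp
  have cont: "continuous_on ({0..T} \<times> UNIV) w"
    unfolding w_def by (intro continuous_intros assms(7))
  have sub: "jet_subsolution (damped \<Lambda> F) ({0<..<T} \<times> UNIV) w"
    unfolding w_def using assms(8) by (intro jet_subsolution_damped) (simp add: viscosity_solution_def)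
  have "jet_subsolution (damped \<Lambda> (reflected F)) ({0<..<T} \<times> UNIV) (\<lambda>z. exp (- \<Lambda> * fst z) * (- u z))"
    using assms(8) by (intro jet_subsolution_damped viscosity_subsolution_reflected) (simp add: viscosity_solution_def)
  then have super: "jet_subsolution (reflected (damped \<Lambda> F)) ({0<..<T} \<times> UNIV) (\<lambda>z. - w z)"
    by (simp add: reflected_damped w_def)
  have init: "uniformly_continuous_on UNIV (\<lambda>x. w (0, x))" using assms(10) by (simp add: w_def)
  have space: "\<exists>\<alpha>>0. \<forall>t\<in>{0..T}. \<forall>x y. w (t, x) - w (t, y) \<le> \<epsilon> + \<alpha> / 2 * (norm (x - y))\<^sup>2" if "0 < \<epsilon>" for \<epsilon>
    by (rule spatial_modulus[OF cont sub super wM' M1 init that])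
  have bnd: "\<exists>K. \<forall>t\<in>{0..T}. \<forall>x. \<forall>r\<in>{-R..R}. \<forall>p\<in>ball 0 R. \<forall>X\<in>sym_mats \<inter> ball 0 R. damped \<Lambda> F t x r p X \<le> K"
    "\<exists>K. \<forall>t\<in>{0..T}. \<forall>x. \<forall>r\<in>{-R..R}. \<forall>p\<in>ball 0 R. \<forall>X\<in>sym_mats \<inter> ball 0 R. reflected (damped \<Lambda> F) t x r p X \<le> K"
    if R: "0 < R" for R
  proof -
    obtain K where K: "\<forall>t\<in>{0..T}. \<forall>x. \<forall>r\<in>{-R..R}. \<forall>p\<in>ball 0 R. \<forall>X\<in>sym_mats \<inter> ball 0 R. \<bar>damped \<Lambda> F t x r p X\<bar> \<le> K"
      using locally_bounded[OF R] by blast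
    then show "\<exists>K. \<forall>t\<in>{0..T}. \<forall>x. \<forall>r\<in>{-R..R}. \<forall>p\<in>ball 0 R. \<forall>X\<in>sym_mats \<inter> ball 0 R. damped \<Lambda> F t x r p X \<le> K"
      by (meson abs_le_D1)
    have "reflected (damped \<Lambda> F) t x r p X \<le> K" if a: "t \<in> {0..T}" "r \<in> {-R..R}" "p \<in> ball 0 R" "X \<in> sym_mats \<inter> ball 0 R" for t x r p X
    proof -
      have "- r \<in> {-R..R}" "- p \<in> ball 0 R" "- X \<in> sym_mats \<inter> ball 0 R"
        using a sym_mats_minus[of X] by auto
      then have "\<bar>damped \<Lambda> F t x (- r) (- p) (- X)\<bar> \<le> K" using K a(1) by blast
      then show ?thesis by (simp add: reflected_def abs_le_iff)
    qed
    then show "\<exists>K. \<forall>t\<in>{0..T}. \<forall>x. \<forall>r\<in>{-R..R}. \<forall>p\<in>ball 0 R. \<forall>X\<in>sym_mats \<inter> ball 0 R. reflected (damped \<Lambda> F) t x r p X \<le> K"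
      by blast
  qed
  have "uniformly_continuous_on ({0..T} \<times> UNIV) w"
  proof (rule uniformly_continuous_of_space_time_moduli[OF space])
    fix \<epsilon> :: real assume \<epsilon>: "0 < \<epsilon>"
    obtain \<alpha> where \<alpha>: "\<alpha> > 0" "\<And>t x y. t \<in> {0..T} \<Longrightarrow> w (t, x) - w (t, y) \<le> \<epsilon> + \<alpha> / 2 * (norm (x - y))\<^sup>2"
      using space[OF \<epsilon>] by blast
    show "\<exists>K\<ge>0. \<forall>s\<in>{0..T}. \<forall>t\<in>{s..T}. \<forall>x. w (t, x) - w (s, x) \<le> \<epsilon> + K * (t - s)"
      by (rule upper_time_modulus[OF cont sub wM' M1 bnd(1) \<alpha> \<epsilon>])
    have cont': "continuous_on ({0..T} \<times> UNIV) (\<lambda>z. - w z)" by (intro continuous_intros cont)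
    have \<alpha>': "- w (t, x) - - w (t, y) \<le> \<epsilon> + \<alpha> / 2 * (norm (x - y))\<^sup>2" if "t \<in> {0..T}" for t x y
      using \<alpha>(2)[OF that, of y x] by (simp add: norm_minus_commute)
    have "\<exists>K\<ge>0. \<forall>s\<in>{0..T}. \<forall>t\<in>{s..T}. \<forall>x. - w (t, x) - - w (s, x) \<le> \<epsilon> + K * (t - s)"
      by (rule upper_time_modulus[OF cont' super _ M1 bnd(2) \<alpha>(1) \<alpha>' \<epsilon>]) (use wM' in auto)
    then show "\<exists>K\<ge>0. \<forall>s\<in>{0..T}. \<forall>t\<in>{s..T}. \<forall>x. w (s, x) - w (t, x) \<le> \<epsilon> + K * (t - s)" by simp
  qed
  then have "uniformly_continuous_on ({0..T} \<times> UNIV) (\<lambda>z. exp (\<Lambda> * fst z) * w z)"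
    by (rule uniformly_continuous_on_exp_times[OF _ wM \<Lambda>(1)])
  moreover have "exp (\<Lambda> * fst z) * w z = u z" for z
    by (simp add: w_def mult.assoc[symmetric] exp_add[symmetric])
  ultimately show ?thesis using assms(6) by simp
qed

end
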